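(* Let $(\Omega,T)$ be a topologically mixing countable Markov shift endowed with a null recurrent potential $\phi$ satisfying Walters' condition and $P_G(\phi)<+\infty$, and let $\mu$ be the associated invariant measure. Assume that the (non-decreasing) normalizing sequence $(a_n)$ of $(\Omega,T,\mu)$ is regularly varying of index $\alpha$ for some $0<\alpha\le1$. Let $x\in\Omega$ and $B_n:=[x_0^{n-1}]$ for $n\ge1$. Assume that $|\mathcal O(x)\cap[x_0]|<+\infty$ and set $j_{x_0}:=\max\{k\ge0:T^kx\in[x_0]\}$. If $\gamma(\mu(B_n))\,r_{[x_0]}\circ T^{j_{x_0}}$ converges in law under $\mu_{B_n}$, as $n\to+\infty$, to a random variable $W$ whose law is a probability measure $\nu$ on $\mathbb R_+$, then $\nu\in\mathcal G_\alpha$.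
   Context: $\mathcal G_\alpha$ is the set of probability measures $\nu$ on $\mathbb R_+=[0,\infty)$ such that for all $s>t>0$, $$\nu((t,+\infty))\le1\wedge\frac{\sin(\pi\alpha)}{\pi\alpha}t^{-\alpha}\quad\text{and}\quad\nu((t,s])\le\frac{\sin(\pi\alpha)}{\pi\alpha}\big(t^{-\alpha}-s^{-\alpha}\big).$$ Topological Markov shifts. Let $V$ be an at most countable alphabet and $A:V\times V\to\{0,1\}$ a transition matrix. $\Omega=\{x=(x_n)_{n\ge0}\in V^{\mathbb N}: A(x_n,x_{n+1})=1\ \forall n\ge0\}$, $T$ is the left shift, topology given by $d(x,y)=\eta^{\min\{n\ge0:x_n\ne y_n\}}$, $\eta\in(0,1)$ fixed; this is a countable Markov shift (CMS) when $V$ is infinite. A word $v_0^{n-1}=(v_0,\dots,v_{n-1})$ is admissible if $A(v_i,v_{i+1})=1$ for all $i$; $[v_0^{n-1}]=\{x\in\Omega:x_i=v_i,\ 0\le i<n\}$. Topologically mixing: for all $v,w\in V$ there is $N$ such that for all $n\ge N$ there is an admissible path of $n$ steps from $v$ to $w$. $|\mathcal O(x)\cap[v]|$ denotes the number of visits $\#\{k\ge0:T^kx\in[v]\}$. Potentials. $\phi:\Omega\to\mathbb R$ is measurable, $S_n\phi=\sum_{k=0}^{n-1}\phi\circ T^k$, $\mathrm{var}_n(\phi)=\sup\{|\phi(x)-\phi(y)|:x_0^{n-1}=y_0^{n-1}\}$. Walters' condition: for all $k\ge1$, $W_k(\phi):=\sup_{n\ge1}\mathrm{var}_{n+k}(S_n\phi)<\infty$,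 and $W_k(\phi)\to0$ as $k\to\infty$. For measurable $B$, $r_B(x)=\inf\{n\ge1:T^nx\in B\}$. $Z_n(\phi,v)=\sum_{T^nx=x}e^{S_n\phi(x)}\mathbf 1_{[v]}(x)$, $Z_n^*(\phi,v)=\sum_{T^nx=x}e^{S_n\phi(x)}\mathbf 1_{\{r_{[v]}=n\}}(x)\mathbf 1_{[v]}(x)$. $P_G(\phi)=\lim_n\frac1n\log Z_n(\phi,v)$ (independent of $v$), $\lambda_\phi=e^{P_G(\phi)}$. $\phi$ is null recurrent if $\sum_n\lambda_\phi^{-n}Z_n(\phi,v)=\infty$ and $\sum_n n\lambda_\phi^{-n}Z_n^*(\phi,v)=\infty$ for some (all) $v$. Then, with $L_\phi f(x)=\sum_{Ty=x}e^{\phi(y)}f(y)$, there are a continuous $h_\phi>0$ and a conservative measure $\nu_\phi$, finite on cylinders, with $L_\phi h_\phi=\lambda_\phi h_\phi$, $L_\phi^*\nu_\phi=\lambda_\phi\nu_\phi$, $\int h_\phi\,d\nu_\phi=+\infty$; $\mu=h_\phi\nu_\phi$ is a conservative ergodic shift-invariant $\sigma$-finite infinite measure. $(\Omega,T,\mu)$ is pointwise dual ergodic: with $\widehat T$ the transfer operator ($\int f\cdot g\circ T\,d\mu=\int(\widehat Tf)g\,d\mu$), there is a normalizing sequence $(a_n)$ with $\frac1{a_n}\sum_{k=0}^{n-1}\widehat T^kf\to\int f\,d\mu$ $\mu$-a.e. for all $f\in L^1(\mu)$; one has $a_n\sim\frac1{\mu[v]}\sum_{k=1}^n\lambda_\phi^{-k}Z_k(\phi,v)$.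 Scaling. With $a(s)=a_{\lfloor s\rfloor}$ and $a^{\leftarrow}(y)=\inf\{s\ge0:a(s)>y\}$, put $\gamma(s)=1/a^{\leftarrow}(1/s)$. $\mu_B=\mu(\cdot\cap B)/\mu(B)$. *)

theory Defs
  imports "HOL-Probability.Probability"
begin

section \<open>Topological Markov shifts\<close>

text \<open>The alphabet is the whole (countable) type \<open>'v\<close>; \<open>A v w\<close> means that the transition
  from \<open>v\<close> to \<open>w\<close> is allowed.\<close>

definition shift_space :: "('v \<Rightarrow> 'v \<Rightarrow> bool) \<Rightarrow> (nat \<Rightarrow> 'v) set" where
  "shift_space A = {x. \<forall>n. A (x n) (x (Suc n))}"

definition shift :: "(nat \<Rightarrow> 'v) \<Rightarrow> nat \<Rightarrow> 'v" where
  "shift x = (\<lambda>n. x (Suc n))"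

definition shift_dist :: "real \<Rightarrow> (nat \<Rightarrow> 'v) \<Rightarrow> (nat \<Rightarrow> 'v) \<Rightarrow> real" where
  "shift_dist \<eta> x y = (if x = y then 0 else \<eta> ^ (LEAST n. x n \<noteq> y n))"

lemma Metric_space_shift_dist:
  assumes "0 < \<eta>" "\<eta> < 1"
  shows "Metric_space (shift_space A) (shift_dist \<eta>)"
proof
  fix x y z :: "nat \<Rightarrow> 'a"
  have nn: "0 \<le> shift_dist \<eta> u v" for u v :: "nat \<Rightarrow> 'a"
    using assms by (simp add: shift_dist_def)
  have le: "\<eta> ^ n \<le> shift_dist \<eta> u v" if "u n \<noteq> v n" for n and u v :: "nat \<Rightarrow> 'a"
  proof -
    have "u \<noteq> v" using that by blast
    moreover have "(LEAST n. u n \<noteq> v n) \<le> n" using that by (rule Least_le)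
    ultimately show ?thesis
      using assms unfolding shift_dist_def by (simp add: power_decreasing)
  qed
  show "0 \<le> shift_dist \<eta> x y" by (rule nn)
  show "shift_dist \<eta> x y = shift_dist \<eta> y x"
  proof -
    have "(\<lambda>n. x n \<noteq> y n) = (\<lambda>n. y n \<noteq> x n)" by metis
    then show ?thesis unfolding shift_dist_def by metis
  qed
  show "shift_dist \<eta> x y = 0 \<longleftrightarrow> x = y"
    using assms by (simp add: shift_dist_def)
  show "shift_dist \<eta> x z \<le> shift_dist \<eta> x y + shift_dist \<eta> y z"
  proof (cases "x = z")
    case True
    then have "shift_dist \<eta> x z = 0" by (simp add: shift_dist_def)
    with nn[of x y] nn[of y z] show ?thesis by linarith
  next
    case False
    define n where "n = (LEAST n. x n \<noteq> z n)"
    have n: "x n \<noteq> z n"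
      unfolding n_def
      by (rule LeastI_ex[of "\<lambda>n. x n \<noteq> z n"]) (use False in \<open>simp add: fun_eq_iff\<close>)
    have d: "shift_dist \<eta> x z = \<eta> ^ n"
      using False by (simp add: shift_dist_def n_def)
    show ?thesis
    proof (cases "x n = y n")
      case True
      with n have "y n \<noteq> z n" by simp
      from le[of y n z, OF this] d nn[of x y] show ?thesis by linarith
    next
      case False
      from le[of x n y, OF this] d nn[of y z] show ?thesis by linarith
    qed
  qed
qed

definition shift_topology :: "real \<Rightarrow> ('v \<Rightarrow> 'v \<Rightarrow> bool) \<Rightarrow> (nat \<Rightarrow> 'v) topology" where
  "shift_topology \<eta> A = Metric_space.mtopology (shift_space A) (shift_dist \<eta>)"

definition shift_borel :: "real \<Rightarrow> ('v \<Rightarrow> 'v \<Rightarrow> bool) \<Rightarrow> (nat \<Rightarrow> 'v) measure" where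
  "shift_borel \<eta> A = sigma (shift_space A) {U. openin (shift_topology \<eta> A) U}"

definition cylinder :: "('v \<Rightarrow> 'v \<Rightarrow> bool) \<Rightarrow> 'v list \<Rightarrow> (nat \<Rightarrow> 'v) set" where
  "cylinder A w = {x \<in> shift_space A. \<forall>i<length w. x i = w ! i}"

text \<open>\<open>(A ^^ n) v w\<close> is relational power: there is an admissible path of \<open>n\<close> steps
  from \<open>v\<close> to \<open>w\<close>.\<close>

definition topologically_mixing :: "('v \<Rightarrow> 'v \<Rightarrow> bool) \<Rightarrow> bool" where
  "topologically_mixing A \<longleftrightarrow> (\<forall>v w. \<exists>N. \<forall>n\<ge>N. (A ^^ n) v w)"

text \<open>The infimum of the empty set is \<open>\<infinity>\<close>. Passing to the reals by \<open>real_of_ereal\<close> sends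
  \<open>\<infinity>\<close> to \<open>0\<close>; for conservative measures this concerns only a null set of points of \<open>B\<close>.\<close>

definition return_time :: "(nat \<Rightarrow> 'v) set \<Rightarrow> (nat \<Rightarrow> 'v) \<Rightarrow> enat" where
  "return_time B x = Inf (enat ` {n. 1 \<le> n \<and> (shift ^^ n) x \<in> B})"

section \<open>Potentials\<close>

definition birkhoff_sum :: "((nat \<Rightarrow> 'v) \<Rightarrow> real) \<Rightarrow> nat \<Rightarrow> (nat \<Rightarrow> 'v) \<Rightarrow> real" where
  "birkhoff_sum \<phi> n x = (\<Sum>k<n. \<phi> ((shift ^^ k) x))"

definition variation :: "('v \<Rightarrow> 'v \<Rightarrow> bool) \<Rightarrow> nat \<Rightarrow> ((nat \<Rightarrow> 'v) \<Rightarrow> real) \<Rightarrow> ennreal" where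
  "variation A n \<phi> =
     Sup {ennreal \<bar>\<phi> x - \<phi> y\<bar> | x y. x \<in> shift_space A \<and> y \<in> shift_space A \<and> (\<forall>i<n. x i = y i)}"

definition walters_W :: "('v \<Rightarrow> 'v \<Rightarrow> bool) \<Rightarrow> ((nat \<Rightarrow> 'v) \<Rightarrow> real) \<Rightarrow> nat \<Rightarrow> ennreal" where
  "walters_W A \<phi> k = (SUP n\<in>{1..}. variation A (n + k) (birkhoff_sum \<phi> n))"

definition walters_condition :: "('v \<Rightarrow> 'v \<Rightarrow> bool) \<Rightarrow> ((nat \<Rightarrow> 'v) \<Rightarrow> real) \<Rightarrow> bool" where
  "walters_condition A \<phi> \<longleftrightarrow> (\<forall>k\<ge>1. walters_W A \<phi> k < \<infinity>) \<and> walters_W A \<phi> \<longlonglongrightarrow> 0"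

text \<open>The sets of periodic points may be infinite, so the partition functions take values
  in \<open>[0,\<infinity>]\<close>.\<close>

definition Z :: "('v \<Rightarrow> 'v \<Rightarrow> bool) \<Rightarrow> ((nat \<Rightarrow> 'v) \<Rightarrow> real) \<Rightarrow> 'v \<Rightarrow> nat \<Rightarrow> ennreal" where
  "Z A \<phi> v n =
     (\<Sum>\<^sub>\<infinity>x\<in>{x \<in> cylinder A [v]. (shift ^^ n) x = x}. ennreal (exp (birkhoff_sum \<phi> n x)))"

definition Z_star :: "('v \<Rightarrow> 'v \<Rightarrow> bool) \<Rightarrow> ((nat \<Rightarrow> 'v) \<Rightarrow> real) \<Rightarrow> 'v \<Rightarrow> nat \<Rightarrow> ennreal" where
  "Z_star A \<phi> v n =
     (\<Sum>\<^sub>\<infinity>x\<in>{x \<in> cylinder A [v]. (shift ^^ n) x = x \<and> return_time (cylinder A [v]) x = enat n}.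
        ennreal (exp (birkhoff_sum \<phi> n x)))"

definition elog :: "ennreal \<Rightarrow> ereal" where
  "elog z = (if z = 0 then - \<infinity> else if z = \<infinity> then \<infinity> else ereal (ln (enn2real z)))"

text \<open>For topologically mixing shifts and Walters potentials the limit exists and does not
  depend on \<open>v\<close>.\<close>

definition gurevich_pressure :: "('v \<Rightarrow> 'v \<Rightarrow> bool) \<Rightarrow> ((nat \<Rightarrow> 'v) \<Rightarrow> real) \<Rightarrow> ereal" where
  "gurevich_pressure A \<phi> =
     (THE P. \<forall>v. (\<lambda>n. ereal (1 / real n) * elog (Z A \<phi> v n)) \<longlonglongrightarrow> P)"

definition lam :: "('v \<Rightarrow> 'v \<Rightarrow> bool) \<Rightarrow> ((nat \<Rightarrow> 'v) \<Rightarrow> real) \<Rightarrow> real" where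
  "lam A \<phi> = exp (real_of_ereal (gurevich_pressure A \<phi>))"

text \<open>The series start at \<open>n = 1\<close>: every point satisfies \<open>T\<^sup>0 x = x\<close>, so the
  term \<open>n = 0\<close> would be meaningless.\<close>

definition null_recurrent :: "('v \<Rightarrow> 'v \<Rightarrow> bool) \<Rightarrow> ((nat \<Rightarrow> 'v) \<Rightarrow> real) \<Rightarrow> bool" where
  "null_recurrent A \<phi> \<longleftrightarrow> (\<exists>v.
     (\<Sum>n. ennreal (inverse (lam A \<phi>) ^ Suc n) * Z A \<phi> v (Suc n)) = \<infinity> \<and>
     (\<Sum>n. ennreal (real (Suc n) * inverse (lam A \<phi>) ^ Suc n) * Z_star A \<phi> v (Suc n)) = \<infinity>)"

section \<open>The invariant measure of a null recurrent potential\<close>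

definition ruelle :: "('v \<Rightarrow> 'v \<Rightarrow> bool) \<Rightarrow> ((nat \<Rightarrow> 'v) \<Rightarrow> real)
    \<Rightarrow> ((nat \<Rightarrow> 'v) \<Rightarrow> ennreal) \<Rightarrow> (nat \<Rightarrow> 'v) \<Rightarrow> ennreal" where
  "ruelle A \<phi> f x = (\<Sum>\<^sub>\<infinity>y\<in>{y \<in> shift_space A. shift y = x}. ennreal (exp (\<phi> y)) * f y)"

definition conservative :: "'a measure \<Rightarrow> ('a \<Rightarrow> 'a) \<Rightarrow> bool" where
  "conservative M T \<longleftrightarrow>
     (\<forall>W\<in>sets M. disjoint_family (\<lambda>n. (T ^^ n) -` W \<inter> space M) \<longrightarrow> emeasure M W = 0)"

text \<open>The eigenfunction \<open>h\<close> and the eigenmeasure \<open>m\<close> of the Ruelle operator. The dual equation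
  is stated on nonnegative functions, where both sides are always defined. The pair
  is unique up to scaling of \<open>h\<close> and of \<open>m\<close>.\<close>

definition rpf_pair :: "real \<Rightarrow> ('v \<Rightarrow> 'v \<Rightarrow> bool) \<Rightarrow> ((nat \<Rightarrow> 'v) \<Rightarrow> real)
    \<Rightarrow> ((nat \<Rightarrow> 'v) \<Rightarrow> real) \<Rightarrow> (nat \<Rightarrow> 'v) measure \<Rightarrow> bool" where
  "rpf_pair \<eta> A \<phi> h m \<longleftrightarrow>
     continuous_map (shift_topology \<eta> A) euclideanreal h \<and>
     (\<forall>x\<in>shift_space A. 0 < h x) \<and>
     sets m = sets (shift_borel \<eta> A) \<and>
     conservative m shift \<and>
     (\<forall>w. w \<noteq> [] \<longrightarrow> emeasure m (cylinder A w) < \<infinity>) \<and>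
     (\<forall>x\<in>shift_space A. ruelle A \<phi> (\<lambda>y. ennreal (h y)) x = ennreal (lam A \<phi> * h x)) \<and>
     (\<forall>f\<in>borel_measurable (shift_borel \<eta> A).
        (\<integral>\<^sup>+x. ruelle A \<phi> f x \<partial>m) = ennreal (lam A \<phi>) * (\<integral>\<^sup>+x. f x \<partial>m)) \<and>
     (\<integral>\<^sup>+x. ennreal (h x) \<partial>m) = \<infinity>"

definition associated_measure :: "real \<Rightarrow> ('v \<Rightarrow> 'v \<Rightarrow> bool) \<Rightarrow> ((nat \<Rightarrow> 'v) \<Rightarrow> real)
    \<Rightarrow> (nat \<Rightarrow> 'v) measure \<Rightarrow> bool" where
  "associated_measure \<eta> A \<phi> \<mu> \<longleftrightarrow>
     (\<exists>h m. rpf_pair \<eta> A \<phi> h m \<and> \<mu> = density m (\<lambda>x. ennreal (h x)))"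

section \<open>Pointwise dual ergodicity and scaling\<close>

text \<open>\<open>transfer_operator M T f\<close> is a version of the transfer operator, determined
  almost everywhere.\<close>

definition transfer_operator :: "'a measure \<Rightarrow> ('a \<Rightarrow> 'a) \<Rightarrow> ('a \<Rightarrow> real) \<Rightarrow> 'a \<Rightarrow> real" where
  "transfer_operator M T f = (SOME F. integrable M F \<and>
     (\<forall>g\<in>borel_measurable M. (\<exists>C. \<forall>x\<in>space M. \<bar>g x\<bar> \<le> C) \<longrightarrow>
        (\<integral>x. f x * g (T x) \<partial>M) = (\<integral>x. F x * g x \<partial>M)))"

definition normalizing_sequence :: "'a measure \<Rightarrow> ('a \<Rightarrow> 'a) \<Rightarrow> (nat \<Rightarrow> real) \<Rightarrow> bool" where
  "normalizing_sequence M T a \<longleftrightarrow> (\<forall>f. integrable M f \<longrightarrow>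
     (AE x in M. (\<lambda>n. (1 / a n) * (\<Sum>k<n. (transfer_operator M T ^^ k) f x))
        \<longlonglongrightarrow> (\<integral>x. f x \<partial>M)))"

definition regularly_varying :: "(nat \<Rightarrow> real) \<Rightarrow> real \<Rightarrow> bool" where
  "regularly_varying a \<alpha> \<longleftrightarrow> (\<forall>\<^sub>F n in sequentially. 0 < a n) \<and>
     (\<forall>c>0. (\<lambda>n. a (nat \<lfloor>c * real n\<rfloor>) / a n) \<longlonglongrightarrow> c powr \<alpha>)"

definition right_inverse :: "(nat \<Rightarrow> real) \<Rightarrow> real \<Rightarrow> real" where
  "right_inverse a y = Inf {s. 0 \<le> s \<and> a (nat \<lfloor>s\<rfloor>) > y}"

definition scaling :: "(nat \<Rightarrow> real) \<Rightarrow> real \<Rightarrow> real" where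
  "scaling a s = 1 / right_inverse a (1 / s)"

section \<open>The class of limit laws\<close>

definition G_class :: "real \<Rightarrow> real measure set" where
  "G_class \<alpha> = {\<nu>. real_distribution \<nu> \<and> measure \<nu> {..<0} = 0 \<and>
     (\<forall>t s. 0 < t \<and> t < s \<longrightarrow>
        measure \<nu> {t<..} \<le> min 1 (sin (pi * \<alpha>) / (pi * \<alpha>) * t powr (- \<alpha>)) \<and>
        measure \<nu> {t<..s} \<le> sin (pi * \<alpha>) / (pi * \<alpha>) * (t powr (- \<alpha>) - s powr (- \<alpha>)))}"

end

theory Submission
  imports Defs
begin

text \<open>On \<open>B\<^sub>n\<close> the point \<open>T\<^sup>j y\<close> lies in any fixed cylinder \<open>X = [x\<^sub>j, \<dots>, x\<^sub>j\<^sub>+\<^sub>N]\<close> as soon as \<open>n\<close> is large,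
  so by invariance of \<open>\<mu>\<close> the mass that the law of the rescaled return time gives to \<open>(t, s]\<close> is at most
  \<open>\<mu>(X \<inter> {t M < r \<le> s M}) / \<mu>(B\<^sub>n)\<close>, where \<open>r\<close> is the return time to \<open>[x\<^sub>0]\<close>, \<open>M = 1 / \<gamma>(\<mu>(B\<^sub>n))\<close> and
  \<open>1 / \<mu>(B\<^sub>n) < a\<^sub>M\<close>. It remains to bound \<open>a\<^sub>M \<mu>(X \<inter> {t M < r \<le> s M})\<close>.

  By Walters' condition the transfer operator sums vary on \<open>X\<close> only by a factor close to \<open>1\<close> when \<open>X\<close> is long.
  The decomposition by the last visit to \<open>X\<close> is therefore almost a renewal equation for the tail of the
  return time \<open>r'\<close> of \<open>X\<close> to itself; a Tauberian argument, based on Weierstrass approximation and monotonicity,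
  yields \<open>a\<^sub>M \<mu>(X \<inter> {r' > t M}) \<approx> sin (\<pi> \<alpha>) / (\<pi> \<alpha>) t\<^sup>-\<^sup>\<alpha>\<close>. Finally \<open>r \<le> r'\<close>, and bounded distortion shows that
  after the first return to \<open>[x\<^sub>0]\<close> the cylinder \<open>X\<close> is reached within a bounded time, up to a small proportion,
  so that \<open>r\<close> may be replaced by \<open>r'\<close>.\<close>

section \<open>A continuity theorem for Laplace transforms of monotone functions\<close>

text \<open>The detour through the long cylinder X is forced by the sharp constant: on [x_0] itself
  Walters' condition only gives a fixed distortion factor, which would survive in the limit, whereas
  the factor for X tends to 1 as X gets longer. X depends on the allowed error and on t and s, but
  not on n, so the error is sent to 0 only after n has gone to infinity. A window (t, s] is a
  difference of two tails, so the tail of r' is needed with matching upper and lower bounds although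
  the conclusion is one-sided; the one-sidedness comes from enlarging B_n to a preimage of X. The
  only link between \<open>a\<close> and the dynamics is the almost everywhere convergence of
  averaged transfer operator iterates. It controls partial sums and no individual term, hence the
  Laplace transforms. That the orbit of x leaves [x_0] for good makes {x} a null set by recurrence;
  so \<mu>(B_n) tends to 0 and M to infinity, which is the regime of the tail asymptotics.\<close>

lemma tendsto_integral_of_moments:
  fixes N :: "nat \<Rightarrow> real measure" and N0 :: "real measure" and F :: "real \<Rightarrow> real"
  assumes fin: "\<And>i. finite_measure (N i)" "finite_measure N0"
    and sets: "\<And>i. sets (N i) = sets borel" "sets N0 = sets borel"
    and pos: "\<And>i. AE t in N i. 0 \<le> t" "AE t in N0. 0 \<le> t"
    and moments: "\<And>k::nat. (\<lambda>i. \<integral>t. exp (- t) ^ k \<partial>N i) \<longlonglongrightarrow> (\<integral>t. exp (- t) ^ k \<partial>N0)"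
    and F: "continuous_on UNIV F"
  shows "(\<lambda>i. \<integral>t. F (exp (- t)) \<partial>N i) \<longlonglongrightarrow> (\<integral>t. F (exp (- t)) \<partial>N0)"
proof (rule LIMSEQ_I)
  fix e :: real assume e: "0 < e"
  \<comment> \<open>The moment of order 0 is the total mass, so the masses converge and are bounded
    by some \<open>K\<close>; this makes the approximation error uniform in
    \<open>i\<close>.\<close>
  have "(\<lambda>i. measure (N i) (space (N i))) \<longlonglongrightarrow> measure N0 (space N0)"
    using moments[of 0] by (simp add: fin finite_measure.finite_measure_eq_AE)
  then have "Bseq (\<lambda>i. measure (N i) (space (N i)))"
    by (intro convergent_imp_Bseq) (auto simp: convergent_def)
  then obtain K where K: "K > 0" "\<And>i. measure (N i) (space (N i)) \<le> K"
    by (auto simp: Bseq_def)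
  define L where "L = K + measure N0 (space N0)"
  have L: "L > 0" using K(1) by (simp add: L_def add_pos_nonneg)
  \<comment> \<open>The approximation errors at \<open>N i\<close> and \<open>N0\<close> add up to
    at most \<open>d * L = e / 2\<close>, leaving \<open>e / 2\<close> for the polynomial.\<close>
  define d where "d = e / (2 * L)"
  have d: "d > 0" using e L by (simp add: d_def)
  \<comment> \<open>All the measures live on the half line, where \<open>exp (- t)\<close> takes
    values in \<open>{0..1}\<close>: only there does \<open>F\<close> have to be
    approximated.\<close>
  have "continuous_on {0..1} F" using F continuous_on_subset by blast
  then obtain P where P: "real_polynomial_function P" "\<And>x. x \<in> {0..1} \<Longrightarrow> \<bar>F x - P x\<bar> < d"
    using Stone_Weierstrass_real_polynomial_function[of "{0..1::real}" F d] d by auto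
  from P(1) obtain c n where Pc: "P = (\<lambda>x. \<Sum>k\<le>n. c k * x ^ k)"
    using real_polynomial_function_iff_sum by blast
  have bnd: "integrable M (\<lambda>t. exp (- t) ^ k) \<and> integrable M (\<lambda>t. F (exp (- t)))
      \<and> \<bar>(\<integral>t. F (exp (- t)) \<partial>M) - (\<integral>t. P (exp (- t)) \<partial>M)\<bar> \<le> d * measure M (space M)"
    if M: "finite_measure M" "sets M = sets borel" "AE t in M. 0 \<le> t" for M :: "real measure" and k
  proof -
    interpret finite_measure M by (rule M)
    have meas: "G \<in> borel_measurable M" if "G \<in> borel_measurable borel" for G :: "real \<Rightarrow> real"
      using that by (simp add: measurable_cong_sets[OF M(2) refl])
    have I: "integrable M (\<lambda>t. exp (- t) ^ k)" for k
      by (rule integrable_const_bound[of _ 1]) (use M(3) in \<open>auto intro!: meas power_le_one\<close>)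
    obtain C where C: "\<And>x. x \<in> {0..1} \<Longrightarrow> \<bar>F x\<bar> \<le> C"
    proof -
      have "bounded (F ` {0..1})"
        by (intro compact_imp_bounded compact_continuous_image continuous_on_subset[OF F]) auto
      then show ?thesis using that by (force simp: bounded_iff)
    qed
    have F': "(\<lambda>t. F (exp (- t))) \<in> borel_measurable borel"
      using borel_measurable_continuous_onI[OF F] by measurable
    have IF: "integrable M (\<lambda>t. F (exp (- t)))"
      by (rule integrable_const_bound[of _ C]) (use M(3) in \<open>auto intro!: meas C F'\<close>)
    have IP: "integrable M (\<lambda>t. P (exp (- t)))" unfolding Pc by (intro Bochner_Integration.integrable_sum integrable_mult_right I)
    have "\<bar>(\<integral>t. F (exp (- t)) \<partial>M) - (\<integral>t. P (exp (- t)) \<partial>M)\<bar> = \<bar>\<integral>t. F (exp (- t)) - P (exp (- t)) \<partial>M\<bar>"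
      using IF IP by simp
    also have "\<dots> \<le> (\<integral>t. \<bar>F (exp (- t)) - P (exp (- t))\<bar> \<partial>M)"
      by (rule integral_abs_bound)
    also have "\<dots> \<le> (\<integral>t. d \<partial>M)"
    proof (rule integral_mono_AE)
      show "AE t in M. \<bar>F (exp (- t)) - P (exp (- t))\<bar> \<le> d"
        using M(3) by eventually_elim (intro less_imp_le P(2), auto)
    qed (use IF IP in auto)
    finally show ?thesis using I IF by (simp add: mult.commute)
  qed
  have P_lim: "(\<lambda>i. \<integral>t. P (exp (- t)) \<partial>N i) \<longlonglongrightarrow> (\<integral>t. P (exp (- t)) \<partial>N0)"
  proof -
    have *: "(\<integral>t. P (exp (- t)) \<partial>M) = (\<Sum>k\<le>n. c k * (\<integral>t. exp (- t) ^ k \<partial>M))"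
      if "\<And>k. integrable M (\<lambda>t. exp (- t) ^ k)" for M :: "real measure"
      unfolding Pc using that by (subst Bochner_Integration.integral_sum) auto
    have "(\<lambda>i. \<Sum>k\<le>n. c k * (\<integral>t. exp (- t) ^ k \<partial>N i)) \<longlonglongrightarrow> (\<Sum>k\<le>n. c k * (\<integral>t. exp (- t) ^ k \<partial>N0))"
      by (intro tendsto_intros moments)
    then show ?thesis
      using bnd[OF fin(1) sets(1) pos(1)] bnd[OF fin(2) sets(2) pos(2)] by (simp add: *)
  qed
  then obtain n0 where n0: "\<And>i. i \<ge> n0 \<Longrightarrow> \<bar>(\<integral>t. P (exp (- t)) \<partial>N i) - (\<integral>t. P (exp (- t)) \<partial>N0)\<bar> < e / 2"
    using LIMSEQ_D[OF P_lim, of "e/2"] e by auto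
  show "\<exists>n0. \<forall>i\<ge>n0. norm ((\<integral>t. F (exp (- t)) \<partial>N i) - (\<integral>t. F (exp (- t)) \<partial>N0)) < e"
  proof (intro exI allI impI)
    fix i assume "i \<ge> n0"
    note n0[OF this]
    moreover have "\<bar>(\<integral>t. F (exp (- t)) \<partial>N i) - (\<integral>t. P (exp (- t)) \<partial>N i)\<bar> \<le> d * measure (N i) (space (N i))"
      "\<bar>(\<integral>t. F (exp (- t)) \<partial>N0) - (\<integral>t. P (exp (- t)) \<partial>N0)\<bar> \<le> d * measure N0 (space N0)"
      using bnd[OF fin(1) sets(1) pos(1)] bnd[OF fin(2) sets(2) pos(2)] by auto
    moreover have "d * measure (N i) (space (N i)) \<le> d * K" using K(2) d by (intro mult_left_mono) auto
    moreover have "d * K + d * measure N0 (space N0) = e / 2" 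
    proof -
      have "d * K + d * measure N0 (space N0) = d * L" by (simp add: L_def distrib_left)
      also have "\<dots> = e / 2" using L by (simp add: d_def)
      finally show ?thesis .
    qed
    ultimately show "norm ((\<integral>t. F (exp (- t)) \<partial>N i) - (\<integral>t. F (exp (- t)) \<partial>N0)) < e"
      unfolding real_norm_def by linarith
  qed
qed

section \<open>The Gamma integral and the constant of the limit\<close>

lemma nn_integral_powr_exp:
  fixes x s :: real
  assumes "0 < x" "0 < s"
  shows "(\<integral>\<^sup>+t\<in>{0..}. ennreal (t powr (x - 1) * exp (- s * t)) \<partial>lborel) = ennreal (Gamma x * s powr (- x))"
proof -
  have "(\<integral>\<^sup>+t\<in>{0..}. ennreal (t powr (x - 1) * exp (- s * t)) \<partial>lborel)
      = ennreal (1 / s) * (\<integral>\<^sup>+t. ennreal ((t / s) powr (x - 1) * exp (- s * (t / s))) * indicator {0..} (t / s) \<partial>lborel)"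
    using nn_integral_real_affine[of "\<lambda>t. ennreal (t powr (x - 1) * exp (- s * t)) * indicator {0..} t" "1 / s" 0] assms
    by simp
  also have "\<dots> = (\<integral>\<^sup>+t. ennreal (s powr (- x)) * (ennreal (t powr (x - 1) / exp t) * indicator {0..} t) \<partial>lborel)"
  proof (subst nn_integral_cmult[symmetric], measurable, intro nn_integral_cong)
    fix t :: real
    show "ennreal (1 / s) * (ennreal ((t / s) powr (x - 1) * exp (- s * (t / s))) * indicator {0..} (t / s))
        = ennreal (s powr (- x)) * (ennreal (t powr (x - 1) / exp t) * indicator {0..} t)"
    proof (cases "t \<ge> 0")
      case True
      have "1 / s * ((t / s) powr (x - 1) * exp (- s * (t / s))) = s powr (- x) * (t powr (x - 1) / exp t)"
      proof -
        have "s powr (- x) = (1 / s) * (1 / s powr (x - 1))"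
          using assms by (simp add: powr_minus powr_diff divide_simps)
        moreover have "(t / s) powr (x - 1) = t powr (x - 1) / s powr (x - 1)"
          using True assms by (simp add: powr_divide)
        moreover have "s * (t / s) = t" using assms by simp
        ultimately show ?thesis by (simp add: exp_minus divide_inverse)
      qed
      then show ?thesis using True assms by (simp add: ennreal_mult[symmetric])
    qed (use assms in \<open>simp add: field_simps\<close>)
  qed
  also have "\<dots> = ennreal (s powr (- x)) * ennreal (Gamma x)"
  proof (subst nn_integral_cmult, simp)
    have "(\<integral>\<^sup>+t\<in>{0..}. ennreal (t powr (x - 1) / exp t) \<partial>lborel) = ennreal (Gamma x)"
      by (rule nn_integral_has_integral_lebesgue') (use Gamma_integral_real assms in auto)
    then show "ennreal (s powr (- x)) * (\<integral>\<^sup>+t. ennreal (t powr (x - 1) / exp t) * indicator {0..} t \<partial>lborel)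
        = ennreal (s powr (- x)) * ennreal (Gamma x)" by simp
  qed
  finally show ?thesis using assms by (simp add: ennreal_mult[symmetric] mult.commute)
qed

text \<open>Origin of the constant in \<open>G_class\<close>: multiplied by
  \<open>t powr (- \<alpha>)\<close> it has the Laplace transform
  \<open>s powr (\<alpha> - 1) / Gamma (1 + \<alpha>)\<close>, the reciprocal of \<open>s\<close>
  times the limit in \<open>abelian_laplace\<close> for \<open>C = 1\<close>. At \<alpha> = 1 the
  left side is 0 and the identity fails.\<close>

lemma Gamma_reflection_sin:
  fixes \<alpha> :: real
  assumes "0 < \<alpha>" "\<alpha> < 1"
  shows "sin (pi * \<alpha>) / (pi * \<alpha>) * Gamma (1 - \<alpha>) = 1 / Gamma (1 + \<alpha>)"
proof -
  have "Gamma (complex_of_real \<alpha>) * Gamma (complex_of_real (1 - \<alpha>)) = complex_of_real pi / sin (complex_of_real (pi * \<alpha>))"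
    using Gamma_reflection_complex[of "complex_of_real \<alpha>"] by simp
  then have *: "Gamma \<alpha> * Gamma (1 - \<alpha>) = pi / sin (pi * \<alpha>)"
    by (simp only: Gamma_complex_of_real sin_of_real of_real_mult[symmetric] of_real_divide[symmetric] of_real_eq_iff)
  have "sin (pi * \<alpha>) > 0" using assms by (intro sin_gt_zero) auto
  moreover have "Gamma (1 + \<alpha>) = \<alpha> * Gamma \<alpha>" 
  proof -
    have "\<alpha> \<notin> \<int>\<^sub>\<le>\<^sub>0" using assms nonpos_Ints_nonpos by force
    then show ?thesis using Gamma_plus1[of \<alpha>] by (simp add: add.commute)
  qed
  moreover have "Gamma \<alpha> > 0" "Gamma (1 - \<alpha>) > 0" using assms by auto
  moreover have "Gamma (1 - \<alpha>) = pi / sin (pi * \<alpha>) / Gamma \<alpha>"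
    using * \<open>Gamma \<alpha> > 0\<close> by (metis less_irrefl nonzero_mult_div_cancel_left)
  ultimately show ?thesis using assms by simp
qed


text \<open>Tilting by \<open>exp (- t)\<close> turns a possibly non-integrable \<open>G\<close>
  into a finite measure, and Laplace transforms at integers become its moments in
  \<open>exp (- t)\<close>. The tilt uses up one exponential, hence the shift from \<open>k\<close>
  to \<open>Suc k\<close>.\<close>

lemma exp_weighted_measure:
  fixes G :: "real \<Rightarrow> real" and l :: "nat \<Rightarrow> real"
  assumes [measurable]: "G \<in> borel_measurable borel"
    and G: "\<And>t. 0 \<le> t \<Longrightarrow> 0 \<le> G t"
    and lap: "\<And>k. 1 \<le> k \<Longrightarrow> (\<integral>\<^sup>+t\<in>{0..}. ennreal (exp (- (real k * t)) * G t) \<partial>lborel) = ennreal (l k)"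
    and l: "\<And>k. 1 \<le> k \<Longrightarrow> 0 \<le> l k"
  defines "N \<equiv> density lborel (\<lambda>t. ennreal (exp (- t) * G t) * indicator {0..} t)"
  shows "finite_measure N" "sets N = sets borel" "AE t in N. 0 \<le> t"
    "(\<integral>t. exp (- t) ^ k \<partial>N) = l (Suc k)"
    "\<And>F. F \<in> borel_measurable borel \<Longrightarrow> (\<And>x. 0 \<le> F x) \<Longrightarrow> (\<integral>t. F (exp (- t)) \<partial>N)
      = enn2real (\<integral>\<^sup>+t\<in>{0..}. ennreal (F (exp (- t)) * exp (- t) * G t) \<partial>lborel)"
proof -
  have *: "(\<integral>\<^sup>+t. ennreal (F (exp (- t))) \<partial>N) = (\<integral>\<^sup>+t\<in>{0..}. ennreal (F (exp (- t)) * exp (- t) * G t) \<partial>lborel)"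
    if [measurable]: "F \<in> borel_measurable borel" and "\<And>x. 0 \<le> F x" for F
    unfolding N_def
    by (subst nn_integral_density)
      (use that G in \<open>auto intro!: nn_integral_cong split: split_indicator simp: ennreal_mult[symmetric] mult_ac\<close>)
  have mom: "(\<integral>\<^sup>+t. ennreal (exp (- t) ^ k) \<partial>N) = ennreal (l (Suc k))" for k
  proof -
    \<comment> \<open>The auxiliary identity asks for a test function that is nonnegative on all
      reals, hence \<open>max 0 x\<close> in place of \<open>x\<close>; on values of
      \<open>exp\<close> they agree.\<close>
    have e: "(max 0 (exp (- t))) ^ k * exp (- t) * G t = exp (- (real (Suc k) * t)) * G t" for t
      by (simp add: exp_of_nat_mult[symmetric] exp_add[symmetric] algebra_simps)
    have "(\<integral>\<^sup>+t. ennreal (exp (- t) ^ k) \<partial>N) = (\<integral>\<^sup>+t\<in>{0..}. ennreal ((max 0 (exp (- t))) ^ k * exp (- t) * G t) \<partial>lborel)"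
      using *[of "\<lambda>x. (max 0 x) ^ k"] by (simp add: max_def)
    also have "\<dots> = ennreal (l (Suc k))" unfolding e by (rule lap) simp
    finally show ?thesis .
  qed
  show "sets N = sets borel" by (simp add: N_def)
  show "finite_measure N"
  proof
    have "emeasure N (space N) = (\<integral>\<^sup>+t. ennreal (exp (- t) ^ 0) \<partial>N)" by simp
    then show "emeasure N (space N) \<noteq> \<infinity>" unfolding mom by simp
  qed
  show "AE t in N. 0 \<le> t" unfolding N_def by (subst AE_density) (auto split: split_indicator)
  show "(\<integral>t. exp (- t) ^ k \<partial>N) = l (Suc k)"
  proof -
    have "(\<lambda>t. exp (- t) ^ k) \<in> borel_measurable N" by (simp add: N_def)
    from integral_eq_nn_integral[OF this] show ?thesis by (simp add: mom l)
  qed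
  show "(\<integral>t. F (exp (- t)) \<partial>N) = enn2real (\<integral>\<^sup>+t\<in>{0..}. ennreal (F (exp (- t)) * exp (- t) * G t) \<partial>lborel)"
    if [measurable]: "F \<in> borel_measurable borel" and "\<And>x. 0 \<le> F x" for F
  proof -
    have "(\<lambda>t. F (exp (- t))) \<in> borel_measurable N" by (simp add: N_def)
    from integral_eq_nn_integral[OF this] show ?thesis using that by (simp add: *)
  qed
qed

text \<open>The test function vanishes at \<open>t\<close> outside \<open>{p<..<q}\<close>, so \<open>J / W\<close> is an average of \<open>G\<close>
  over \<open>{p..q}\<close>; for monotone \<open>G\<close> this turns convergence of integrals into convergence of values.\<close>

lemma tent_average_bounds:
  fixes G :: "real \<Rightarrow> real" and p q lo hi :: real
  assumes [measurable]: "G \<in> borel_measurable borel"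
    and pq: "0 < p" "p < q"
    and G: "\<And>t. p \<le> t \<Longrightarrow> t \<le> q \<Longrightarrow> lo \<le> G t \<and> G t \<le> hi" "0 \<le> lo"
  defines "F \<equiv> \<lambda>x::real. max 0 (min (x - exp (- q)) (exp (- p) - x))"
  defines "W \<equiv> enn2real (\<integral>\<^sup>+t. ennreal (F (exp (- t)) * exp (- t)) \<partial>lborel)"
  defines "J \<equiv> enn2real (\<integral>\<^sup>+t\<in>{0..}. ennreal (F (exp (- t)) * exp (- t) * G t) \<partial>lborel)"
  shows "0 < W" "lo * W \<le> J" "J \<le> hi * W"
proof -
  have [measurable]: "F \<in> borel_measurable borel" unfolding F_def by measurable
  have F0: "F (exp (- t)) = 0" if "t \<notin> {p<..<q}" for t
  proof -
    have "exp (- p) \<le> exp (- t) \<or> exp (- t) \<le> exp (- q)" using that by auto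
    then show ?thesis unfolding F_def by (intro max_absorb1) (auto simp: min_le_iff_disj)
  qed
  have Fpos: "0 < F (exp (- t))" if "t \<in> {p<..<q}" for t
    using that by (auto simp: F_def max_def min_def)
  have F1: "0 \<le> F x" for x by (simp add: F_def)
  have F2: "F (exp (- t)) * exp (- t) \<le> 1" if "t \<in> {p<..<q}" for t
  proof -
    have e: "exp (- p) \<le> 1" "exp (- t) \<le> 1" "0 \<le> exp (- t)" using that pq by simp_all
    then have "exp (- p) - exp (- t) \<le> 1" by linarith
    then have "F (exp (- t)) \<le> 1" by (simp add: F_def min_le_iff_disj)
    with e(2) show ?thesis using F1 mult_mono[of "F (exp (- t))" 1 "exp (- t)" 1] by simp
  qed
  let ?W = "\<integral>\<^sup>+t. ennreal (F (exp (- t)) * exp (- t)) \<partial>lborel"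
  let ?J = "\<integral>\<^sup>+t\<in>{0..}. ennreal (F (exp (- t)) * exp (- t) * G t) \<partial>lborel"
  have "?W \<le> (\<integral>\<^sup>+t. indicator {p<..<q} t \<partial>lborel)"
    by (intro nn_integral_mono) (use F0 F2 in \<open>auto split: split_indicator\<close>)
  also have "\<dots> < \<infinity>" using pq by simp
  finally have fin: "?W < \<infinity>" .
  have "?W \<noteq> 0"
  proof
    assume "?W = 0"
    then have "AE t in lborel. ennreal (F (exp (- t)) * exp (- t)) = 0"
      by (subst (asm) nn_integral_0_iff_AE) auto
    then have "AE t in lborel. t \<notin> {p<..<q}"
      by eventually_elim (use Fpos in \<open>fastforce simp: ennreal_eq_0_iff mult_le_0_iff\<close>)
    then have "emeasure lborel {t. t \<in> {p<..<q}} = 0"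
      by (subst (asm) AE_iff_measurable[OF _ refl]) auto
    then have "emeasure lborel {p<..<q} = 0" by (simp only: Collect_mem_eq)
    then show False using pq by simp
  qed
  with fin show "0 < W" unfolding W_def by (simp add: enn2real_positive_iff zero_less_iff_neq_zero)
  have W: "?W = ennreal W" using fin by (simp add: W_def)
  have "hi \<ge> 0" using G(1)[of p] G(2) pq by simp
  have "?J \<le> (\<integral>\<^sup>+t. ennreal hi * ennreal (F (exp (- t)) * exp (- t)) \<partial>lborel)"
  proof (intro nn_integral_mono)
    fix t
    show "ennreal (F (exp (- t)) * exp (- t) * G t) * indicator {0..} t \<le> ennreal hi * ennreal (F (exp (- t)) * exp (- t))"
    proof (cases "t \<in> {p<..<q}")
      case True
      then show ?thesis using pq F1 G(1)[of t] \<open>hi \<ge> 0\<close>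
        by (auto simp: ennreal_mult[symmetric] mult_ac intro!: ennreal_leI mult_left_mono mult_right_mono)
    qed (simp add: F0)
  qed
  also have "\<dots> = ennreal (hi * W)"
    using \<open>hi \<ge> 0\<close> by (subst nn_integral_cmult) (auto simp: W ennreal_mult' )
  finally have J: "?J \<le> ennreal (hi * W)" .
  show "J \<le> hi * W" unfolding J_def
    using enn2real_mono[OF J] \<open>hi \<ge> 0\<close> \<open>0 < W\<close> by simp
  have "ennreal (lo * W) = (\<integral>\<^sup>+t. ennreal lo * ennreal (F (exp (- t)) * exp (- t)) \<partial>lborel)"
    using G(2) by (subst nn_integral_cmult) (auto simp: W ennreal_mult' )
  also have "\<dots> \<le> ?J"
  proof (intro nn_integral_mono)
    fix t
    show "ennreal lo * ennreal (F (exp (- t)) * exp (- t)) \<le> ennreal (F (exp (- t)) * exp (- t) * G t) * indicator {0..} t"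
    proof (cases "t \<in> {p<..<q}")
      case True
      then show ?thesis using pq F1 G(1)[of t] G(2)
        by (auto simp: ennreal_mult[symmetric] mult_ac intro!: ennreal_leI mult_left_mono mult_right_mono)
    qed (simp add: F0)
  qed
  finally have "ennreal (lo * W) \<le> ?J" .
  then have "enn2real (ennreal (lo * W)) \<le> J"
    unfolding J_def using J by (intro enn2real_mono) (auto simp: top_unique intro: le_less_trans)
  then show "lo * W \<le> J" using G(2) \<open>0 < W\<close> by simp
qed

text \<open>Moment convergence upgrades to convergence against continuous functions of
  \<open>exp (- t)\<close>, tents give averages over short intervals, and monotonicity of
  \<open>g i\<close> together with continuity of the limit at \<open>t\<close> turns averages on
  either side of \<open>t\<close> into the value there.\<close>

lemma tendsto_of_laplace_transforms:
  fixes g :: "nat \<Rightarrow> real \<Rightarrow> real" and l :: "nat \<Rightarrow> nat \<Rightarrow> real"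
  assumes \<alpha>: "0 < \<alpha>" "\<alpha> \<le> 1"
    and g_meas: "\<And>i. g i \<in> borel_measurable borel"
    and g_nonneg: "\<And>i t. 0 \<le> t \<Longrightarrow> 0 \<le> g i t"
    and g_mono: "\<And>i t u. 0 \<le> t \<Longrightarrow> t \<le> u \<Longrightarrow> g i u \<le> g i t"
    and lap: "\<And>i k. 1 \<le> k \<Longrightarrow> (\<integral>\<^sup>+t\<in>{0..}. ennreal (exp (- (real k * t)) * g i t) \<partial>lborel) = ennreal (l i k)"
    and l: "\<And>i k. 1 \<le> k \<Longrightarrow> 0 \<le> l i k"
    and lim: "\<And>k. 1 \<le> k \<Longrightarrow> (\<lambda>i. l i k) \<longlonglongrightarrow> real k powr (\<alpha> - 1) / Gamma (1 + \<alpha>)"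
    and t: "0 < t"
  shows "(\<lambda>i. g i t) \<longlonglongrightarrow> sin (pi * \<alpha>) / (pi * \<alpha>) * t powr (- \<alpha>)"
proof -
  define c where "c = sin (pi * \<alpha>) / (pi * \<alpha>)"
  have c: "0 \<le> c"
    using \<alpha> sin_ge_zero[of "pi * \<alpha>"] mult_left_mono[of \<alpha> 1 pi] by (simp add: c_def)
  define N where "N i = density lborel (\<lambda>t. ennreal (exp (- t) * g i t) * indicator {0..} t)" for i
  have N: "finite_measure (N i)" "sets (N i) = sets borel" "AE t in N i. 0 \<le> t"
    "(\<integral>t. exp (- t) ^ k \<partial>N i) = l i (Suc k)"
    "F \<in> borel_measurable borel \<Longrightarrow> (\<And>x. 0 \<le> F x) \<Longrightarrow> (\<integral>t. F (exp (- t)) \<partial>N i)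
      = enn2real (\<integral>\<^sup>+t\<in>{0..}. ennreal (F (exp (- t)) * exp (- t) * g i t) \<partial>lborel)" for i k F
    unfolding N_def by (rule exp_weighted_measure[OF g_meas g_nonneg lap l]; assumption)+
  define G where "G t = c * t powr (- \<alpha>)" for t
  have G_anti: "G u \<le> G t" if "0 < t" "t \<le> u" for t u
    unfolding G_def using that \<alpha> c by (intro mult_left_mono powr_mono2') auto
  \<comment> \<open>For \<open>\<alpha> = 1\<close> the constant \<open>c\<close> vanishes and the limiting measure is an atom at the origin.\<close>
  define N0 where "N0 = (if \<alpha> = 1 then return borel (0::real)
      else density lborel (\<lambda>t. ennreal (exp (- t) * G t) * indicator {0..} t))"
  have N0: "finite_measure N0 \<and> sets N0 = sets borel \<and> (AE t in N0. 0 \<le> t)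
      \<and> (\<forall>k. (\<integral>t. exp (- t) ^ k \<partial>N0) = real (Suc k) powr (\<alpha> - 1) / Gamma (1 + \<alpha>))
      \<and> (\<forall>F. F \<in> borel_measurable borel \<longrightarrow> (\<forall>x. 0 \<le> F x) \<longrightarrow> F 1 = 0 \<longrightarrow> (\<integral>t. F (exp (- t)) \<partial>N0)
          = enn2real (\<integral>\<^sup>+t\<in>{0..}. ennreal (F (exp (- t)) * exp (- t) * G t) \<partial>lborel))"
  proof (cases "\<alpha> = 1")
    case True
    have "finite_measure (return borel (0::real))"
      using prob_space_return[of "0::real" borel] by (simp add: prob_space_def)
    moreover have "c = 0" using True by (simp add: c_def)
    moreover have "Gamma 2 = (1::real)" using Gamma_fact[of 1, where 'a=real] by simp
    moreover have "AE t in return borel (0::real). 0 \<le> t" by (subst AE_return) auto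
    moreover have N0_eq: "N0 = return borel 0" using True by (simp add: N0_def)
    ultimately show ?thesis unfolding N0_eq
      by (intro conjI allI impI) (simp_all add: integral_return G_def True)
  next
    case False
    then have \<alpha>1: "\<alpha> < 1" using \<alpha> by simp
    have lap: "(\<integral>\<^sup>+t\<in>{0..}. ennreal (exp (- (real k * t)) * G t) \<partial>lborel) = ennreal (real k powr (\<alpha> - 1) / Gamma (1 + \<alpha>))"
      if "1 \<le> k" for k
    proof -
      have "(\<integral>\<^sup>+t\<in>{0..}. ennreal (exp (- (real k * t)) * G t) \<partial>lborel)
          = (\<integral>\<^sup>+t. ennreal c * (ennreal (t powr ((1 - \<alpha>) - 1) * exp (- real k * t)) * indicator {0..} t) \<partial>lborel)"
        using c by (intro nn_integral_cong) (auto simp: G_def ennreal_mult[symmetric] mult_ac split: split_indicator)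
      also have "\<dots> = ennreal c * ennreal (Gamma (1 - \<alpha>) * real k powr (- (1 - \<alpha>)))"
        using nn_integral_powr_exp[of "1 - \<alpha>" "real k"] that \<alpha>1 by (subst nn_integral_cmult) auto
      also have "\<dots> = ennreal (c * Gamma (1 - \<alpha>) * real k powr (\<alpha> - 1))"
        using c by (simp add: ennreal_mult'[symmetric] mult_ac)
      also have "c * Gamma (1 - \<alpha>) = 1 / Gamma (1 + \<alpha>)"
        unfolding c_def using Gamma_reflection_sin \<alpha> \<alpha>1 by simp
      finally show ?thesis by simp
    qed
    have "G \<in> borel_measurable borel" "\<And>t. 0 \<le> t \<Longrightarrow> 0 \<le> G t"
      "\<And>k::nat. 1 \<le> k \<Longrightarrow> 0 \<le> real k powr (\<alpha> - 1) / Gamma (1 + \<alpha>)"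
      unfolding G_def[abs_def] using c \<alpha> by (measurable, auto simp: less_imp_le)
    note E = exp_weighted_measure[of G "\<lambda>k. real k powr (\<alpha> - 1) / Gamma (1 + \<alpha>)", OF this(1,2) lap this(3)]
    have N0_eq: "N0 = density lborel (\<lambda>t. ennreal (exp (- t) * G t) * indicator {0..} t)"
      using False by (simp add: N0_def)
    show ?thesis unfolding N0_eq by (intro conjI allI impI E) auto
  qed
  note N0a = N0[THEN conjunct1] N0[THEN conjunct2, THEN conjunct1]
    N0[THEN conjunct2, THEN conjunct2, THEN conjunct1]
    N0[THEN conjunct2, THEN conjunct2, THEN conjunct2, THEN conjunct1, rule_format]
    N0[THEN conjunct2, THEN conjunct2, THEN conjunct2, THEN conjunct2, rule_format]
  have conv: "(\<lambda>i. \<integral>t. F (exp (- t)) \<partial>N i) \<longlonglongrightarrow> (\<integral>t. F (exp (- t)) \<partial>N0)"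
    if "continuous_on UNIV F" for F :: "real \<Rightarrow> real"
  proof (rule tendsto_integral_of_moments[OF N(1) N0a(1) N(2) N0a(2) N(3) N0a(3) _ that])
    show "(\<lambda>i. \<integral>t. exp (- t) ^ k \<partial>N i) \<longlonglongrightarrow> (\<integral>t. exp (- t) ^ k \<partial>N0)" for k
      using lim[of "Suc k"] unfolding N(4) N0a(4) by simp
  qed
  \<comment> \<open>An average over \<open>{p..q}\<close> lies between the values at
    \<open>q\<close> and at \<open>p\<close>, for \<open>g i\<close> and for \<open>G\<close> alike.
    Comparing the two averages bounds \<open>g i\<close> at one endpoint by \<open>G\<close> at the
    other.\<close>
  have ev: "(\<forall>\<^sub>F i in sequentially. g i q < G p + e) \<and> (\<forall>\<^sub>F i in sequentially. G q - e < g i p)"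
    if pq: "0 < p" "p < q" and e: "0 < e" for p q e
  proof -
    \<comment> \<open>The tent vanishes at 1, that is at \<open>t = 0\<close>, and so does not see
      the atom that \<open>N0\<close> has there when \<alpha> = 1.\<close>
    define F where "F = (\<lambda>x::real. max 0 (min (x - exp (- q)) (exp (- p) - x)))"
    have F: "continuous_on UNIV F" "F \<in> borel_measurable borel" "\<And>x. 0 \<le> F x" "F 1 = 0"
    proof -
      show "continuous_on UNIV F" unfolding F_def by (intro continuous_intros)
      show "F \<in> borel_measurable borel" unfolding F_def by measurable
      show "F 1 = 0" unfolding F_def using pq by (intro max_absorb1) (simp add: min_le_iff_disj)
    qed (simp add: F_def)
    define W where "W = enn2real (\<integral>\<^sup>+t. ennreal (F (exp (- t)) * exp (- t)) \<partial>lborel)"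
    have "G \<in> borel_measurable borel" unfolding G_def[abs_def] by measurable
    have b0: "0 < W" "G q * W \<le> (\<integral>t. F (exp (- t)) \<partial>N0)" "(\<integral>t. F (exp (- t)) \<partial>N0) \<le> G p * W"
    proof -
      have 1: "G q \<le> G t \<and> G t \<le> G p" if "p \<le> t" "t \<le> q" for t
        using that pq by (intro conjI G_anti) auto
      have 2: "0 \<le> G q" using c by (simp add: G_def)
      have 3: "(\<integral>t. F (exp (- t)) \<partial>N0) = enn2real (\<integral>\<^sup>+t\<in>{0..}. ennreal (F (exp (- t)) * exp (- t) * G t) \<partial>lborel)"
        by (rule N0a(5)[OF F(2,3,4)])
      show "0 < W" "G q * W \<le> (\<integral>t. F (exp (- t)) \<partial>N0)" "(\<integral>t. F (exp (- t)) \<partial>N0) \<le> G p * W"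
        unfolding 3 unfolding W_def F_def
        by (rule tent_average_bounds[OF \<open>G \<in> borel_measurable borel\<close> pq 1 2]; assumption)+
    qed
    have b: "g i q * W \<le> (\<integral>t. F (exp (- t)) \<partial>N i)" "(\<integral>t. F (exp (- t)) \<partial>N i) \<le> g i p * W" for i
    proof -
      have 1: "g i q \<le> g i t \<and> g i t \<le> g i p" if "p \<le> t" "t \<le> q" for t
        using that pq by (intro conjI g_mono) auto
      have 2: "0 \<le> g i q" using pq by (intro g_nonneg) auto
      show "g i q * W \<le> (\<integral>t. F (exp (- t)) \<partial>N i)" "(\<integral>t. F (exp (- t)) \<partial>N i) \<le> g i p * W"
        unfolding N(5)[OF F(2,3)] unfolding W_def F_def
        by (rule tent_average_bounds[OF g_meas pq 1 2]; assumption)+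
    qed
    have "\<forall>\<^sub>F i in sequentially. (\<integral>t. F (exp (- t)) \<partial>N i) < (G p + e) * W"
      by (rule order_tendstoD(2)[OF conv[OF F(1)]]) (use b0 mult_pos_pos[OF e b0(1)] in \<open>simp add: distrib_right\<close>)
    then have 1: "\<forall>\<^sub>F i in sequentially. g i q < G p + e"
    proof eventually_elim
      case (elim i)
      with b(1)[of i] have "g i q * W < (G p + e) * W" by linarith
      then show ?case using b0(1) by (simp add: mult_less_cancel_right_pos)
    qed
    have "\<forall>\<^sub>F i in sequentially. (G q - e) * W < (\<integral>t. F (exp (- t)) \<partial>N i)"
    proof (rule order_tendstoD(1)[OF conv[OF F(1)]])
      show "(G q - e) * W < (\<integral>t. F (exp (- t)) \<partial>N0)"
        using b0 mult_pos_pos[OF e b0(1)] by (simp add: left_diff_distrib)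
    qed
    then have 2: "\<forall>\<^sub>F i in sequentially. G q - e < g i p"
    proof eventually_elim
      case (elim i)
      with b(2)[of i] have "(G q - e) * W < g i p * W" by linarith
      then show ?case using b0(1) by (simp add: mult_less_cancel_right_pos)
    qed
    from 1 2 show ?thesis by simp
  qed
  have cont: "(G \<longlongrightarrow> G t) (at t)" unfolding G_def[abs_def] using t by (intro tendsto_intros) auto
  have "(\<lambda>i. g i t) \<longlonglongrightarrow> G t"
  proof (rule order_tendstoI)
    fix b assume b: "b < G t"
    \<comment> \<open>Half of the gap pays for moving from \<open>t\<close> to \<open>q\<close>, the
      other half for the error in \<open>ev\<close>.\<close>
    define e where "e = (G t - b) / 2"
    have "\<forall>\<^sub>F q in at_right t. G t - e < G q"
      by (rule order_tendstoD(1)[OF tendsto_within_subset[OF cont subset_UNIV]]) (use b in \<open>simp add: e_def\<close>)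
    moreover have "\<forall>\<^sub>F q in at_right t. t < q" by (simp add: eventually_at_right_less)
    ultimately have "\<forall>\<^sub>F q in at_right t. G t - e < G q \<and> t < q" by (rule eventually_conj)
    then obtain q where q: "G t - e < G q" "t < q" using eventually_happens'[OF trivial_limit_at_right_real] by blast
    have "\<forall>\<^sub>F i in sequentially. G q - e < g i t" using ev[of t q e] q t b by (simp add: e_def)
    then show "\<forall>\<^sub>F i in sequentially. b < g i t"
    proof eventually_elim
      case (elim i)
      moreover have "G t - e - e = b" by (simp add: e_def)
      ultimately show ?case using q by linarith
    qed
  next
    fix b assume b: "G t < b"
    define e where "e = (b - G t) / 2"
    have "\<forall>\<^sub>F p in at_left t. G p < G t + e"
      by (rule order_tendstoD(2)[OF tendsto_within_subset[OF cont subset_UNIV]]) (use b in \<open>simp add: e_def\<close>)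
    moreover have "\<forall>\<^sub>F p in at_left t. p \<in> {0<..<t}"
      by (rule eventually_at_left_real[OF t])
    ultimately have "\<forall>\<^sub>F p in at_left t. G p < G t + e \<and> p \<in> {0<..<t}" by (rule eventually_conj)
    then obtain p where p: "G p < G t + e" "0 < p" "p < t" using eventually_happens'[OF trivial_limit_at_left_real] by auto
    have "\<forall>\<^sub>F i in sequentially. g i t < G p + e" using ev[of p t e] p b by (simp add: e_def)
    then show "\<forall>\<^sub>F i in sequentially. g i t < b"
    proof eventually_elim
      case (elim i)
      moreover have "G t + e + e = b" by (simp add: e_def)
      ultimately show ?case using p by linarith
    qed
  qed
  then show ?thesis by (simp add: G_def c_def)
qed

text \<open>The dynamics supplies the transform only up to a fixed factor close to 1, so a uniform
  version of the limit theorem is required. Counterexamples with tolerance \<open>1 / Suc n\<close>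
  up to order \<open>n\<close> would form a sequence contradicting
  \<open>tendsto_of_laplace_transforms\<close>. Only orders up to \<open>K\<close> are tested, so
  that finitely many asymptotic statements have to hold at once.\<close>

lemma laplace_transform_close:
  fixes \<alpha> t e :: real
  assumes \<alpha>: "0 < \<alpha>" "\<alpha> \<le> 1" and t: "0 < t" and e: "0 < e"
  obtains D :: real and K :: nat where "0 < D"
    "\<And>g l. g \<in> borel_measurable borel \<Longrightarrow> (\<And>t. 0 \<le> t \<Longrightarrow> 0 \<le> g t)
      \<Longrightarrow> (\<And>t u. 0 \<le> t \<Longrightarrow> t \<le> u \<Longrightarrow> g u \<le> g t)
      \<Longrightarrow> (\<And>k. 1 \<le> k \<Longrightarrow> (\<integral>\<^sup>+t\<in>{0..}. ennreal (exp (- (real k * t)) * g t) \<partial>lborel) = ennreal (l k))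
      \<Longrightarrow> (\<And>k. 1 \<le> k \<Longrightarrow> 0 \<le> l k)
      \<Longrightarrow> (\<And>k. 1 \<le> k \<Longrightarrow> k \<le> K \<Longrightarrow> \<bar>l k - real k powr (\<alpha> - 1) / Gamma (1 + \<alpha>)\<bar> < D)
      \<Longrightarrow> \<bar>g t - sin (pi * \<alpha>) / (pi * \<alpha>) * t powr (- \<alpha>)\<bar> < e"
proof -
  define adm where "adm g l D K \<longleftrightarrow> g \<in> borel_measurable borel \<and> (\<forall>t. 0 \<le> t \<longrightarrow> 0 \<le> g t)
      \<and> (\<forall>t u. 0 \<le> t \<longrightarrow> t \<le> u \<longrightarrow> g u \<le> g t)
      \<and> (\<forall>k\<ge>1. (\<integral>\<^sup>+t\<in>{0..}. ennreal (exp (- (real k * t)) * g t) \<partial>lborel) = ennreal (l k))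
      \<and> (\<forall>k\<ge>1. 0 \<le> l k)
      \<and> (\<forall>k\<ge>1. k \<le> K \<longrightarrow> \<bar>l k - real k powr (\<alpha> - 1) / Gamma (1 + \<alpha>)\<bar> < D)"
    for g :: "real \<Rightarrow> real" and l :: "nat \<Rightarrow> real" and D :: real and K :: nat
  let ?c = "sin (pi * \<alpha>) / (pi * \<alpha>) * t powr (- \<alpha>)"
  have "\<exists>n. \<forall>g l. adm g l (1 / real (Suc n)) n \<longrightarrow> \<bar>g t - ?c\<bar> < e"
  proof (rule ccontr)
    assume "\<not> ?thesis"
    then have "\<forall>n. \<exists>g l. adm g l (1 / real (Suc n)) n \<and> e \<le> \<bar>g t - ?c\<bar>"
      by (simp add: not_less)
    then obtain g l where gl: "\<And>n. adm (g n) (l n) (1 / real (Suc n)) n" "\<And>n. e \<le> \<bar>g n t - ?c\<bar>"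
      by metis
    have lim: "(\<lambda>n. l n k) \<longlonglongrightarrow> real k powr (\<alpha> - 1) / Gamma (1 + \<alpha>)" if "1 \<le> k" for k
    proof -
      have "(\<lambda>n. l n k - real k powr (\<alpha> - 1) / Gamma (1 + \<alpha>)) \<longlonglongrightarrow> 0"
      proof (rule Lim_null_comparison)
        show "\<forall>\<^sub>F n in sequentially. norm (l n k - real k powr (\<alpha> - 1) / Gamma (1 + \<alpha>)) \<le> 1 / real (Suc n)"
          using eventually_ge_at_top[of k] by eventually_elim (use gl(1) that in \<open>auto simp: adm_def less_imp_le\<close>)
        show "(\<lambda>n. 1 / real (Suc n)) \<longlonglongrightarrow> 0" using LIMSEQ_inverse_real_of_nat by (simp add: inverse_eq_divide)
      qed
      then show ?thesis by (simp add: LIM_zero_iff)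
    qed
    have "(\<lambda>n. g n t) \<longlonglongrightarrow> ?c"
      using gl(1) by (intro tendsto_of_laplace_transforms[OF \<alpha> _ _ _ _ _ lim t]) (auto simp: adm_def)
    then have "\<forall>\<^sub>F n in sequentially. \<bar>g n t - ?c\<bar> < e" using e by (auto dest: tendstoD simp: dist_real_def)
    then show False using gl(2) eventually_happens'[OF sequentially_bot] by (metis not_less)
  qed
  then obtain n where n: "\<And>g l. adm g l (1 / real (Suc n)) n \<Longrightarrow> \<bar>g t - ?c\<bar> < e" by blast
  show ?thesis
  proof (rule that[of "1 / real (Suc n)" n])
    fix g :: "real \<Rightarrow> real" and l :: "nat \<Rightarrow> real"
    assume "g \<in> borel_measurable borel" "\<And>t. 0 \<le> t \<Longrightarrow> 0 \<le> g t" "\<And>t u. 0 \<le> t \<Longrightarrow> t \<le> u \<Longrightarrow> g u \<le> g t"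
      "\<And>k. 1 \<le> k \<Longrightarrow> (\<integral>\<^sup>+t\<in>{0..}. ennreal (exp (- (real k * t)) * g t) \<partial>lborel) = ennreal (l k)"
      "\<And>k. 1 \<le> k \<Longrightarrow> 0 \<le> l k"
      "\<And>k. 1 \<le> k \<Longrightarrow> k \<le> n \<Longrightarrow> \<bar>l k - real k powr (\<alpha> - 1) / Gamma (1 + \<alpha>)\<bar> < 1 / real (Suc n)"
    then have "adm g l (1 / real (Suc n)) n" unfolding adm_def by blast
    then show "\<bar>g t - ?c\<bar> < e" by (rule n)
  qed simp
qed

section \<open>Regular variation and renewal sequences\<close>

context
  fixes a :: "nat \<Rightarrow> real" and \<alpha> :: real
  assumes inc: "incseq a" and rv: "regularly_varying a \<alpha>" and \<alpha>: "0 < \<alpha>" "\<alpha> \<le> 1"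
begin

lemma rv_pos: "\<forall>\<^sub>F n in sequentially. 0 < a n"
  using rv by (simp add: regularly_varying_def)

lemma rv_lim: "0 < c \<Longrightarrow> (\<lambda>n. a (nat \<lfloor>c * real n\<rfloor>) / a n) \<longlonglongrightarrow> c powr \<alpha>"
  using rv by (simp add: regularly_varying_def)

lemma rv_double: "(\<lambda>n. a (2 * n) / a n) \<longlonglongrightarrow> 2 powr \<alpha>"
proof -
  have "nat \<lfloor>2 * real n\<rfloor> = 2 * n" for n
  proof -
    have "2 * real n = real (2 * n)" by simp
    then show ?thesis by (simp only: floor_of_nat nat_int)
  qed
  then show ?thesis using rv_lim[of 2] by simp
qed

text \<open>A bounded nondecreasing sequence that is eventually positive has a positive limit, so
  \<open>a (2 * n) / a n\<close> would tend to 1 instead of \<open>2 powr \<alpha>\<close>.\<close>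

lemma rv_at_top: "filterlim a at_top sequentially"
proof (rule ccontr)
  assume *: "\<not> filterlim a at_top sequentially"
  then obtain Z where Z: "\<And>n. a n \<le> Z"
  proof -
    from * obtain Z where "\<not> (\<forall>\<^sub>F n in sequentially. Z \<le> a n)" by (auto simp: filterlim_at_top)
    then have "\<And>N. \<exists>n\<ge>N. a n < Z" by (auto simp: eventually_sequentially not_le)
    then have "a n \<le> Z" for n using incseqD[OF inc] by (metis less_imp_le order_trans)
    then show ?thesis using that by blast
  qed
  obtain L where L: "a \<longlonglongrightarrow> L" using incseq_convergent[OF inc] Z by blast
  obtain n where n: "0 < a n" using eventually_happens'[OF sequentially_bot rv_pos] by blast
  have "L > 0" using n incseq_le[OF inc L, of n] by linarith
  have "(\<lambda>n. a (2 * n)) \<longlonglongrightarrow> L"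
    using LIMSEQ_subseq_LIMSEQ[OF L, of "\<lambda>n. 2 * n"] by (simp add: strict_mono_def o_def)
  then have "(\<lambda>n. a (2 * n) / a n) \<longlonglongrightarrow> L / L"
    using L \<open>L > 0\<close> by (intro tendsto_divide) auto
  then have "2 powr \<alpha> = 1" using LIMSEQ_unique[OF rv_double] \<open>L > 0\<close> by simp
  then show False using \<alpha> by simp
qed

text \<open>Monotonicity squeezes \<open>a (Suc n)\<close> between \<open>a n\<close> and the value
  of \<open>a\<close> near \<open>c * n\<close> for any \<open>c > 1\<close>, and
  \<open>c powr \<alpha>\<close> is close to 1 for \<open>c\<close> close to 1.\<close>

lemma rv_Suc: "(\<lambda>n. a (Suc n) / a n) \<longlonglongrightarrow> 1"
proof (rule order_tendstoI)
  fix b :: real assume "b < 1"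
  show "\<forall>\<^sub>F n in sequentially. b < a (Suc n) / a n"
    using rv_pos
  proof eventually_elim
    case (elim n)
    then have "1 \<le> a (Suc n) / a n" using incseqD[OF inc, of n "Suc n"] by simp
    then show ?case using \<open>b < 1\<close> by linarith
  qed
next
  fix b :: real assume b: "1 < b"
  have "((\<lambda>c. c powr \<alpha>) \<longlongrightarrow> 1 powr \<alpha>) (at_right 1)" by (intro tendsto_intros) auto
  then have "\<forall>\<^sub>F c in at_right 1. c powr \<alpha> < b" using b by (auto intro: order_tendstoD)
  moreover have "\<forall>\<^sub>F c in at_right (1::real). 1 < c" by (rule eventually_at_right_less)
  ultimately have "\<forall>\<^sub>F c in at_right (1::real). c powr \<alpha> < b \<and> 1 < c" by (rule eventually_conj)
  then obtain c where c: "c powr \<alpha> < b" "1 < c"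
    using eventually_happens'[OF trivial_limit_at_right_real] by blast
  obtain N :: nat where N: "1 / (c - 1) \<le> real N" using real_arch_simple by blast
  have "\<forall>\<^sub>F n in sequentially. a (nat \<lfloor>c * real n\<rfloor>) / a n < b"
    using rv_lim[of c] c by (intro order_tendstoD) auto
  then show "\<forall>\<^sub>F n in sequentially. a (Suc n) / a n < b"
    using rv_pos eventually_ge_at_top[of N]
  proof eventually_elim
    case (elim n)
    have "1 / (c - 1) \<le> real n" using elim N by (meson of_nat_mono order_trans)
    then have "real (Suc n) \<le> c * real n" using c by (simp add: field_simps)
    then have "Suc n \<le> nat \<lfloor>c * real n\<rfloor>" by (simp add: le_nat_floor)
    then have "a (Suc n) \<le> a (nat \<lfloor>c * real n\<rfloor>)" by (rule incseqD[OF inc])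
    then have "a (Suc n) / a n \<le> a (nat \<lfloor>c * real n\<rfloor>) / a n" using elim by (intro divide_right_mono) auto
    then show ?case using elim by linarith
  qed
qed

text \<open>A crude Potter bound, for domination only. Since \<open>2 powr \<alpha> \<le> 2\<close>,
  doubling the index eventually multiplies \<open>a\<close> by at most 4; about
  \<open>log 2 (1 + t)\<close> doublings cost a factor \<open>4 ^ k = (2 ^ k)\<^sup>2\<close>,
  quadratic in \<open>t\<close>.\<close>

lemma rv_growth: "\<forall>\<^sub>F n in sequentially. \<forall>t\<ge>0. a (nat \<lfloor>t * real n\<rfloor>) \<le> 4 * (1 + t)\<^sup>2 * a n"
proof -
  have "2 powr \<alpha> \<le> (2::real) powr 1" using \<alpha> by (intro powr_mono) auto
  then have "\<forall>\<^sub>F n in sequentially. a (2 * n) / a n < 4"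
    by (intro order_tendstoD[OF rv_double]) auto
  then have "\<forall>\<^sub>F n in sequentially. 0 < a n \<and> a (2 * n) \<le> 4 * a n"
    using rv_pos by eventually_elim (auto simp: field_simps)
  then obtain N where N: "\<And>n. n \<ge> N \<Longrightarrow> 0 < a n \<and> a (2 * n) \<le> 4 * a n"
    by (auto simp: eventually_sequentially)
  have pow: "a (2 ^ k * n) \<le> 4 ^ k * a n" if "n \<ge> N" for n k
  proof (induction k)
    case (Suc k)
    have "N \<le> 2 ^ k * n" using that by (metis le_trans mult.commute mult_le_mono2 mult.right_neutral one_le_numeral one_le_power)
    then have "a (2 * (2 ^ k * n)) \<le> 4 * a (2 ^ k * n)" using N by blast
    then show ?case using Suc by (simp add: mult.assoc)
  qed simp
  show ?thesis
    using eventually_ge_at_top[of N]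
  proof eventually_elim
    case (elim n)
    show ?case
    proof (intro allI impI)
      fix t :: real assume t: "0 \<le> t"
      define k where "k = nat \<lceil>log 2 (1 + t)\<rceil>"
      have l0: "0 \<le> log 2 (1 + t)" using t by simp
      have "1 + t = 2 powr (log 2 (1 + t))" using t by simp
      also have "\<dots> \<le> 2 powr real k" unfolding k_def by (intro powr_mono) linarith+
      finally have k1: "1 + t \<le> 2 ^ k" by (simp add: powr_realpow)
      have "real k \<le> log 2 (1 + t) + 1" unfolding k_def using l0 by linarith
      then have "2 powr real k \<le> 2 powr (log 2 (1 + t) + 1)" by (intro powr_mono) auto
      also have "\<dots> = 2 * (1 + t)" using t by (simp add: powr_add)
      finally have k2: "2 ^ k \<le> 2 * (1 + t)" by (simp add: powr_realpow)
      have "t * real n \<le> real (2 ^ k * n)" using k1 by (simp add: mult_right_mono)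
      then have "nat \<lfloor>t * real n\<rfloor> \<le> 2 ^ k * n" by linarith
      then have "a (nat \<lfloor>t * real n\<rfloor>) \<le> a (2 ^ k * n)" by (rule incseqD[OF inc])
      also have "\<dots> \<le> 4 ^ k * a n" using pow elim by blast
      also have "(4::real) ^ k = (2 ^ k)\<^sup>2"
      proof -
        have "(2 ^ k)\<^sup>2 = ((2::real)\<^sup>2) ^ k" by (simp only: power_mult[symmetric] mult.commute)
        then show ?thesis by simp
      qed
      also have "(2 ^ k)\<^sup>2 * a n \<le> (2 * (1 + t))\<^sup>2 * a n"
        using k2 N elim by (intro mult_right_mono power_mono) (auto simp: less_imp_le)
      also have "(2 * (1 + t))\<^sup>2 = 4 * (1 + t)\<^sup>2" unfolding power_mult_distrib by simp
      finally show "a (nat \<lfloor>t * real n\<rfloor>) \<le> 4 * (1 + t)\<^sup>2 * a n" .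
    qed
  qed
qed

text \<open>Pointwise limit and polynomial envelope for the dominated convergence in
  \<open>abelian_laplace\<close>. The \<open>Suc\<close> is there because the integer part of
  \<open>t * m\<close> itself indexes a term of the sum in
  \<open>laplace_of_step_sum\<close>.\<close>

lemma rv_partial_sums_scaled:
  fixes U :: "nat \<Rightarrow> real"
  assumes U: "incseq U" "\<And>n. 0 \<le> U n" and lim: "(\<lambda>n. U n / a n) \<longlonglongrightarrow> C"
  shows "0 < t \<Longrightarrow> (\<lambda>m. U (Suc (nat \<lfloor>t * real m\<rfloor>)) / a m) \<longlonglongrightarrow> C * t powr \<alpha>"
    and "\<exists>K\<ge>0. \<forall>\<^sub>F m in sequentially. \<forall>t\<ge>0. U (Suc (nat \<lfloor>t * real m\<rfloor>)) / a m \<le> K * (2 + t)\<^sup>2"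
proof -
  assume t: "0 < t"
  let ?N = "\<lambda>m. nat \<lfloor>t * real m\<rfloor>"
  have N: "filterlim ?N at_top sequentially"
    using t by (intro filterlim_compose[OF filterlim_nat_sequentially]
      filterlim_compose[OF filterlim_floor_sequentially] filterlim_tendsto_pos_mult_at_top[OF tendsto_const])
      (auto simp: filterlim_real_sequentially)
  have "(\<lambda>n. U (Suc n) / a (Suc n)) \<longlonglongrightarrow> C" using lim by (rule LIMSEQ_Suc)
  then have "(\<lambda>n. U (Suc n) / a (Suc n) * (a (Suc n) / a n)) \<longlonglongrightarrow> C * 1"
    using rv_Suc by (rule tendsto_mult)
  then have "(\<lambda>m. U (Suc (?N m)) / a (Suc (?N m)) * (a (Suc (?N m)) / a (?N m))) \<longlonglongrightarrow> C * 1"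
    using N by (rule filterlim_compose)
  then have "(\<lambda>m. U (Suc (?N m)) / a (Suc (?N m)) * (a (Suc (?N m)) / a (?N m)) * (a (?N m) / a m)) \<longlonglongrightarrow> C * 1 * t powr \<alpha>"
    using rv_lim[OF t] by (rule tendsto_mult)
  moreover have "\<forall>\<^sub>F m in sequentially. U (Suc (?N m)) / a (Suc (?N m)) * (a (Suc (?N m)) / a (?N m)) * (a (?N m) / a m)
      = U (Suc (?N m)) / a m"
    using eventually_compose_filterlim[OF rv_pos N]
  proof eventually_elim
    case (elim m)
    moreover have "a (?N m) \<le> a (Suc (?N m))" by (rule incseqD[OF inc]) simp
    ultimately show ?case by simp
  qed
  ultimately show "(\<lambda>m. U (Suc (?N m)) / a m) \<longlonglongrightarrow> C * t powr \<alpha>" 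
    by (simp only: tendsto_cong mult_1_right)
next
  have "\<forall>\<^sub>F n in sequentially. U n / a n < C + 1" by (rule order_tendstoD[OF lim]) simp
  then have "\<forall>\<^sub>F n in sequentially. 0 < a n \<and> U n / a n < C + 1" using rv_pos by eventually_elim simp
  then obtain n0 where n0: "\<And>n. n \<ge> n0 \<Longrightarrow> 0 < a n \<and> U n / a n < C + 1"
    by (auto simp: eventually_sequentially)
  have bd: "U n \<le> (C + 1) * a n" if "n \<ge> n0" for n using n0[OF that] pos_divide_less_eq[of "a n" "U n" "C + 1"] by linarith
  have C: "0 \<le> C + 1" using n0[of n0] U(2)[of n0] by (meson divide_nonneg_pos less_imp_le order_refl order_trans)
  show "\<exists>K\<ge>0. \<forall>\<^sub>F m in sequentially. \<forall>t\<ge>0. U (Suc (nat \<lfloor>t * real m\<rfloor>)) / a m \<le> K * (2 + t)\<^sup>2"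
  proof (intro exI conjI)
    show "0 \<le> (C + 1) * 4" using C by simp
    show "\<forall>\<^sub>F m in sequentially. \<forall>t\<ge>0. U (Suc (nat \<lfloor>t * real m\<rfloor>)) / a m \<le> (C + 1) * 4 * (2 + t)\<^sup>2"
      using rv_growth eventually_ge_at_top[of "max n0 1"] rv_pos
    proof eventually_elim
      case (elim m)
      show ?case
      proof (intro allI impI)
        fix t :: real assume t: "0 \<le> t"
        \<comment> \<open>Enlarging \<open>t\<close> to \<open>t + 1\<close> absorbs the
          \<open>Suc\<close>, as \<open>m\<close> is at least 1, and keeps the index above
          \<open>n0\<close>, as \<open>m\<close> is at least \<open>n0\<close>.\<close>
        let ?M = "nat \<lfloor>(t + 1) * real m\<rfloor>"
        have "real m \<le> (t + 1) * real m" "t * real m + 1 \<le> (t + 1) * real m" using t elim by (auto simp: algebra_simps)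
        moreover have "real (Suc (nat \<lfloor>t * real m\<rfloor>)) \<le> t * real m + 1" using t by simp
        ultimately have M: "m \<le> ?M" "Suc (nat \<lfloor>t * real m\<rfloor>) \<le> ?M" by (auto intro!: le_nat_floor)
        have "U (Suc (nat \<lfloor>t * real m\<rfloor>)) \<le> U ?M" by (rule incseqD[OF U(1) M(2)])
        also have "\<dots> \<le> (C + 1) * a ?M" using M elim by (intro bd) auto
        also have "\<dots> \<le> (C + 1) * (4 * (1 + (t + 1))\<^sup>2 * a m)"
          using elim(1)[rule_format, of "t + 1"] t C by (intro mult_left_mono) simp_all
        also have "\<dots> = (C + 1) * 4 * (2 + t)\<^sup>2 * a m" by (simp only: mult.assoc add.commute[of t] add.assoc[symmetric] one_add_one)
        finally show "U (Suc (nat \<lfloor>t * real m\<rfloor>)) / a m \<le> (C + 1) * 4 * (2 + t)\<^sup>2"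
          using elim by (simp only: pos_divide_le_eq)
      qed
    qed
  qed
qed

end

section \<open>Laplace transforms of step functions and an Abelian theorem\<close>

lemma nn_integral_exp_tail:
  fixes s x :: real
  assumes "0 < s"
  shows "(\<integral>\<^sup>+t\<in>{x..}. ennreal (s * exp (- (s * t))) \<partial>lborel) = ennreal (exp (- (s * x)))"
proof -
  have "((\<lambda>t. - exp (- (s * t))) \<longlongrightarrow> - 0) at_top"
    using assms by (intro tendsto_minus filterlim_compose[OF exp_at_bot] filterlim_uminus_at_bot_at_top[THEN filterlim_compose]
      filterlim_tendsto_pos_mult_at_top[OF tendsto_const _ filterlim_ident])
  then have "(\<integral>\<^sup>+t\<in>{x..}. ennreal (s * exp (- (s * t))) \<partial>lborel) = ennreal (- 0 - (- exp (- (s * x))))"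
    using assms
    by (intro nn_integral_FTC_atLeast) (auto intro!: derivative_eq_intros)
  then show ?thesis by simp
qed

text \<open>The term \<open>u k\<close> is present exactly for \<open>t \<ge> k / m\<close>, and the
  weight \<open>s * exp (- (s * t))\<close> integrates over that ray to
  \<open>exp (- (s * k / m))\<close>.\<close>

lemma laplace_of_step_sum:
  fixes u :: "nat \<Rightarrow> real"
  assumes u: "\<And>k. 0 \<le> u k" and s: "0 < s" and m: "0 < m"
  shows "(\<integral>\<^sup>+t\<in>{0..}. ennreal (s * exp (- (s * t)) * (\<Sum>k<Suc (nat \<lfloor>t * real m\<rfloor>). u k)) \<partial>lborel)
      = (\<Sum>k. ennreal (u k * exp (- (s / real m * real k))))"
proof -
  have eq: "ennreal (s * exp (- (s * t)) * (\<Sum>k<Suc (nat \<lfloor>t * real m\<rfloor>). u k)) * indicator {0..} t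
      = (\<Sum>k. ennreal (u k) * (ennreal (s * exp (- (s * t))) * indicator {real k / real m..} t))" for t
  proof (cases "0 \<le> t")
    case True
    have "k < Suc (nat \<lfloor>t * real m\<rfloor>) \<longleftrightarrow> real k / real m \<le> t" for k
    proof -
      have "k < Suc (nat \<lfloor>t * real m\<rfloor>) \<longleftrightarrow> real k \<le> t * real m" using True by (simp add: less_Suc_eq_le le_nat_iff le_floor_iff)
      then show ?thesis using m by (simp add: pos_divide_le_eq)
    qed
    then have "(\<Sum>k. ennreal (u k) * (ennreal (s * exp (- (s * t))) * indicator {real k / real m..} t))
        = (\<Sum>k<Suc (nat \<lfloor>t * real m\<rfloor>). ennreal (u k) * (ennreal (s * exp (- (s * t))) * indicator {real k / real m..} t))"
      by (intro suminf_finite) (auto split: split_indicator)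
    also have "\<dots> = (\<Sum>k<Suc (nat \<lfloor>t * real m\<rfloor>). ennreal (s * exp (- (s * t)) * u k))"
    proof (rule sum.cong[OF refl])
      fix k assume "k \<in> {..<Suc (nat \<lfloor>t * real m\<rfloor>)}"
      then have "real k / real m \<le> t" using \<open>\<And>k. k < Suc (nat \<lfloor>t * real m\<rfloor>) \<longleftrightarrow> real k / real m \<le> t\<close> by blast
      then show "ennreal (u k) * (ennreal (s * exp (- (s * t))) * indicator {real k / real m..} t) = ennreal (s * exp (- (s * t)) * u k)"
        using u s by (simp add: ennreal_mult[symmetric] mult_ac)
    qed
    also have "\<dots> = ennreal (s * exp (- (s * t)) * (\<Sum>k<Suc (nat \<lfloor>t * real m\<rfloor>). u k))"
      using u s by (subst sum_ennreal) (auto simp: sum_distrib_left simp del: sum.lessThan_Suc)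
    finally show ?thesis using True by simp
  next
    case False
    then have "indicator {real k / real m..} t = (0::ennreal)" for k
      using order_trans[of 0 "real k / real m" t] by (auto split: split_indicator)
    then show ?thesis using False by simp
  qed
  have "(\<integral>\<^sup>+t\<in>{0..}. ennreal (s * exp (- (s * t)) * (\<Sum>k<Suc (nat \<lfloor>t * real m\<rfloor>). u k)) \<partial>lborel)
      = (\<Sum>k. \<integral>\<^sup>+t. ennreal (u k) * (ennreal (s * exp (- (s * t))) * indicator {real k / real m..} t) \<partial>lborel)"
    unfolding eq by (rule nn_integral_suminf) measurable
  also have "\<dots> = (\<Sum>k. ennreal (u k * exp (- (s / real m * real k))))"
  proof (rule suminf_cong)
    fix k
    have "(\<integral>\<^sup>+t. ennreal (u k) * (ennreal (s * exp (- (s * t))) * indicator {real k / real m..} t) \<partial>lborel)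
        = ennreal (u k) * ennreal (exp (- (s * (real k / real m))))"
      by (subst nn_integral_cmult) (use nn_integral_exp_tail[OF s] in auto)
    then show "(\<integral>\<^sup>+t. ennreal (u k) * (ennreal (s * exp (- (s * t))) * indicator {real k / real m..} t) \<partial>lborel)
        = ennreal (u k * exp (- (s / real m * real k)))"
      using u by (simp add: ennreal_mult[symmetric])
  qed
  finally show ?thesis .
qed

text \<open>The step function is constant on each interval of length \<open>1 / m\<close>;
  integrating the exponential there gives the prefactor. Its numerator is the factor
  \<open>1 - exp (- \<sigma>)\<close> of a renewal equation, at
  \<open>\<sigma> = s / m\<close>.\<close>

lemma laplace_of_step_function:
  fixes q :: "nat \<Rightarrow> real"
  assumes q: "\<And>l. 0 \<le> q l" and s: "0 < s" and m: "0 < m"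
  shows "(\<integral>\<^sup>+t\<in>{0..}. ennreal (exp (- (s * t)) * q (nat \<lfloor>t * real m\<rfloor>)) \<partial>lborel)
      = ennreal ((1 - exp (- (s / real m))) / s) * (\<Sum>l. ennreal (q l * exp (- (s / real m * real l))))"
proof -
  define I where "I l = {real l / real m..<real (Suc l) / real m}" for l
  have eq: "ennreal (exp (- (s * t)) * q (nat \<lfloor>t * real m\<rfloor>)) * indicator {0..} t
      = (\<Sum>l. ennreal (q l) * (ennreal (exp (- (s * t))) * indicator (I l) t))" for t
  proof (cases "0 \<le> t")
    case True
    let ?n = "nat \<lfloor>t * real m\<rfloor>"
    have I: "t \<in> I l \<longleftrightarrow> l = ?n" for l
    proof -
      have "t \<in> I l \<longleftrightarrow> real l \<le> t * real m \<and> t * real m < real (Suc l)"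
        unfolding I_def using m by (simp add: pos_divide_le_eq pos_less_divide_eq del: of_nat_Suc)
      also have "\<dots> \<longleftrightarrow> \<lfloor>t * real m\<rfloor> = int l" by (simp add: floor_eq_iff algebra_simps)
      finally show ?thesis using True by auto
    qed
    have "(\<Sum>l. ennreal (q l) * (ennreal (exp (- (s * t))) * indicator (I l) t))
        = (\<Sum>l\<in>{?n}. ennreal (q l) * (ennreal (exp (- (s * t))) * indicator (I l) t))"
      by (intro suminf_finite) (auto simp: I)
    then show ?thesis using True q by (simp add: I ennreal_mult[symmetric] mult_ac)
  next
    case False
    then have "indicator (I l) t = (0::ennreal)" for l
      using order_trans[of 0 "real l / real m" t] by (auto split: split_indicator simp: I_def)
    then show ?thesis using False by simp
  qed
  have int: "(\<integral>\<^sup>+t. ennreal (exp (- (s * t))) * indicator (I l) t \<partial>lborel)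
      = ennreal ((1 - exp (- (s / real m))) / s * exp (- (s / real m * real l)))" for l
  proof -
    have "((\<lambda>t. - exp (- (s * t)) / s) has_real_derivative exp (- (s * x))) (at x)" for x
      using s by (auto intro!: derivative_eq_intros)
    then have "(\<integral>\<^sup>+t. ennreal (exp (- (s * t))) * indicator {real l / real m..real (Suc l) / real m} t \<partial>lborel)
        = ennreal (- exp (- (s * (real (Suc l) / real m))) / s - (- exp (- (s * (real l / real m))) / s))"
      using m by (intro nn_integral_FTC_Icc)
        (auto intro: divide_right_mono DERIV_subset simp: has_real_derivative_iff_has_vector_derivative[symmetric])
    also have "- exp (- (s * (real (Suc l) / real m))) / s - (- exp (- (s * (real l / real m))) / s)
        = (1 - exp (- (s / real m))) / s * exp (- (s / real m * real l))"
      using s m by (simp add: exp_add[symmetric] field_simps)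
    finally have *: "(\<integral>\<^sup>+t. ennreal (exp (- (s * t))) * indicator {real l / real m..real (Suc l) / real m} t \<partial>lborel)
        = ennreal ((1 - exp (- (s / real m))) / s * exp (- (s / real m * real l)))" .
    have "AE t in lborel. t \<noteq> real (Suc l) / real m" by (rule AE_lborel_singleton)
    then have "(\<integral>\<^sup>+t. ennreal (exp (- (s * t))) * indicator (I l) t \<partial>lborel)
        = (\<integral>\<^sup>+t. ennreal (exp (- (s * t))) * indicator {real l / real m..real (Suc l) / real m} t \<partial>lborel)"
      by (intro nn_integral_cong_AE) (auto simp: I_def split: split_indicator)
    then show ?thesis unfolding * .
  qed
  have "(\<integral>\<^sup>+t\<in>{0..}. ennreal (exp (- (s * t)) * q (nat \<lfloor>t * real m\<rfloor>)) \<partial>lborel)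
      = (\<Sum>l. \<integral>\<^sup>+t. ennreal (q l) * (ennreal (exp (- (s * t))) * indicator (I l) t) \<partial>lborel)"
    unfolding eq by (rule nn_integral_suminf) (unfold I_def, measurable)
  also have "\<dots> = (\<Sum>l. ennreal ((1 - exp (- (s / real m))) / s) * ennreal (q l * exp (- (s / real m * real l))))"
  proof (rule suminf_cong)
    fix l
    have "0 \<le> (1 - exp (- (s / real m))) / s" using s m by simp
    moreover have "(\<integral>\<^sup>+t. ennreal (q l) * (ennreal (exp (- (s * t))) * indicator (I l) t) \<partial>lborel)
        = ennreal (q l) * ennreal ((1 - exp (- (s / real m))) / s * exp (- (s / real m * real l)))"
      unfolding int[symmetric] by (intro nn_integral_cmult) (unfold I_def, measurable)
    ultimately show "(\<integral>\<^sup>+t. ennreal (q l) * (ennreal (exp (- (s * t))) * indicator (I l) t) \<partial>lborel)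
        = ennreal ((1 - exp (- (s / real m))) / s) * ennreal (q l * exp (- (s / real m * real l)))"
      using q by (simp only: ennreal_mult[symmetric] mult_nonneg_nonneg exp_ge_zero mult_ac)
  qed
  also have "\<dots> = ennreal ((1 - exp (- (s / real m))) / s) * (\<Sum>l. ennreal (q l * exp (- (s / real m * real l))))"
    by (rule ennreal_suminf_cmult)
  finally show ?thesis .
qed

text \<open>The Abelian half of Karamata's theorem: after rescaling time by \<open>m\<close> the
  partial sums divided by \<open>a m\<close> converge to \<open>C * t powr \<alpha>\<close>, and the
  limit is the integral of this function against \<open>s * exp (- (s * t))\<close>.\<close>

lemma abelian_laplace:
  fixes u a :: "nat \<Rightarrow> real"
  assumes inc: "incseq a" and rv: "regularly_varying a \<alpha>" and \<alpha>: "0 < \<alpha>" "\<alpha> \<le> 1"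
    and u: "\<And>k. 0 \<le> u k" and lim: "(\<lambda>n. (\<Sum>k<n. u k) / a n) \<longlonglongrightarrow> C" and s: "0 < s"
  shows "\<forall>\<^sub>F m in sequentially. summable (\<lambda>k. u k * exp (- (s / real m * real k)))"
    and "(\<lambda>m. (\<Sum>k. u k * exp (- (s / real m * real k))) / a m) \<longlonglongrightarrow> C * Gamma (1 + \<alpha>) * s powr (- \<alpha>)"
proof -
  define U where "U n = (\<Sum>k<n. u k)" for n
  have U: "incseq U" "\<And>n. 0 \<le> U n"
    unfolding U_def by (auto intro!: incseq_SucI sum_nonneg u)
  have lim': "(\<lambda>n. U n / a n) \<longlonglongrightarrow> C" using lim by (simp add: U_def)
  note sc = rv_partial_sums_scaled[OF inc rv \<alpha> U lim']
  obtain K where K: "0 \<le> K" "\<forall>\<^sub>F m in sequentially. \<forall>t\<ge>0. U (Suc (nat \<lfloor>t * real m\<rfloor>)) / a m \<le> K * (2 + t)\<^sup>2"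
    using sc(2) by blast
  have "\<forall>\<^sub>F m in sequentially. (\<forall>t\<ge>0. U (Suc (nat \<lfloor>t * real m\<rfloor>)) / a m \<le> K * (2 + t)\<^sup>2) \<and> 0 < a m \<and> 0 < m"
    using K(2) rv_pos[OF inc rv \<alpha>] eventually_gt_at_top[of 0] by eventually_elim auto
  then obtain m0 where m0: "\<And>m. m \<ge> m0 \<Longrightarrow> (\<forall>t\<ge>0. U (Suc (nat \<lfloor>t * real m\<rfloor>)) / a m \<le> K * (2 + t)\<^sup>2) \<and> 0 < a m \<and> 0 < m"
    by (auto simp: eventually_sequentially)
  define f where "f m t = s * exp (- (s * t)) * (U (Suc (nat \<lfloor>t * real m\<rfloor>)) / a m) * indicator {0..} t" for m t
  \<comment> \<open>Envelope: \<open>(2 + t)\<^sup>2\<close> is at most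
    \<open>8 + 16 / s\<^sup>2\<close> times \<open>exp (s / 2 * t)\<close>, which uses up half of
    the exponential decay.\<close>
  define w where "w t = (K * (8 + 16 / s\<^sup>2) * s) * (exp (- (s / 2 * t)) * indicator {0..} t)" for t :: real
  define f0 where "f0 t = C * s * (t powr \<alpha> * exp (- (s * t)) * indicator {0..} t)" for t :: real
  have intp: "integrable lborel (\<lambda>t::real. t powr (x - 1) * exp (- (\<sigma> * t)) * indicator {0..} t) \<and>
      (\<integral>t. t powr (x - 1) * exp (- (\<sigma> * t)) * indicator {0..} t \<partial>lborel) = Gamma x * \<sigma> powr (- x)"
    if "0 < x" "0 < \<sigma>" for x \<sigma> :: real
  proof -
    have *: "(\<integral>\<^sup>+t. ennreal (t powr (x - 1) * exp (- (\<sigma> * t)) * indicator {0..} t) \<partial>lborel) = ennreal (Gamma x * \<sigma> powr (- x))"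
    proof -
      have "ennreal (t powr (x - 1) * exp (- (\<sigma> * t)) * indicator {0..} t)
          = ennreal (t powr (x - 1) * exp (- \<sigma> * t)) * indicator {0..} t" for t
        by (simp split: split_indicator)
      then show ?thesis using nn_integral_powr_exp[OF that] by (simp only:)
    qed
    have "0 \<le> Gamma x * \<sigma> powr (- x)" using that by (simp add: less_imp_le)
    then show ?thesis
      by (intro conjI integrableI_nonneg) (auto simp: integral_eq_nn_integral *)
  qed
  have wint: "integrable lborel w"
  proof -
    have "integrable lborel (\<lambda>t::real. t powr (1 - 1) * exp (- (s / 2 * t)) * indicator {0..} t)"
      using intp[of 1 "s/2"] s by auto
    \<comment> \<open>In HOL \<open>0 powr 0\<close> is 0, so the two integrands differ at the
      origin.\<close>
    then have "integrable lborel (\<lambda>t::real. exp (- (s / 2 * t)) * indicator {0..} t)"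
      by (rule integrable_cong_AE_imp) (use AE_lborel_singleton[of 0] in \<open>auto elim: eventually_mono\<close>)
    then show ?thesis unfolding w_def by (rule integrable_mult_right)
  qed
  have dom: "\<bar>f m t\<bar> \<le> w t" if "m \<ge> m0" for m t
  proof (cases "0 \<le> t")
    case True
    define y where "y = s / 2 * t"
    have y: "0 \<le> y" using True s by (simp add: y_def)
    have "1 + y + y\<^sup>2 / 2 \<le> exp y" using exp_lower_Taylor_quadratic[OF y] .
    then have "1 \<le> exp y" "y\<^sup>2 \<le> 2 * exp y" using y zero_le_power2[of y] by linarith+
    have "(2 + t)\<^sup>2 \<le> 8 + 2 * t\<^sup>2" using sum_squares_bound[of 2 t] by (simp add: power2_sum)
    also have "t = 2 / s * y" using s by (simp add: y_def)
    also have "8 + 2 * (2 / s * y)\<^sup>2 = 8 + 8 / s\<^sup>2 * y\<^sup>2" by (simp add: power_mult_distrib power_divide)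
    also have "\<dots> \<le> 8 * exp y + 8 / s\<^sup>2 * (2 * exp y)"
      using \<open>1 \<le> exp y\<close> \<open>y\<^sup>2 \<le> 2 * exp y\<close> by (intro add_mono mult_left_mono) auto
    also have "\<dots> = (8 + 16 / s\<^sup>2) * exp y" by (simp add: algebra_simps)
    finally have t2: "(2 + t)\<^sup>2 \<le> (8 + 16 / s\<^sup>2) * exp y" using s by (simp add: y_def)
    have "0 \<le> U (Suc (nat \<lfloor>t * real m\<rfloor>)) / a m" by (intro divide_nonneg_pos U(2)) (use m0[OF that] in blast)
    then have "\<bar>f m t\<bar> = s * exp (- (s * t)) * (U (Suc (nat \<lfloor>t * real m\<rfloor>)) / a m)"
    proof -
      assume "0 \<le> U (Suc (nat \<lfloor>t * real m\<rfloor>)) / a m"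
      then have "0 \<le> s * exp (- (s * t)) * (U (Suc (nat \<lfloor>t * real m\<rfloor>)) / a m)"
        using s by (intro mult_nonneg_nonneg) auto
      moreover have "f m t = s * exp (- (s * t)) * (U (Suc (nat \<lfloor>t * real m\<rfloor>)) / a m)"
        using True by (simp add: f_def)
      ultimately show ?thesis by (simp only: abs_of_nonneg)
    qed
    also have "\<dots> \<le> s * exp (- (s * t)) * (K * (2 + t)\<^sup>2)"
      using m0[OF that] True s by (intro mult_left_mono) auto
    also have "\<dots> \<le> s * exp (- (s * t)) * (K * ((8 + 16 / s\<^sup>2) * exp y))"
      using t2 s K by (intro mult_left_mono) auto
    also have "\<dots> = w t"
    proof -
      have "exp (- (s / 2 * t)) = exp (- (s * t)) * exp y" unfolding exp_add[symmetric] by (simp add: y_def)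
      then show ?thesis using True by (simp add: w_def mult_ac)
    qed
    finally show ?thesis .
  qed (simp add: f_def w_def)
  have lim_f: "AE t in lborel. (\<lambda>m. f (m + m0) t) \<longlonglongrightarrow> f0 t"
    using AE_lborel_singleton[of 0]
  proof eventually_elim
    case (elim t)
    show ?case
    proof (cases "0 \<le> t")
      case True
      then have "(\<lambda>m. s * exp (- (s * t)) * (U (Suc (nat \<lfloor>t * real m\<rfloor>)) / a m) * indicator {0..} t)
          \<longlonglongrightarrow> s * exp (- (s * t)) * (C * t powr \<alpha>) * indicator {0..} t"
        using elim by (intro tendsto_intros sc(1)) auto
      then have "(\<lambda>m. f m t) \<longlonglongrightarrow> f0 t" by (simp add: f_def f0_def mult_ac)
      then show ?thesis by (rule LIMSEQ_ignore_initial_segment)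
    qed (simp add: f_def f0_def)
  qed
  have [measurable]: "f m \<in> borel_measurable lborel" "f0 \<in> borel_measurable lborel" for m
    unfolding f_def[abs_def] f0_def[abs_def] by measurable
  have fint: "integrable lborel (f (m + m0))" for m
    by (rule Bochner_Integration.integrable_bound[OF wint]) (auto intro!: AE_I2 intro: order_trans[OF dom abs_ge_self])
  have "(\<lambda>m. \<integral>t. f (m + m0) t \<partial>lborel) \<longlonglongrightarrow> (\<integral>t. f0 t \<partial>lborel)"
    by (rule integral_dominated_convergence[OF _ _ wint lim_f]) (use dom in auto)
  then have lim_int: "(\<lambda>m. \<integral>t. f m t \<partial>lborel) \<longlonglongrightarrow> (\<integral>t. f0 t \<partial>lborel)"
    by (rule LIMSEQ_offset)
  have int0: "(\<integral>t. f0 t \<partial>lborel) = C * Gamma (1 + \<alpha>) * s powr (- \<alpha>)"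
  proof -
    have "(\<integral>t. f0 t \<partial>lborel) = C * s * (\<integral>t. t powr ((1 + \<alpha>) - 1) * exp (- (s * t)) * indicator {0..} t \<partial>lborel)"
      unfolding f0_def by simp
    also have "\<dots> = C * s * (Gamma (1 + \<alpha>) * s powr (- (1 + \<alpha>)))"
      using intp[of "1 + \<alpha>" s] \<alpha> s by simp
    also have "s powr (- (1 + \<alpha>)) = s powr (- \<alpha>) / s"

    proof -
      have "s powr (- \<alpha> - 1) = s powr (- \<alpha>) / s" using s powr_diff[of s "- \<alpha>" 1] by simp
      moreover have "- (1 + \<alpha>) = - \<alpha> - 1" by simp
      ultimately show ?thesis by (simp only:)
    qed
    finally show ?thesis using s by simp
  qed
  have eq: "summable (\<lambda>k. u k * exp (- (s / real m * real k)))
      \<and> (\<Sum>k. u k * exp (- (s / real m * real k))) / a m = (\<integral>t. f m t \<partial>lborel)" if m: "m \<ge> m0" for m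
  proof -
    have am: "0 < a m" "0 < m" using m0[OF m] by auto
    have fm: "integrable lborel (f m)" using fint[of "m - m0"] m by simp
    have fnn: "0 \<le> f m t" for t unfolding f_def using s am by (intro mult_nonneg_nonneg divide_nonneg_pos U(2)) auto
    have "(\<Sum>k. ennreal (u k * exp (- (s / real m * real k))))
        = (\<integral>\<^sup>+t\<in>{0..}. ennreal (s * exp (- (s * t)) * U (Suc (nat \<lfloor>t * real m\<rfloor>))) \<partial>lborel)"
      unfolding U_def by (rule laplace_of_step_sum[OF u s am(2), symmetric])
    also have "\<dots> = (\<integral>\<^sup>+t. ennreal (a m) * ennreal (f m t) \<partial>lborel)"
      using am U(2) s by (intro nn_integral_cong) (auto simp: f_def ennreal_mult[symmetric] split: split_indicator)
    also have "\<dots> = ennreal (a m) * ennreal (\<integral>t. f m t \<partial>lborel)"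
      using fm fnn by (subst nn_integral_cmult) (auto simp: nn_integral_eq_integral)
    also have "\<dots> = ennreal (a m * (\<integral>t. f m t \<partial>lborel))"
      using am by (intro ennreal_mult'[symmetric]) simp
    finally have E: "(\<Sum>k. ennreal (u k * exp (- (s / real m * real k)))) = ennreal (a m * (\<integral>t. f m t \<partial>lborel))" .
    have nn: "0 \<le> u k * exp (- (s / real m * real k))" for k using u by simp
    have S: "summable (\<lambda>k. u k * exp (- (s / real m * real k)))"
      by (rule summable_suminf_not_top[OF nn]) (unfold E, simp)
    moreover have "ennreal (\<Sum>k. u k * exp (- (s / real m * real k))) = ennreal (a m * (\<integral>t. f m t \<partial>lborel))"
      using suminf_ennreal2[OF nn S] E by simp
    then have "(\<Sum>k. u k * exp (- (s / real m * real k))) = a m * (\<integral>t. f m t \<partial>lborel)"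
      using suminf_nonneg[OF S nn] am fnn by (subst (asm) ennreal_inj) (auto simp: Bochner_Integration.integral_nonneg)
    ultimately show ?thesis using am by simp
  qed
  show "\<forall>\<^sub>F m in sequentially. summable (\<lambda>k. u k * exp (- (s / real m * real k)))"
    using eventually_ge_at_top[of m0] by eventually_elim (use eq in blast)
  have "\<forall>\<^sub>F m in sequentially. (\<Sum>k. u k * exp (- (s / real m * real k))) / a m = (\<integral>t. f m t \<partial>lborel)"
    using eventually_ge_at_top[of m0] by eventually_elim (use eq in blast)
  then show "(\<lambda>m. (\<Sum>k. u k * exp (- (s / real m * real k))) / a m) \<longlonglongrightarrow> C * Gamma (1 + \<alpha>) * s powr (- \<alpha>)"
    using lim_int unfolding int0 by (simp only: tendsto_cong)
qed

text \<open>If the convolution \<open>(\<Sum>k\<le>n. u k * q (n - k))\<close> were 1 for all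
  \<open>n\<close>, as for a renewal sequence \<open>u\<close> and the tail \<open>q\<close> of its
  waiting time, this product of generating functions at \<open>exp (- \<sigma>)\<close> would be
  exactly 1. The factor \<open>\<kappa>\<close> measures the deviation.\<close>

definition almost_renewal :: "real \<Rightarrow> (nat \<Rightarrow> real) \<Rightarrow> (nat \<Rightarrow> real) \<Rightarrow> bool" where
  "almost_renewal \<kappa> q u \<longleftrightarrow> (\<forall>\<sigma>>0. summable (\<lambda>k. u k * exp (- (\<sigma> * real k))) \<longrightarrow>
    (1 - exp (- \<sigma>)) * (\<Sum>l. q l * exp (- (\<sigma> * real l))) * (\<Sum>k. u k * exp (- (\<sigma> * real k))) \<in> {1 / \<kappa>..\<kappa>})"

text \<open>The renewal equation is only known up to a factor \<open>\<kappa>\<close> close to \<open>1\<close>, so the Tauberian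
  conclusion is stated with an \<open>e\<close>--\<open>d\<close> quantification uniform in \<open>q\<close> and \<open>u\<close>.\<close>

lemma renewal_tail_close:
  fixes a :: "nat \<Rightarrow> real" and t e :: real
  assumes inc: "incseq a" and rv: "regularly_varying a \<alpha>" and \<alpha>: "0 < \<alpha>" "\<alpha> \<le> 1"
    and t: "0 < t" and e: "0 < e"
  obtains d :: real where "0 < d"
    "\<And>q u \<kappa>. (\<And>l. 0 \<le> q l) \<Longrightarrow> decseq q \<Longrightarrow> (\<And>k. 0 \<le> u k)
      \<Longrightarrow> (\<lambda>n. (\<Sum>k<n. u k) / a n) \<longlonglongrightarrow> 1 \<Longrightarrow> 1 \<le> \<kappa> \<Longrightarrow> \<kappa> \<le> 1 + d
      \<Longrightarrow> almost_renewal \<kappa> q u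
      \<Longrightarrow> \<forall>\<^sub>F m in sequentially. \<bar>a m * q (nat \<lfloor>t * real m\<rfloor>) - sin (pi * \<alpha>) / (pi * \<alpha>) * t powr (- \<alpha>)\<bar> < e"
proof -
  obtain D :: real and K :: nat where D: "0 < D" and close:
    "\<And>g l. g \<in> borel_measurable borel \<Longrightarrow> (\<And>t. 0 \<le> t \<Longrightarrow> 0 \<le> g t)
      \<Longrightarrow> (\<And>t u. 0 \<le> t \<Longrightarrow> t \<le> u \<Longrightarrow> g u \<le> g t)
      \<Longrightarrow> (\<And>k. 1 \<le> k \<Longrightarrow> (\<integral>\<^sup>+t\<in>{0..}. ennreal (exp (- (real k * t)) * g t) \<partial>lborel) = ennreal (l k))
      \<Longrightarrow> (\<And>k. 1 \<le> k \<Longrightarrow> 0 \<le> l k)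
      \<Longrightarrow> (\<And>k. 1 \<le> k \<Longrightarrow> k \<le> K \<Longrightarrow> \<bar>l k - real k powr (\<alpha> - 1) / Gamma (1 + \<alpha>)\<bar> < D)
      \<Longrightarrow> \<bar>g t - sin (pi * \<alpha>) / (pi * \<alpha>) * t powr (- \<alpha>)\<bar> < e"
    using laplace_transform_close[OF \<alpha> t e] by blast
  define G where "G = Gamma (1 + \<alpha>)"
  have G: "0 < G" using \<alpha> by (simp add: G_def)
  \<comment> \<open>Below, \<open>x\<close> is within \<open>d\<close> of 1 and \<open>y\<close>
    within \<open>D / 4\<close> of \<open>L \<le> 1 / G\<close>, so \<open>x * y\<close> differs
    from \<open>L\<close> by at most \<open>2 * (D / 4) + d / G\<close>, that is by at most
    \<open>3 * D / 4\<close>; the bound \<open>d \<le> 1\<close> gives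
    \<open>x \<le> 2\<close>.\<close>
  define d where "d = min 1 (D * G / 4)"
  have d: "0 < d" using D G by (simp add: d_def)
  show ?thesis
  proof (rule that[OF d])
    fix q u :: "nat \<Rightarrow> real" and \<kappa> :: real
    assume q: "\<And>l. 0 \<le> q l" "decseq q" and u: "\<And>k. 0 \<le> u k"
      and lim: "(\<lambda>n. (\<Sum>k<n. u k) / a n) \<longlonglongrightarrow> 1" and \<kappa>: "1 \<le> \<kappa>" "\<kappa> \<le> 1 + d"
      and ren: "almost_renewal \<kappa> q u"
    define Q where "Q \<sigma> = (\<Sum>l. q l * exp (- (\<sigma> * real l)))" for \<sigma>
    define b where "b \<sigma> = (\<Sum>k. u k * exp (- (\<sigma> * real k)))" for \<sigma>
    have sumq: "summable (\<lambda>l. q l * exp (- (\<sigma> * real l)))" if "0 < \<sigma>" for \<sigma>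
    proof (rule summable_comparison_test')
      show "summable (\<lambda>l. q 0 * exp (- \<sigma>) ^ l)" using that by (intro summable_mult summable_geometric) simp
      fix l :: nat
      have "exp (- (\<sigma> * real l)) = exp (- \<sigma>) ^ l" by (simp add: exp_of_nat_mult[symmetric] mult.commute)
      then show "norm (q l * exp (- (\<sigma> * real l))) \<le> q 0 * exp (- \<sigma>) ^ l"
        using q(1)[of l] decseqD[OF q(2), of 0 l] by (simp add: mult_right_mono)
    qed
    have Lk: "real k powr (\<alpha> - 1) / G \<le> 1 / G" if "1 \<le> k" for k
    proof -
      have "real k powr (\<alpha> - 1) \<le> real k powr 0" using that \<alpha> by (intro powr_mono) auto
      then show ?thesis using that G by (simp add: divide_right_mono)
    qed
    have "\<forall>\<^sub>F m in sequentially. \<forall>k\<in>{1..K}. summable (\<lambda>j. u j * exp (- (real k / real m * real j)))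
        \<and> \<bar>1 / real k * inverse (b (real k / real m) / a m) - real k powr (\<alpha> - 1) / G\<bar> < D / 4"
    proof (rule eventually_ball_finite, simp, intro ballI)
      fix k :: nat assume "k \<in> {1..K}"
      then have k: "0 < real k" by simp
      note ab = abelian_laplace[OF inc rv \<alpha> u lim k]
      have "(\<lambda>m. 1 / real k * inverse (b (real k / real m) / a m)) \<longlonglongrightarrow> 1 / real k * inverse (1 * Gamma (1 + \<alpha>) * real k powr (- \<alpha>))"
        unfolding b_def using ab(2) k G by (intro tendsto_intros) (auto simp: G_def)
      also have "1 / real k * inverse (1 * Gamma (1 + \<alpha>) * real k powr (- \<alpha>)) = real k powr (\<alpha> - 1) / G"
        using k by (simp add: G_def powr_minus powr_diff divide_simps)
      finally have "\<forall>\<^sub>F m in sequentially. dist (1 / real k * inverse (b (real k / real m) / a m)) (real k powr (\<alpha> - 1) / G) < D / 4"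
        using D by (intro tendstoD) auto
      with ab(1) show "\<forall>\<^sub>F m in sequentially. summable (\<lambda>j. u j * exp (- (real k / real m * real j)))
        \<and> \<bar>1 / real k * inverse (b (real k / real m) / a m) - real k powr (\<alpha> - 1) / G\<bar> < D / 4"
        by eventually_elim (simp add: dist_real_def)
    qed
    then show "\<forall>\<^sub>F m in sequentially. \<bar>a m * q (nat \<lfloor>t * real m\<rfloor>) - sin (pi * \<alpha>) / (pi * \<alpha>) * t powr (- \<alpha>)\<bar> < e"
      using rv_pos[OF inc rv \<alpha>] eventually_gt_at_top[of 0]
    proof eventually_elim
      case (elim m)
      define l where "l k = a m * ((1 - exp (- (real k / real m))) / real k * Q (real k / real m))" for k :: nat
      show ?case
      proof (rule close[where g = "\<lambda>t. a m * q (nat \<lfloor>t * real m\<rfloor>)" and l = l])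
        have "(\<lambda>t::real. q (nat \<lfloor>t * real m\<rfloor>)) \<in> borel_measurable borel"
          by (rule measurable_compose[of _ _ "count_space UNIV"]) measurable
        then show "(\<lambda>t. a m * q (nat \<lfloor>t * real m\<rfloor>)) \<in> borel_measurable borel" by measurable
        show "0 \<le> a m * q (nat \<lfloor>t * real m\<rfloor>)" for t using q elim by simp
        show "a m * q (nat \<lfloor>v * real m\<rfloor>) \<le> a m * q (nat \<lfloor>t * real m\<rfloor>)" if "0 \<le> t" "t \<le> v" for t v
          using that elim by (intro mult_left_mono decseqD[OF q(2)] nat_mono floor_mono mult_right_mono) auto
        show "(\<integral>\<^sup>+t\<in>{0..}. ennreal (exp (- (real k * t)) * (a m * q (nat \<lfloor>t * real m\<rfloor>))) \<partial>lborel) = ennreal (l k)"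
          if k: "1 \<le> k" for k
        proof -
          have k': "0 < real k" "0 < real k / real m" using k elim by auto
          have nn: "0 \<le> q j * exp (- (real k / real m * real j))" for j using q by simp
          have "(\<integral>\<^sup>+t\<in>{0..}. ennreal (exp (- (real k * t)) * (a m * q (nat \<lfloor>t * real m\<rfloor>))) \<partial>lborel)
              = ennreal ((1 - exp (- (real k / real m))) / real k) * (\<Sum>j. ennreal ((a m * q j) * exp (- (real k / real m * real j))))"
            using elim q k' by (intro laplace_of_step_function) auto
          also have "(\<Sum>j. ennreal ((a m * q j) * exp (- (real k / real m * real j))))
              = (\<Sum>j. ennreal (a m) * ennreal (q j * exp (- (real k / real m * real j))))"
            using elim nn by (intro suminf_cong) (simp only: ennreal_mult[symmetric] mult.assoc less_imp_le)
          also have "\<dots> = ennreal (a m) * ennreal (Q (real k / real m))"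
            unfolding Q_def using suminf_ennreal2[OF nn sumq[OF k'(2)]] by simp
          also have "ennreal ((1 - exp (- (real k / real m))) / real k) * (ennreal (a m) * ennreal (Q (real k / real m))) = ennreal (l k)"
            using elim k' suminf_nonneg[OF sumq[OF k'(2)] nn]
            by (simp add: l_def ennreal_mult[symmetric] Q_def mult_ac)
          finally show ?thesis .
        qed
        show "0 \<le> l k" if k: "1 \<le> k" for k
        proof -
          have "0 \<le> Q (real k / real m)" unfolding Q_def using k elim q by (intro suminf_nonneg sumq) auto
          then show ?thesis unfolding l_def using elim k by (intro mult_nonneg_nonneg divide_nonneg_pos) auto
        qed
        show "\<bar>l k - real k powr (\<alpha> - 1) / Gamma (1 + \<alpha>)\<bar> < D" if k: "1 \<le> k" "k \<le> K" for k
        proof -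
          \<comment> \<open>\<open>l k\<close> factors as \<open>x * y\<close>: the renewal product
            \<open>x\<close> is known up to \<open>\<kappa>\<close>, and \<open>y\<close> is close
            to the reference transform by the Abelian theorem.\<close>
          define x where "x = (1 - exp (- (real k / real m))) * Q (real k / real m) * b (real k / real m)"
          define y where "y = 1 / real k * inverse (b (real k / real m) / a m)"
          define L where "L = real k powr (\<alpha> - 1) / G"
          have kK: "k \<in> {1..K}" using k by simp
          have x: "1 / \<kappa> \<le> x" "x \<le> \<kappa>"
            using ren[unfolded almost_renewal_def, rule_format, of "real k / real m"] elim kK
            by (auto simp: x_def Q_def b_def)
          have "0 < 1 / \<kappa>" using \<kappa> by simp
          then have "0 < x" using x by linarith
          then have "b (real k / real m) \<noteq> 0" by (auto simp: x_def)
          then have lxy: "l k = x * y" by (simp add: l_def x_def y_def divide_inverse mult_ac)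
          have y: "\<bar>y - L\<bar> < D / 4" using elim kK by (simp add: y_def L_def)
          have L: "0 \<le> L" "L \<le> 1 / G" using Lk[OF k(1)] G by (simp_all add: L_def)
          \<comment> \<open>Convexity of the reciprocal turns the lower bound
            \<open>1 / \<kappa>\<close> for \<open>x\<close> into \<open>1 - d\<close>.\<close>
          have "1 / \<kappa> \<ge> 2 - \<kappa>"
          proof -
            have "0 \<le> (\<kappa> - 1)\<^sup>2 / \<kappa>" using \<kappa> by simp
            also have "(\<kappa> - 1)\<^sup>2 / \<kappa> = \<kappa> - 2 + 1 / \<kappa>" using \<kappa> by (simp add: power2_eq_square field_simps)
            finally show ?thesis by simp
          qed
          moreover have "d \<le> 1" by (simp add: d_def)
          ultimately have x1: "\<bar>x - 1\<bar> \<le> d" "x \<le> 2" using x \<kappa> unfolding abs_le_iff by linarith+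
          have "\<bar>x * y - L\<bar> = \<bar>x * (y - L) + (x - 1) * L\<bar>" by (simp add: algebra_simps)
          also have "\<dots> \<le> \<bar>x * (y - L)\<bar> + \<bar>(x - 1) * L\<bar>" by (rule abs_triangle_ineq)
          also have "\<dots> = x * \<bar>y - L\<bar> + \<bar>x - 1\<bar> * L" using \<open>0 < x\<close> L by (simp add: abs_mult)
          also have "\<dots> \<le> 2 * (D / 4) + (D * G / 4) * (1 / G)"
            using x1 y L \<open>0 < x\<close> D G by (intro add_mono mult_mono) (auto simp: d_def)
          also have "\<dots> < D" using D G by simp
          finally show ?thesis by (simp add: lxy L_def G_def)
        qed
      qed
    qed
  qed
qed

section \<open>The Borel structure of the shift space\<close>

text \<open>Makes the sums over preimages in \<open>ruelle\<close> accessible to monotonicity,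
  linearity and measurability of the nonnegative integral.\<close>

lemma infsum_ennreal_eq_nn_integral:
  fixes f :: "'a \<Rightarrow> ennreal"
  assumes "countable S"
  shows "infsum f S = (\<integral>\<^sup>+x. f x \<partial>count_space S)"
proof (cases "finite S")
  case True
  then show ?thesis by (simp add: nn_integral_count_space_finite)
next
  case False
  then have b: "bij_betw (from_nat_into S) UNIV S" using assms by (simp add: bij_betw_from_nat_into)
  have "infsum f S = infsum (\<lambda>n. f (from_nat_into S n)) UNIV"
    by (rule infsum_reindex_bij_betw[OF b, symmetric])
  also have "\<dots> = (\<Sum>n. f (from_nat_into S n))"
  proof (rule sums_unique[OF has_sum_imp_sums])
    show "((\<lambda>n. f (from_nat_into S n)) has_sum (\<Sum>\<^sub>\<infinity>n. f (from_nat_into S n))) UNIV"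
      by (rule has_sum_infsum[OF nonneg_summable_on_complete]) simp
  qed
  also have "\<dots> = (\<integral>\<^sup>+x. f x \<partial>count_space S)"
    using nn_integral_bij_count_space[OF b, of f] by (simp add: nn_integral_count_space_nat)
  finally show ?thesis .
qed

lemma funpow_shift: "(shift ^^ k) x = (\<lambda>i. x (i + k))"
  by (induction k) (auto simp: shift_def)

lemma shift_space_shift: "x \<in> shift_space A \<Longrightarrow> shift x \<in> shift_space A"
  by (simp add: shift_space_def shift_def)

lemma shift_space_funpow: "x \<in> shift_space A \<Longrightarrow> (shift ^^ k) x \<in> shift_space A"
  by (induction k) (auto simp: shift_space_shift)

lemma shift_dist_le:
  assumes \<eta>: "0 < \<eta>" "\<eta> < 1" and xy: "\<forall>i<n. x i = y i"
  shows "shift_dist \<eta> x y \<le> \<eta> ^ n"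
proof (cases "x = y")
  case False
  then have "\<exists>i. x i \<noteq> y i" by (simp add: fun_eq_iff)
  then have "n \<le> (LEAST i. x i \<noteq> y i)" using xy by (metis (mono_tags, lifting) LeastI_ex not_less)
  then show ?thesis using False \<eta> by (simp add: shift_dist_def power_decreasing)
qed (use \<eta> in \<open>simp add: shift_dist_def\<close>)

lemma agree_if_shift_dist_less:
  assumes \<eta>: "0 < \<eta>" "\<eta> < 1" and xy: "shift_dist \<eta> x y < \<eta> ^ n" and "i \<le> n"
  shows "x i = y i"
proof (rule ccontr)
  assume i: "x i \<noteq> y i"
  then have "x \<noteq> y" by auto
  moreover have "(LEAST i. x i \<noteq> y i) \<le> n" using Least_le[of "\<lambda>i. x i \<noteq> y i", OF i] assms(4) by simp
  ultimately have "\<eta> ^ n \<le> shift_dist \<eta> x y" using \<eta> by (simp add: shift_dist_def power_decreasing)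
  then show False using xy by simp
qed

text \<open>The cylinder of the first \<open>n\<close> coordinates of \<open>x\<close> contains the
  ball of radius \<open>\<eta> ^ n\<close> and lies in every larger ball, so prefix cylinders form a
  neighbourhood base.\<close>

lemma openin_shift_topology_iff:
  assumes \<eta>: "0 < \<eta>" "\<eta> < 1"
  shows "openin (shift_topology \<eta> A) U \<longleftrightarrow> U \<subseteq> shift_space A \<and>
    (\<forall>x\<in>U. \<exists>n. cylinder A (map x [0..<n]) \<subseteq> U)"
proof -
  interpret Metric_space "shift_space A" "shift_dist \<eta>" by (rule Metric_space_shift_dist[OF \<eta>])
  have cyl: "y \<in> cylinder A (map x [0..<n]) \<longleftrightarrow> y \<in> shift_space A \<and> (\<forall>i<n. x i = y i)" for x y n
    by (auto simp: cylinder_def)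
  show ?thesis unfolding shift_topology_def openin_mtopology
  proof (intro conj_cong refl iffI ballI allI impI)
    fix x assume U: "U \<subseteq> shift_space A" "\<forall>x. x \<in> U \<longrightarrow> (\<exists>r>0. mball x r \<subseteq> U)" and x: "x \<in> U"
    then obtain r where r: "r > 0" "mball x r \<subseteq> U" by blast
    obtain n where n: "\<eta> ^ n < r" using real_arch_pow_inv[OF r(1) \<eta>(2)] by blast
    have "cylinder A (map x [0..<n]) \<subseteq> mball x r"
    proof
      fix y assume y: "y \<in> cylinder A (map x [0..<n])"
      then have "shift_dist \<eta> x y \<le> \<eta> ^ n" by (intro shift_dist_le[OF \<eta>]) (simp add: cyl)
      then have "shift_dist \<eta> x y < r" using n by simp
      then show "y \<in> mball x r" using y x U(1) by (auto simp: cyl mball_def)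
    qed
    with r show "\<exists>n. cylinder A (map x [0..<n]) \<subseteq> U" by blast
  next
    fix x assume U: "U \<subseteq> shift_space A" "\<forall>x\<in>U. \<exists>n. cylinder A (map x [0..<n]) \<subseteq> U" and x: "x \<in> U"
    then obtain n where n: "cylinder A (map x [0..<n]) \<subseteq> U" by blast
    have "mball x (\<eta> ^ n) \<subseteq> cylinder A (map x [0..<n])"
      by (auto simp: cyl mball_def intro: agree_if_shift_dist_less[OF \<eta> _ less_imp_le])
    then show "\<exists>r>0. mball x r \<subseteq> U" using n \<eta> by (intro exI[of _ "\<eta> ^ n"]) auto
  qed
qed

text \<open>Every open set is a union of cylinders, and there are only countably many finite
  words.\<close>

lemma shift_borel_eq_sigma_cylinders:
  fixes A :: "'v::countable \<Rightarrow> 'v \<Rightarrow> bool"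
  assumes \<eta>: "0 < \<eta>" "\<eta> < 1"
  shows "shift_borel \<eta> A = sigma (shift_space A) (range (cylinder A))"
  unfolding shift_borel_def
proof (rule sigma_eqI)
  have cyl: "cylinder A w \<subseteq> shift_space A" for w by (auto simp: cylinder_def)
  show "{U. openin (shift_topology \<eta> A) U} \<subseteq> Pow (shift_space A)"
    by (auto simp: openin_shift_topology_iff[OF \<eta>])
  show "range (cylinder A) \<subseteq> Pow (shift_space A)" using cyl by auto
  have "openin (shift_topology \<eta> A) (cylinder A w)" for w
    unfolding openin_shift_topology_iff[OF \<eta>]
    by (auto simp: cylinder_def intro!: exI[of _ "length w"])
  then have 1: "range (cylinder A) \<subseteq> sigma_sets (shift_space A) {U. openin (shift_topology \<eta> A) U}"
    by (auto intro: sigma_sets.Basic)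
  have 2: "U \<in> sigma_sets (shift_space A) (range (cylinder A))" if U: "openin (shift_topology \<eta> A) U" for U
  proof -
    have "U = (\<Union>w\<in>{w. cylinder A w \<subseteq> U}. cylinder A w)"
    proof (intro equalityI subsetI)
      fix x assume x: "x \<in> U"
      then obtain n where n: "cylinder A (map x [0..<n]) \<subseteq> U" and "x \<in> shift_space A"
        using U[unfolded openin_shift_topology_iff[OF \<eta>]] by blast
      then have "x \<in> cylinder A (map x [0..<n])" by (simp add: cylinder_def)
      with n show "x \<in> (\<Union>w\<in>{w. cylinder A w \<subseteq> U}. cylinder A w)" by blast
    qed auto
    moreover have "(\<Union>w\<in>{w. cylinder A w \<subseteq> U}. cylinder A w) \<in> sigma_sets (shift_space A) (range (cylinder A))"
      by (rule sigma_sets_UNION) (auto intro: sigma_sets.Basic)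
    ultimately show ?thesis by simp
  qed
  show "sigma_sets (shift_space A) {U. openin (shift_topology \<eta> A) U} = sigma_sets (shift_space A) (range (cylinder A))"
    by (intro equalityI sigma_sets_mono 1) (use 2 in auto)
qed

section \<open>Inverse branches of the shift and measurability\<close>

definition cons_seq :: "'v \<Rightarrow> (nat \<Rightarrow> 'v) \<Rightarrow> nat \<Rightarrow> 'v" where
  "cons_seq v y = case_nat v y"

lemma cons_seq_simps [simp]: "cons_seq v y 0 = v" "cons_seq v y (Suc i) = y i" "shift (cons_seq v y) = y"
  by (auto simp: cons_seq_def shift_def)

lemma cons_seq_in_shift_space: "cons_seq v y \<in> shift_space A \<longleftrightarrow> A v (y 0) \<and> y \<in> shift_space A"
proof
  assume *: "cons_seq v y \<in> shift_space A"
  then have "\<And>n. A (cons_seq v y n) (cons_seq v y (Suc n))" by (simp add: shift_space_def)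
  from this[of 0] this[of "Suc _"] show "A v (y 0) \<and> y \<in> shift_space A"
    by (simp add: shift_space_def)
next
  assume *: "A v (y 0) \<and> y \<in> shift_space A"
  show "cons_seq v y \<in> shift_space A"
    unfolding shift_space_def
  proof (intro CollectI allI)
    fix n show "A (cons_seq v y n) (cons_seq v y (Suc n))"
      using * by (cases n) (auto simp: shift_space_def)
  qed
qed

lemma preimages_shift:
  assumes "y \<in> shift_space A"
  shows "{z \<in> shift_space A. shift z = y} = (\<lambda>v. cons_seq v y) ` {v. A v (y 0)}"
proof -
  have "z = cons_seq (z 0) (shift z)" for z :: "nat \<Rightarrow> 'a"
    by (auto simp: fun_eq_iff cons_seq_def shift_def split: nat.split)
  then show ?thesis using assms cons_seq_in_shift_space[of _ y A]
    by (auto simp: image_iff) (metis)+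
qed

lemma ruelle_eq_nn_integral:
  fixes A :: "'v::countable \<Rightarrow> 'v \<Rightarrow> bool"
  assumes "y \<in> shift_space A"
  shows "ruelle A \<phi> F y
    = (\<integral>\<^sup>+v. (if A v (y 0) then ennreal (exp (\<phi> (cons_seq v y))) * F (cons_seq v y) else 0) \<partial>count_space UNIV)"
proof -
  have "ruelle A \<phi> F y = infsum (\<lambda>v. ennreal (exp (\<phi> (cons_seq v y))) * F (cons_seq v y)) {v. A v (y 0)}"
    unfolding ruelle_def preimages_shift[OF assms]
    by (subst infsum_reindex) (auto intro!: inj_onI dest: fun_cong[of _ _ 0] simp: o_def)
  also have "\<dots> = (\<integral>\<^sup>+v. ennreal (exp (\<phi> (cons_seq v y))) * F (cons_seq v y) \<partial>count_space {v. A v (y 0)})"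
    by (rule infsum_ennreal_eq_nn_integral) simp
  also have "\<dots> = (\<integral>\<^sup>+v. (if A v (y 0) then ennreal (exp (\<phi> (cons_seq v y))) * F (cons_seq v y) else 0) \<partial>count_space UNIV)"
    by (subst nn_integral_count_space_indicator) (auto intro!: nn_integral_cong)
  finally show ?thesis .
qed

locale shift_measurable =
  fixes \<eta> :: real and A :: "'v::countable \<Rightarrow> 'v \<Rightarrow> bool"
  assumes \<eta>: "0 < \<eta>" "\<eta> < 1"
begin

abbreviation "\<Omega> \<equiv> shift_space A"
abbreviation "\<B> \<equiv> shift_borel \<eta> A"

lemma space_shift_borel [simp]: "space \<B> = \<Omega>"
  by (simp add: shift_borel_def space_measure_of_conv)

lemma cylinder_sets [measurable]: "cylinder A w \<in> sets \<B>"
proof -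
  have "range (cylinder A) \<subseteq> Pow \<Omega>" by (auto simp: cylinder_def)
  then show ?thesis unfolding shift_borel_eq_sigma_cylinders[OF \<eta>] by (auto simp: sets_measure_of)
qed

text \<open>Reduces measurability of the shift, its iterates and its inverse branches to discrete
  coordinates.\<close>

lemma measurable_shift_borel_iff:
  "f \<in> M \<rightarrow>\<^sub>M \<B> \<longleftrightarrow> f \<in> space M \<rightarrow> \<Omega> \<and> (\<forall>i. (\<lambda>x. f x i) \<in> M \<rightarrow>\<^sub>M count_space UNIV)"
proof (intro iffI conjI allI)
  have coord: "(\<lambda>y. y i) \<in> \<B> \<rightarrow>\<^sub>M count_space UNIV" for i
    unfolding measurable_count_space_eq2_countable
  proof (intro conjI ballI)
    fix v :: 'v
    have "(\<lambda>y. y i) -` {v} \<inter> space \<B> = (\<Union>w\<in>{w. length w = Suc i \<and> w ! i = v}. cylinder A w)"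
    proof (intro equalityI subsetI)
      fix y assume "y \<in> (\<lambda>y. y i) -` {v} \<inter> space \<B>"
      then have "y \<in> cylinder A (map y [0..<Suc i])" "map y [0..<Suc i] ! i = v"
        by (auto simp: cylinder_def simp del: upt_Suc)
      then show "y \<in> (\<Union>w\<in>{w. length w = Suc i \<and> w ! i = v}. cylinder A w)"
        by (intro UN_I[of "map y [0..<Suc i]"]) auto
    qed (auto simp: cylinder_def)
    also have "\<dots> \<in> sets \<B>" by (intro sets.countable_UN') (auto simp: cylinder_sets)
    finally show "(\<lambda>y. y i) -` {v} \<inter> space \<B> \<in> sets \<B>" .
  qed simp
  { assume f: "f \<in> M \<rightarrow>\<^sub>M \<B>"
    show "f \<in> space M \<rightarrow> \<Omega>" using measurable_space[OF f] by auto
    show "(\<lambda>x. f x i) \<in> M \<rightarrow>\<^sub>M count_space UNIV" for i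
      using measurable_compose[OF f coord] . }
  assume f: "f \<in> space M \<rightarrow> \<Omega> \<and> (\<forall>i. (\<lambda>x. f x i) \<in> M \<rightarrow>\<^sub>M count_space UNIV)"
  show "f \<in> M \<rightarrow>\<^sub>M \<B>"
    unfolding shift_borel_eq_sigma_cylinders[OF \<eta>]
  proof (rule measurable_measure_of)
    show "range (cylinder A) \<subseteq> Pow \<Omega>" by (auto simp: cylinder_def)
    show "f \<in> space M \<rightarrow> \<Omega>" using f by simp
    fix C assume "C \<in> range (cylinder A)"
    then obtain w where C: "C = cylinder A w" by auto
    have [measurable]: "(\<lambda>x. f x i) \<in> M \<rightarrow>\<^sub>M count_space UNIV" for i using f by simp
    have "f -` C \<inter> space M = {x \<in> space M. \<forall>i\<in>{..<length w}. f x i = w ! i}"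
      using f by (auto simp: C cylinder_def)
    also have "\<dots> \<in> sets M" by measurable
    finally show "f -` C \<inter> space M \<in> sets M" .
  qed
qed

lemma measurable_coordinate [measurable]: "(\<lambda>y. y i) \<in> \<B> \<rightarrow>\<^sub>M count_space UNIV"
  using measurable_shift_borel_iff[of "\<lambda>y. y" \<B>] by simp

lemma measurable_shift [measurable]: "shift \<in> \<B> \<rightarrow>\<^sub>M \<B>"
  unfolding measurable_shift_borel_iff by (auto simp: shift_space_shift) (simp add: shift_def)

lemma measurable_funpow_shift [measurable]: "(shift ^^ k) \<in> \<B> \<rightarrow>\<^sub>M \<B>"
  by (induction k) (auto intro: measurable_comp measurable_shift)

lemma measurable_cons_seq: "cons_seq v \<in> restrict_space \<B> {y. A v (y 0)} \<rightarrow>\<^sub>M \<B>"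
  unfolding measurable_shift_borel_iff
proof (intro conjI allI)
  show "cons_seq v \<in> space (restrict_space \<B> {y. A v (y 0)}) \<rightarrow> \<Omega>"
    by (auto simp: space_restrict_space cons_seq_in_shift_space)
  show "(\<lambda>x. cons_seq v x i) \<in> restrict_space \<B> {y. A v (y 0)} \<rightarrow>\<^sub>M count_space UNIV" for i
    by (cases i) (auto intro: measurable_restrict_space1)
qed

lemma measurable_ruelle:
  assumes [measurable]: "\<phi> \<in> borel_measurable \<B>" "F \<in> borel_measurable \<B>"
  shows "ruelle A \<phi> F \<in> borel_measurable \<B>"
proof -
  have *: "(\<lambda>y. if A v (y 0) then ennreal (exp (\<phi> (cons_seq v y))) * F (cons_seq v y) else 0) \<in> borel_measurable \<B>" for v
  proof (rule measurable_If_restrict_space_iff[THEN iffD2])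
    show "{y \<in> space \<B>. A v (y 0)} \<in> sets \<B>" by measurable
    have [measurable]: "(\<lambda>y. \<phi> (cons_seq v y)) \<in> borel_measurable (restrict_space \<B> {y. A v (y 0)})"
      "(\<lambda>y. F (cons_seq v y)) \<in> borel_measurable (restrict_space \<B> {y. A v (y 0)})"
      by (rule measurable_compose[OF measurable_cons_seq assms(1)] measurable_compose[OF measurable_cons_seq assms(2)])+
    show "(\<lambda>y. ennreal (exp (\<phi> (cons_seq v y))) * F (cons_seq v y)) \<in> borel_measurable (restrict_space \<B> {y. A v (y 0)}) \<and>
        (\<lambda>y. 0) \<in> borel_measurable (restrict_space \<B> {y. \<not> A v (y 0)})"
      by (intro conjI; measurable)
  qed
  have "(\<lambda>y. \<integral>\<^sup>+v. (if A v (y 0) then ennreal (exp (\<phi> (cons_seq v y))) * F (cons_seq v y) else 0) \<partial>count_space UNIV)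
      \<in> borel_measurable \<B>"
  proof (rule sigma_finite_measure.borel_measurable_nn_integral)
    show "sigma_finite_measure (count_space (UNIV::'v set))" by (rule sigma_finite_measure_count_space)
    show "(\<lambda>(y, v). if A v (y 0) then ennreal (exp (\<phi> (cons_seq v y))) * F (cons_seq v y) else 0)
        \<in> borel_measurable (\<B> \<Otimes>\<^sub>M count_space UNIV)"
      unfolding split_def
    \<comment> \<open>The letter ranges over a countable discrete space, so joint measurability
      follows from measurability in \<open>y\<close> for each fixed letter.\<close>
    proof (rule measurable_compose_countable'[where I = UNIV and g = snd
          and f = "\<lambda>v p. if A v (fst p 0) then ennreal (exp (\<phi> (cons_seq v (fst p)))) * F (cons_seq v (fst p)) else 0"])
      show "(\<lambda>p. if A v (fst p 0) then ennreal (exp (\<phi> (cons_seq v (fst p)))) * F (cons_seq v (fst p)) else 0)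
          \<in> borel_measurable (\<B> \<Otimes>\<^sub>M count_space UNIV)" for v
        by (rule measurable_compose[OF measurable_fst *])
    qed simp_all
  qed
  then show ?thesis by (rule measurable_cong[THEN iffD1, rotated]) (simp add: ruelle_eq_nn_integral)
qed

end

section \<open>The Ruelle operator and the invariant measure\<close>

locale rpf_measure = shift_measurable \<eta> A for \<eta> and A :: "'v::countable \<Rightarrow> 'v \<Rightarrow> bool" +
  fixes \<phi> :: "(nat \<Rightarrow> 'v) \<Rightarrow> real" and h :: "(nat \<Rightarrow> 'v) \<Rightarrow> real" and m :: "(nat \<Rightarrow> 'v) measure"
  assumes phi_measurable [measurable]: "\<phi> \<in> borel_measurable (shift_borel \<eta> A)"
    and walters: "walters_condition A \<phi>"
    and rpf: "rpf_pair \<eta> A \<phi> h m"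
begin

lemma sets_m [simp, measurable_cong]: "sets m = sets \<B>"
  using rpf by (simp add: rpf_pair_def)

lemma space_m [simp]: "space m = \<Omega>"
  using sets_eq_imp_space_eq[OF sets_m] by simp

lemma h_pos: "y \<in> \<Omega> \<Longrightarrow> 0 < h y"
  using rpf by (simp add: rpf_pair_def)

lemma h_measurable [measurable]: "h \<in> borel_measurable \<B>"
proof -
  have c: "continuous_map (shift_topology \<eta> A) euclideanreal h" using rpf by (simp add: rpf_pair_def)
  have top: "topspace (shift_topology \<eta> A) = \<Omega>"
    using Metric_space.topspace_mtopology[OF Metric_space_shift_dist[OF \<eta>]] by (simp add: shift_topology_def)
  show ?thesis
  proof (rule borel_measurableI)
    fix S :: "real set" assume "open S"
    then have "openin (shift_topology \<eta> A) {x \<in> \<Omega>. h x \<in> S}"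
      using openin_continuous_map_preimage[OF c, of S] by (simp add: top)
    moreover have "{U. openin (shift_topology \<eta> A) U} \<subseteq> Pow \<Omega>"
      by (auto simp: openin_shift_topology_iff[OF \<eta>])
    ultimately have "{x \<in> \<Omega>. h x \<in> S} \<in> sets \<B>"
      by (auto simp: shift_borel_def sets_measure_of intro: sigma_sets.Basic)
    then show "h -` S \<inter> space \<B> \<in> sets \<B>" by (simp add: vimage_def Int_def conj_commute)
  qed
qed

lemma finite_cylinder: "w \<noteq> [] \<Longrightarrow> emeasure m (cylinder A w) < \<infinity>"
  using rpf by (simp add: rpf_pair_def)

lemma conservative_m: "W \<in> sets \<B> \<Longrightarrow> disjoint_family (\<lambda>n. (shift ^^ n) -` W \<inter> \<Omega>) \<Longrightarrow> emeasure m W = 0"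
  using rpf by (simp add: rpf_pair_def conservative_def)

text \<open>Dividing by the eigenvalue makes \<open>h\<close> a fixed point of \<open>P\<close> and
  \<open>m\<close> a fixed point of its dual. Values in \<open>ennreal\<close> avoid all convergence
  questions.\<close>

definition P :: "((nat \<Rightarrow> 'v) \<Rightarrow> ennreal) \<Rightarrow> (nat \<Rightarrow> 'v) \<Rightarrow> ennreal" where
  "P F y = ennreal (1 / lam A \<phi>) * ruelle A \<phi> F y"

lemma lam_pos: "0 < lam A \<phi>"
  by (simp add: lam_def)

lemma P_measurable [measurable]: "F \<in> borel_measurable \<B> \<Longrightarrow> P F \<in> borel_measurable \<B>"
  unfolding P_def[abs_def] using measurable_ruelle by simp

lemma P_pow_measurable [measurable]: "F \<in> borel_measurable \<B> \<Longrightarrow> (P ^^ k) F \<in> borel_measurable \<B>"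
  by (induction k) auto

lemma P_h: "y \<in> \<Omega> \<Longrightarrow> P (\<lambda>x. ennreal (h x)) y = ennreal (h y)"
proof -
  assume y: "y \<in> \<Omega>"
  then have "ruelle A \<phi> (\<lambda>x. ennreal (h x)) y = ennreal (lam A \<phi> * h y)"
    using rpf by (simp add: rpf_pair_def)
  then show ?thesis using lam_pos h_pos[OF y] by (simp add: P_def ennreal_mult[symmetric])
qed

text \<open>Every preimage \<open>z\<close> of \<open>y\<close> has \<open>shift z = y\<close>, so
  the factor \<open>G y\<close> may be moved inside the sum over preimages; the dual equation then
  makes \<open>P\<close> the transfer operator of the shift with respect to
  \<open>m\<close>.\<close>

lemma P_duality:
  assumes [measurable]: "F \<in> borel_measurable \<B>" "G \<in> borel_measurable \<B>"
  shows "(\<integral>\<^sup>+y. P F y * G y \<partial>m) = (\<integral>\<^sup>+y. F y * G (shift y) \<partial>m)"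
proof -
  have "(\<integral>\<^sup>+y. P F y * G y \<partial>m) = (\<integral>\<^sup>+y. ennreal (1 / lam A \<phi>) * ruelle A \<phi> (\<lambda>x. F x * G (shift x)) y \<partial>m)"
  proof (rule nn_integral_cong)
    fix y assume "y \<in> space m"
    then have y: "y \<in> \<Omega>" by simp
    have "ruelle A \<phi> F y * G y = ruelle A \<phi> (\<lambda>x. F x * G (shift x)) y"
      unfolding ruelle_eq_nn_integral[OF y]
      by (subst nn_integral_multc[symmetric]) (auto intro!: nn_integral_cong simp: mult.assoc)
    then show "P F y * G y = ennreal (1 / lam A \<phi>) * ruelle A \<phi> (\<lambda>x. F x * G (shift x)) y"
      by (simp add: P_def mult.assoc)
  qed
  also have "\<dots> = ennreal (1 / lam A \<phi>) * (\<integral>\<^sup>+y. ruelle A \<phi> (\<lambda>x. F x * G (shift x)) y \<partial>m)"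
    by (rule nn_integral_cmult) (use measurable_ruelle[OF phi_measurable, of "\<lambda>x. F x * G (shift x)"] in measurable)
  also have "(\<integral>\<^sup>+y. ruelle A \<phi> (\<lambda>x. F x * G (shift x)) y \<partial>m) = ennreal (lam A \<phi>) * (\<integral>\<^sup>+x. F x * G (shift x) \<partial>m)"
    using rpf by (simp add: rpf_pair_def)
  also have "ennreal (1 / lam A \<phi>) * (ennreal (lam A \<phi>) * (\<integral>\<^sup>+x. F x * G (shift x) \<partial>m)) = (\<integral>\<^sup>+x. F x * G (shift x) \<partial>m)"
    using lam_pos by (simp add: mult.assoc[symmetric] ennreal_mult[symmetric])
  finally show ?thesis .
qed

lemma P_pow_duality:
  assumes [measurable]: "F \<in> borel_measurable \<B>" "G \<in> borel_measurable \<B>"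
  shows "(\<integral>\<^sup>+y. (P ^^ k) F y * G y \<partial>m) = (\<integral>\<^sup>+y. F y * G ((shift ^^ k) y) \<partial>m)"
  using assms(2)
proof (induction k arbitrary: G)
  case (Suc k)
  note [measurable] = Suc.prems
  have "(\<integral>\<^sup>+y. (P ^^ Suc k) F y * G y \<partial>m) = (\<integral>\<^sup>+y. (P ^^ k) F y * G (shift y) \<partial>m)"
    using P_duality[of "(P ^^ k) F" G] by simp
  also have "\<dots> = (\<integral>\<^sup>+y. F y * G (shift ((shift ^^ k) y)) \<partial>m)"
    by (rule Suc.IH) measurable
  finally show ?case by simp
qed simp

section \<open>Bounded distortion of the iterated operator\<close>

lemma walters_distortion:
  assumes "1 \<le> p" "y \<in> \<Omega>" "z \<in> \<Omega>" "\<forall>i<k + p. y i = z i"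
  shows "\<bar>birkhoff_sum \<phi> k y - birkhoff_sum \<phi> k z\<bar> \<le> enn2real (walters_W A \<phi> p)"
\<comment> \<open>The supremum in \<open>walters_W\<close> starts at \<open>n = 1\<close>; for
  \<open>k = 0\<close> both sums are empty.\<close>
proof (cases "k = 0")
  case False
  have fin: "walters_W A \<phi> p < \<infinity>" using walters assms(1) by (simp add: walters_condition_def)
  have "ennreal \<bar>birkhoff_sum \<phi> k y - birkhoff_sum \<phi> k z\<bar> \<le> variation A (k + p) (birkhoff_sum \<phi> k)"
    unfolding variation_def using assms by (intro Sup_upper) blast
  also have "\<dots> \<le> walters_W A \<phi> p"
    unfolding walters_W_def using False by (intro SUP_upper) simp
  finally have "enn2real (ennreal \<bar>birkhoff_sum \<phi> k y - birkhoff_sum \<phi> k z\<bar>) \<le> enn2real (walters_W A \<phi> p)"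
    using fin by (intro enn2real_mono) auto
  then show ?thesis by simp
qed (simp add: birkhoff_sum_def)

text \<open>Multiplicative form of Walters' bound: the factor between the weights of two branches
  that follow the same word and whose endpoints share \<open>p\<close> coordinates.\<close>

definition \<kappa> :: "nat \<Rightarrow> real" where
  "\<kappa> p = exp (enn2real (walters_W A \<phi> p))"

lemma kappa_ge_1: "1 \<le> \<kappa> p"
  by (simp add: \<kappa>_def)

lemma kappa_tendsto: "\<kappa> \<longlonglongrightarrow> 1"
proof -
  have "(\<lambda>p. enn2real (walters_W A \<phi> p)) \<longlonglongrightarrow> enn2real 0"
    using walters by (intro tendsto_enn2real) (auto simp: walters_condition_def)
  then have "(\<lambda>p. exp (enn2real (walters_W A \<phi> p))) \<longlonglongrightarrow> exp 0" by (intro tendsto_exp) simp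
  then show ?thesis by (simp add: \<kappa>_def[abs_def])
qed

lemma birkhoff_sum_Suc_left: "birkhoff_sum \<phi> (Suc k) z = \<phi> z + birkhoff_sum \<phi> k (shift z)"
  by (simp add: birkhoff_sum_def sum.lessThan_Suc_shift funpow_swap1 del: sum.lessThan_Suc)

text \<open>\<open>(P ^^ k) F y\<close> sums over the admissible words of length \<open>k\<close>
  leading to \<open>y\<close>. Since \<open>y 0 = y' 0\<close>, the same words lead to
  \<open>y'\<close>, and the hypothesis compares the terms word by word. The induction passes to
  \<open>P F\<close> and \<open>P G\<close>, so each step prepends one letter to both
  branches.\<close>

lemma P_pow_mono:
  fixes c :: ennreal
  assumes y: "y \<in> \<Omega>" "y' \<in> \<Omega>" "y 0 = y' 0"
    and le: "\<And>z z'. z \<in> \<Omega> \<Longrightarrow> z' \<in> \<Omega> \<Longrightarrow> \<forall>i<k. z i = z' i \<Longrightarrow> (shift ^^ k) z = y \<Longrightarrow> (shift ^^ k) z' = y'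
      \<Longrightarrow> ennreal (exp (birkhoff_sum \<phi> k z)) * F z \<le> c * (ennreal (exp (birkhoff_sum \<phi> k z')) * G z')"
  shows "(P ^^ k) F y \<le> c * (P ^^ k) G y'"
  using le
proof (induction k arbitrary: F G)
  case 0
  show ?case using 0[of y y'] y by (simp add: birkhoff_sum_def)
next
  case (Suc k)
  have "(P ^^ k) (P F) y \<le> c * (P ^^ k) (P G) y'"
  proof (rule Suc.IH)
    fix z z' assume z: "z \<in> \<Omega>" "z' \<in> \<Omega>" "\<forall>i<k. z i = z' i" "(shift ^^ k) z = y" "(shift ^^ k) z' = y'"
    have z0: "z 0 = z' 0"
    proof (cases k)
      case 0 then show ?thesis using z y by simp
    qed (use z in auto)
    have S: "ennreal (exp (birkhoff_sum \<phi> k x)) * P F x = (\<integral>\<^sup>+v. ennreal (1 / lam A \<phi>) *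
        (if A v (x 0) then ennreal (exp (birkhoff_sum \<phi> (Suc k) (cons_seq v x))) * F (cons_seq v x) else 0) \<partial>count_space UNIV)"
      if "x \<in> \<Omega>" for x F
    proof -
      have "ennreal (exp (birkhoff_sum \<phi> k x)) * P F x = ennreal (exp (birkhoff_sum \<phi> k x)) * (ennreal (1 / lam A \<phi>) *
          (\<integral>\<^sup>+v. (if A v (x 0) then ennreal (exp (\<phi> (cons_seq v x))) * F (cons_seq v x) else 0) \<partial>count_space UNIV))"
        by (simp add: P_def ruelle_eq_nn_integral[OF that])
      also have "\<dots> = (\<integral>\<^sup>+v. ennreal (exp (birkhoff_sum \<phi> k x)) * (ennreal (1 / lam A \<phi>) *
          (if A v (x 0) then ennreal (exp (\<phi> (cons_seq v x))) * F (cons_seq v x) else 0)) \<partial>count_space UNIV)"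
        by (simp add: nn_integral_cmult)
      also have "\<dots> = (\<integral>\<^sup>+v. ennreal (1 / lam A \<phi>) *
          (if A v (x 0) then ennreal (exp (birkhoff_sum \<phi> (Suc k) (cons_seq v x))) * F (cons_seq v x) else 0) \<partial>count_space UNIV)"
        by (intro nn_integral_cong) (simp add: birkhoff_sum_Suc_left exp_add ennreal_mult mult_ac)
      finally show ?thesis .
    qed
    have "ennreal (exp (birkhoff_sum \<phi> k z)) * P F z \<le> (\<integral>\<^sup>+v. c * (ennreal (1 / lam A \<phi>) *
        (if A v (z' 0) then ennreal (exp (birkhoff_sum \<phi> (Suc k) (cons_seq v z'))) * G (cons_seq v z') else 0)) \<partial>count_space UNIV)"
      unfolding S[OF z(1)]
    proof (rule nn_integral_mono)
      fix v
      show "ennreal (1 / lam A \<phi>) * (if A v (z 0) then ennreal (exp (birkhoff_sum \<phi> (Suc k) (cons_seq v z))) * F (cons_seq v z) else 0)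
          \<le> c * (ennreal (1 / lam A \<phi>) * (if A v (z' 0) then ennreal (exp (birkhoff_sum \<phi> (Suc k) (cons_seq v z'))) * G (cons_seq v z') else 0))"
      proof (cases "A v (z 0)")
        case True
        have "ennreal (exp (birkhoff_sum \<phi> (Suc k) (cons_seq v z))) * F (cons_seq v z)
            \<le> c * (ennreal (exp (birkhoff_sum \<phi> (Suc k) (cons_seq v z'))) * G (cons_seq v z'))"
        proof (rule Suc.prems)
          show "cons_seq v z \<in> \<Omega>" "cons_seq v z' \<in> \<Omega>" using True z z0 by (auto simp: cons_seq_in_shift_space)
          show "\<forall>i<Suc k. cons_seq v z i = cons_seq v z' i" using z(3) by (auto simp: less_Suc_eq_0_disj)
          show "(shift ^^ Suc k) (cons_seq v z) = y" "(shift ^^ Suc k) (cons_seq v z') = y'"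
            using z by (simp_all add: funpow_swap1)
        qed
        then have "ennreal (1 / lam A \<phi>) * (ennreal (exp (birkhoff_sum \<phi> (Suc k) (cons_seq v z))) * F (cons_seq v z))
            \<le> ennreal (1 / lam A \<phi>) * (c * (ennreal (exp (birkhoff_sum \<phi> (Suc k) (cons_seq v z'))) * G (cons_seq v z')))"
          by (rule mult_left_mono) simp
        then show ?thesis using True z0 by (simp add: mult.left_commute)
      qed simp
    qed
    also have "\<dots> = c * (ennreal (exp (birkhoff_sum \<phi> k z')) * P G z')"
      unfolding S[OF z(2)] by (simp add: nn_integral_cmult)
    finally show "ennreal (exp (birkhoff_sum \<phi> k z)) * P F z \<le> c * (ennreal (exp (birkhoff_sum \<phi> k z')) * P G z')" .
  qed
  then show ?case by (simp add: funpow_swap1)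
qed

text \<open>Branches with the same word ending in \<open>y\<close> and \<open>y'\<close> share
  \<open>k\<close> coordinates from the word and \<open>p\<close> more from the endpoints, so
  Walters' condition applies at depth \<open>p\<close> and \<open>F\<close> takes equal values on
  them.\<close>

lemma P_pow_distortion:
  assumes p: "1 \<le> p" and y: "y \<in> \<Omega>" "y' \<in> \<Omega>" "\<forall>i<p. y i = y' i"
    and F: "\<And>z z'. z \<in> \<Omega> \<Longrightarrow> z' \<in> \<Omega> \<Longrightarrow> \<forall>i<k + p. z i = z' i \<Longrightarrow> F z = F z'"
  shows "(P ^^ k) F y \<le> ennreal (\<kappa> p) * (P ^^ k) F y'"
proof (rule P_pow_mono[OF y(1,2)])
  show "y 0 = y' 0" using y(3) p by simp
  fix z z' assume z: "z \<in> \<Omega>" "z' \<in> \<Omega>" "\<forall>i<k. z i = z' i" "(shift ^^ k) z = y" "(shift ^^ k) z' = y'"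
  have zz: "\<forall>i<k + p. z i = z' i"
  proof (intro allI impI)
    fix i assume i: "i < k + p"
    show "z i = z' i"
    proof (cases "i < k")
      case False
      then have "z i = y (i - k)" "z' i = y' (i - k)" "i - k < p"
        using i z(4,5) by (auto simp: funpow_shift)
      then show ?thesis using y(3) by simp
    qed (use z in auto)
  qed
  have "birkhoff_sum \<phi> k z \<le> enn2real (walters_W A \<phi> p) + birkhoff_sum \<phi> k z'"
    using walters_distortion[OF p z(1,2) zz] by simp
  then have "exp (birkhoff_sum \<phi> k z) \<le> \<kappa> p * exp (birkhoff_sum \<phi> k z')"
    by (simp add: \<kappa>_def exp_add[symmetric])
  then have "ennreal (exp (birkhoff_sum \<phi> k z)) \<le> ennreal (\<kappa> p) * ennreal (exp (birkhoff_sum \<phi> k z'))"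
    using kappa_ge_1[of p] by (simp add: ennreal_mult[symmetric])
  then show "ennreal (exp (birkhoff_sum \<phi> k z)) * F z \<le> ennreal (\<kappa> p) * (ennreal (exp (birkhoff_sum \<phi> k z')) * F z')"
    unfolding F[OF z(1,2) zz] mult.assoc[symmetric] by (rule mult_right_mono) simp
qed

section \<open>The invariant measure and the iterates of its transfer operator\<close>

definition \<mu> :: "(nat \<Rightarrow> 'v) measure" where
  "\<mu> = density m (\<lambda>x. ennreal (h x))"

lemma sets_mu [simp, measurable_cong]: "sets \<mu> = sets \<B>"
  by (simp add: \<mu>_def)

lemma space_mu [simp]: "space \<mu> = \<Omega>"
  by (simp add: \<mu>_def)

lemma AE_mu_iff: "(AE x in \<mu>. Q x) \<longleftrightarrow> (AE x in m. Q x)"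
proof -
  have "(AE x in \<mu>. Q x) \<longleftrightarrow> (AE x in m. 0 < ennreal (h x) \<longrightarrow> Q x)"
    unfolding \<mu>_def by (rule AE_density) simp
  also have "\<dots> \<longleftrightarrow> (AE x in m. Q x)"
    using h_pos by (intro AE_cong) (simp add: ennreal_less_zero_iff)
  finally show ?thesis .
qed

lemma emeasure_mu: "S \<in> sets \<B> \<Longrightarrow> emeasure \<mu> S = (\<integral>\<^sup>+y. ennreal (h y) * indicator S y \<partial>m)"
  unfolding \<mu>_def by (rule emeasure_density) auto

lemma emeasure_mu_eq_0_iff: "S \<in> sets \<B> \<Longrightarrow> emeasure \<mu> S = 0 \<longleftrightarrow> emeasure m S = 0"
  using AE_mu_iff[of "\<lambda>x. x \<notin> S"] AE_iff_null_sets[of S \<mu>] AE_iff_null_sets[of S m] by auto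

lemma P_cong: "(\<And>z. z \<in> \<Omega> \<Longrightarrow> F z = G z) \<Longrightarrow> P F y = P G y"
  unfolding P_def ruelle_def by (intro arg_cong2[where f = "(*)"] infsum_cong) auto

lemma P_pow_h: "y \<in> \<Omega> \<Longrightarrow> (P ^^ k) (\<lambda>x. ennreal (h x)) y = ennreal (h y)"
proof (induction k arbitrary: y)
  case (Suc k)
  have "P ((P ^^ k) (\<lambda>x. ennreal (h x))) y = P (\<lambda>x. ennreal (h x)) y"
    by (rule P_cong) (rule Suc.IH)
  then show ?case using P_h[OF Suc.prems] by simp
qed simp

text \<open>Invariance comes from the fixed point: moving \<open>shift ^^ k\<close> onto the density
  \<open>h\<close> by duality reproduces \<open>h\<close>.\<close>

lemma nn_integral_mu_shift:
  assumes [measurable]: "G \<in> borel_measurable \<B>"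
  shows "(\<integral>\<^sup>+y. G ((shift ^^ k) y) \<partial>\<mu>) = (\<integral>\<^sup>+y. G y \<partial>\<mu>)"
proof -
  have "(\<integral>\<^sup>+y. G ((shift ^^ k) y) \<partial>\<mu>) = (\<integral>\<^sup>+y. ennreal (h y) * G ((shift ^^ k) y) \<partial>m)"
    unfolding \<mu>_def by (rule nn_integral_density) measurable
  also have "\<dots> = (\<integral>\<^sup>+y. (P ^^ k) (\<lambda>x. ennreal (h x)) y * G y \<partial>m)"
    by (rule P_pow_duality[symmetric]) measurable
  also have "\<dots> = (\<integral>\<^sup>+y. ennreal (h y) * G y \<partial>m)"
    by (rule nn_integral_cong) (simp add: P_pow_h)
  also have "\<dots> = (\<integral>\<^sup>+y. G y \<partial>\<mu>)"
    unfolding \<mu>_def by (rule nn_integral_density[symmetric]) measurable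
  finally show ?thesis .
qed

lemma sets_vimage_shift [measurable]: "S \<in> sets \<B> \<Longrightarrow> (shift ^^ k) -` S \<inter> \<Omega> \<in> sets \<B>"
  using measurable_sets[OF measurable_funpow_shift, of S k] by simp

lemma emeasure_mu_vimage_shift:
  assumes [measurable]: "S \<in> sets \<B>"
  shows "emeasure \<mu> ((shift ^^ k) -` S \<inter> \<Omega>) = emeasure \<mu> S"
proof -
  have "emeasure \<mu> ((shift ^^ k) -` S \<inter> \<Omega>) = (\<integral>\<^sup>+y. indicator S ((shift ^^ k) y) \<partial>\<mu>)"
  proof -
    have "(\<integral>\<^sup>+y. indicator S ((shift ^^ k) y) \<partial>\<mu>) = (\<integral>\<^sup>+y. indicator ((shift ^^ k) -` S \<inter> \<Omega>) y \<partial>\<mu>)"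
      by (intro nn_integral_cong) (auto split: split_indicator)
    then show ?thesis by simp
  qed
  also have "\<dots> = (\<integral>\<^sup>+y. indicator S y \<partial>\<mu>)" by (rule nn_integral_mu_shift) measurable
  finally show ?thesis by simp
qed

text \<open>By duality this is the density with respect to \<open>m\<close> of the image under
  \<open>shift ^^ k\<close> of \<open>m\<close> restricted to \<open>Y\<close>. It may be infinite
  at single points, hence the finiteness statement that holds only almost everywhere.\<close>

definition u :: "(nat \<Rightarrow> 'v) set \<Rightarrow> nat \<Rightarrow> (nat \<Rightarrow> 'v) \<Rightarrow> ennreal" where
  "u Y k = (P ^^ k) (indicator Y)"

lemma u_measurable [measurable]: "Y \<in> sets \<B> \<Longrightarrow> u Y k \<in> borel_measurable \<B>"
  unfolding u_def by (intro P_pow_measurable borel_measurable_indicator)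

lemma nn_integral_u:
  assumes [measurable]: "Y \<in> sets \<B>" "G \<in> borel_measurable \<B>"
  shows "(\<integral>\<^sup>+y. u Y k y * G y \<partial>m) = (\<integral>\<^sup>+y. indicator Y y * G ((shift ^^ k) y) \<partial>m)"
  unfolding u_def by (rule P_pow_duality) measurable

lemma nn_integral_u_1: "Y \<in> sets \<B> \<Longrightarrow> (\<integral>\<^sup>+y. u Y k y \<partial>m) = emeasure m Y"
  using nn_integral_u[of Y "\<lambda>_. 1" k] by simp

lemma AE_u_finite:
  assumes Y [measurable]: "Y \<in> sets \<B>" and fin: "emeasure m Y < \<infinity>"
  shows "AE y in m. \<forall>k. u Y k y < \<infinity>"
proof -
  have "AE y in m. u Y k y \<noteq> \<infinity>" for k
    by (rule nn_integral_PInf_AE) (use fin nn_integral_u_1[OF Y, of k] in auto)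
  then have "AE y in m. \<forall>k. u Y k y \<noteq> \<infinity>" unfolding AE_all_countable ..
  then show ?thesis by (simp only: infinity_ennreal_def less_top)
qed

text \<open>A version of the \<open>k\<close>-th transfer operator iterate of \<open>indicator Y / h\<close>. Dividing by \<open>h\<close> makes
  the eigenfunction cancel, so that no regularity of \<open>h\<close> is needed to compare values of \<open>u Y k\<close>.\<close>

definition v :: "(nat \<Rightarrow> 'v) set \<Rightarrow> nat \<Rightarrow> (nat \<Rightarrow> 'v) \<Rightarrow> real" where
  "v Y k y = enn2real (u Y k y) / h y"

lemma v_measurable [measurable]:
  assumes [measurable]: "Y \<in> sets \<B>"
  shows "v Y k \<in> borel_measurable \<B>"
  unfolding v_def[abs_def] by measurable

text \<open>On the shift space \<open>v Y 0\<close> is \<open>indicator Y / h\<close>, so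
  integrating it against \<mu> cancels \<open>h\<close> and leaves the mass of \<open>Y\<close>
  under \<open>m\<close>, which every application of \<open>P\<close> preserves.\<close>

lemma v_integrable:
  assumes Y: "Y \<in> sets \<B>" "emeasure m Y < \<infinity>"
  shows "integrable \<mu> (v Y k)" "(\<integral>y. v Y k y \<partial>\<mu>) = measure m Y"
proof -
  note [measurable] = Y(1)
  have nn: "AE y in \<mu>. 0 \<le> v Y k y" unfolding AE_mu_iff by (rule AE_I2) (simp add: v_def h_pos less_imp_le)
  have "(\<integral>\<^sup>+y. ennreal (v Y k y) \<partial>\<mu>) = (\<integral>\<^sup>+y. ennreal (h y) * ennreal (v Y k y) \<partial>m)"
    unfolding \<mu>_def by (rule nn_integral_density) measurable
  also have "\<dots> = (\<integral>\<^sup>+y. u Y k y \<partial>m)"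
  proof (rule nn_integral_cong_AE)
    show "AE y in m. ennreal (h y) * ennreal (v Y k y) = u Y k y"
      using AE_u_finite[OF Y] AE_space
    proof eventually_elim
      case (elim y)
      then have "0 < h y" using h_pos by simp
      then have "ennreal (h y) * ennreal (v Y k y) = ennreal (enn2real (u Y k y))"
        by (simp add: v_def ennreal_mult'[symmetric])
      then show ?case using elim by (simp add: top.not_eq_extremum)
    qed
  qed
  also have "\<dots> = emeasure m Y" by (rule nn_integral_u_1[OF Y(1)])
  finally have *: "(\<integral>\<^sup>+y. ennreal (v Y k y) \<partial>\<mu>) = emeasure m Y" .
  show "integrable \<mu> (v Y k)" using nn Y by (intro integrableI_nonneg) (auto simp: *)
  show "(\<integral>y. v Y k y \<partial>\<mu>) = measure m Y"
    using nn by (subst integral_eq_nn_integral) (auto simp: * measure_def)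
qed

text \<open>Both sides integrate \<open>g\<close> against the image of \<open>m\<close> restricted
  to \<open>Y\<close> under \<open>k + 1\<close> shifts. Being an equality of measures, this covers
  every measurable \<open>g\<close>, including those whose integral takes the default value.\<close>

lemma v_duality:
  assumes Y: "Y \<in> sets \<B>" "emeasure m Y < \<infinity>" and g [measurable]: "g \<in> borel_measurable \<B>"
  shows "(\<integral>y. v Y k y * g (shift y) \<partial>\<mu>) = (\<integral>y. v Y (Suc k) y * g y \<partial>\<mu>)"
proof -
  note [measurable] = Y(1)
  define M where "M k = density m (u Y k)" for k
  have M: "(\<integral>y. f y \<partial>M k) = (\<integral>y. v Y k y * f y \<partial>\<mu>)" if [measurable]: "f \<in> borel_measurable \<B>" for f :: "_ \<Rightarrow> real" and k
  proof -
    have "M k = density m (\<lambda>y. ennreal (enn2real (u Y k y)))"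
      unfolding M_def using AE_u_finite[OF Y]
      by (intro density_cong) (auto elim!: eventually_mono simp: top.not_eq_extremum)
    then have "(\<integral>y. f y \<partial>M k) = (\<integral>y. enn2real (u Y k y) * f y \<partial>m)"
      by (simp add: integral_real_density)
    also have "\<dots> = (\<integral>y. h y * (v Y k y * f y) \<partial>m)"
      using h_pos by (intro Bochner_Integration.integral_cong) (auto simp: v_def less_imp_neq[symmetric])
    also have "\<dots> = (\<integral>y. v Y k y * f y \<partial>\<mu>)"
      unfolding \<mu>_def using h_pos by (intro integral_real_density[symmetric] AE_I2) (auto intro: less_imp_le)
    finally show ?thesis .
  qed
  have "distr (M k) \<B> shift = M (Suc k)"
  proof (rule measure_eqI)
    fix S assume "S \<in> sets (distr (M k) \<B> shift)"
    then have [measurable]: "S \<in> sets \<B>" by simp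
    have "emeasure (distr (M k) \<B> shift) S = emeasure (M k) (shift -` S \<inter> \<Omega>)"
      by (subst emeasure_distr) (auto simp: M_def)
    also have "\<dots> = (\<integral>\<^sup>+y. u Y k y * indicator S (shift y) \<partial>m)"
      unfolding M_def using measurable_sets[OF measurable_shift, of S]
      by (subst emeasure_density) (auto intro!: nn_integral_cong split: split_indicator)
    also have "\<dots> = (\<integral>\<^sup>+y. u Y (Suc k) y * indicator S y \<partial>m)"
      using P_duality[of "u Y k" "indicator S"] by (simp add: u_def)
    also have "\<dots> = emeasure (M (Suc k)) S" unfolding M_def by (rule emeasure_density[symmetric]) auto
    finally show "emeasure (distr (M k) \<B> shift) S = emeasure (M (Suc k)) S" .
  qed (simp add: M_def)
  moreover have "(\<integral>y. g y \<partial>distr (M k) \<B> shift) = (\<integral>y. g (shift y) \<partial>M k)"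
    by (rule integral_distr) (auto simp: M_def)
  ultimately show ?thesis using M[of g "Suc k"] M[of "\<lambda>y. g (shift y)" k] by simp
qed

text \<open>\<open>transfer_operator\<close> chooses among functions determined almost everywhere,
  so the chosen one has to be identified: testing with the bounded sign of its difference from
  \<open>v Y (Suc k)\<close> shows that the absolute difference has integral 0. The hypothesis on
  \<open>F\<close> is an almost everywhere equality, since this is all that a previous choice
  provides.\<close>

lemma transfer_operator_v:
  assumes Y: "Y \<in> sets \<B>" "emeasure m Y < \<infinity>" and F: "integrable \<mu> F" "AE y in \<mu>. F y = v Y k y"
  shows "integrable \<mu> (transfer_operator \<mu> shift F) \<and> (AE y in \<mu>. transfer_operator \<mu> shift F y = v Y (Suc k) y)"
proof -
  note [measurable] = Y(1)
  let ?Q = "\<lambda>H. integrable \<mu> H \<and> (\<forall>g\<in>borel_measurable \<mu>. (\<exists>C. \<forall>x\<in>space \<mu>. \<bar>g x\<bar> \<le> C) \<longrightarrow>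
        (\<integral>x. F x * g (shift x) \<partial>\<mu>) = (\<integral>x. H x * g x \<partial>\<mu>))"
  have Fv: "(\<integral>x. F x * g (shift x) \<partial>\<mu>) = (\<integral>x. v Y (Suc k) x * g x \<partial>\<mu>)" if "g \<in> borel_measurable \<mu>" for g
  proof -
    have [measurable]: "g \<in> borel_measurable \<B>" using that by simp
    have "(\<integral>x. F x * g (shift x) \<partial>\<mu>) = (\<integral>x. v Y k x * g (shift x) \<partial>\<mu>)"
      using F by (intro integral_cong_AE) (auto elim!: eventually_mono)
    also have "\<dots> = (\<integral>x. v Y (Suc k) x * g x \<partial>\<mu>)" by (rule v_duality[OF Y]) measurable
    finally show ?thesis .
  qed
  have "?Q (v Y (Suc k))" using v_integrable[OF Y] Fv by blast
  then have Q: "?Q (transfer_operator \<mu> shift F)" unfolding transfer_operator_def by (rule someI[of ?Q])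
  define H where "H = transfer_operator \<mu> shift F"
  define D where "D y = H y - v Y (Suc k) y" for y
  have H: "integrable \<mu> H" using Q by (simp add: H_def)
  have D: "integrable \<mu> D" unfolding D_def[abs_def] using H v_integrable[OF Y] by simp
  have sg: "(\<lambda>y. sgn (D y)) \<in> borel_measurable \<mu>" using borel_measurable_integrable[OF D] by measurable
  have "\<exists>C. \<forall>x\<in>space \<mu>. \<bar>sgn (D x)\<bar> \<le> C" by (rule exI[of _ 1]) (simp add: sgn_real_def)
  then have "(\<integral>x. H x * sgn (D x) \<partial>\<mu>) = (\<integral>x. v Y (Suc k) x * sgn (D x) \<partial>\<mu>)"
    using Q[folded H_def, THEN conjunct2, rule_format, OF sg] Fv[OF sg] by simp
  moreover have "integrable \<mu> (\<lambda>x. f x * sgn (D x))" if f: "integrable \<mu> f" for f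
    by (rule Bochner_Integration.integrable_bound[OF f]) (use sg borel_measurable_integrable[OF f] in \<open>auto simp: sgn_real_def\<close>)
  ultimately have "(\<integral>x. H x * sgn (D x) - v Y (Suc k) x * sgn (D x) \<partial>\<mu>) = 0"
    using H v_integrable[OF Y] by (subst Bochner_Integration.integral_diff) auto
  moreover have "H x * sgn (D x) - v Y (Suc k) x * sgn (D x) = \<bar>D x\<bar>" for x
    unfolding D_def left_diff_distrib[symmetric] by (simp add: abs_sgn)
  ultimately have "(\<integral>x. \<bar>D x\<bar> \<partial>\<mu>) = 0" by simp
  then have "AE x in \<mu>. \<bar>D x\<bar> = 0"
    using D by (subst (asm) integral_nonneg_eq_0_iff_AE) auto
  then have "AE y in \<mu>. H y = v Y (Suc k) y" by eventually_elim (simp add: D_def)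
  then show ?thesis using H by (simp add: H_def)
qed

lemma transfer_operator_iterates:
  assumes Y: "Y \<in> sets \<B>" "emeasure m Y < \<infinity>"
  shows "integrable \<mu> ((transfer_operator \<mu> shift ^^ k) (v Y 0))
    \<and> (AE y in \<mu>. (transfer_operator \<mu> shift ^^ k) (v Y 0) y = v Y k y)"
proof (induction k)
  case 0
  show ?case using v_integrable[OF Y] by simp
next
  case (Suc k)
  then show ?case using transfer_operator_v[OF Y, of "(transfer_operator \<mu> shift ^^ k) (v Y 0)" k] by simp
qed

lemma AE_average_v:
  assumes Y: "Y \<in> sets \<B>" "emeasure m Y < \<infinity>" and a: "normalizing_sequence \<mu> shift a"
  shows "AE y in m. (\<lambda>n. (\<Sum>k<n. v Y k y) / a n) \<longlonglongrightarrow> measure m Y"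
proof -
  have "AE y in \<mu>. \<forall>k. (transfer_operator \<mu> shift ^^ k) (v Y 0) y = v Y k y"
    unfolding AE_all_countable using transfer_operator_iterates[OF Y] by blast
  moreover have "AE y in \<mu>. (\<lambda>n. (1 / a n) * (\<Sum>k<n. (transfer_operator \<mu> shift ^^ k) (v Y 0) y)) \<longlonglongrightarrow> (\<integral>y. v Y 0 y \<partial>\<mu>)"
    using a v_integrable[OF Y] unfolding normalizing_sequence_def by blast
  ultimately have "AE y in \<mu>. (\<lambda>n. (\<Sum>k<n. v Y k y) / a n) \<longlonglongrightarrow> measure m Y"
    by eventually_elim (simp add: v_integrable(2)[OF Y])
  then show ?thesis by (simp add: AE_mu_iff)
qed

text \<open>Points of \<open>Y\<close> that never come back form a wandering set, null by
  conservativity. A point with finitely many visits is mapped into it at its last visit, and the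
  preimages are null because \<mu> is invariant and has the same null sets as
  \<open>m\<close>.\<close>

lemma AE_recurrent:
  assumes Y [measurable]: "Y \<in> sets \<B>"
  shows "AE y in m. y \<in> Y \<longrightarrow> (\<forall>k. \<exists>i\<ge>k. (shift ^^ i) y \<in> Y)"
proof -
  define W where "W = {y \<in> \<Omega>. y \<in> Y \<and> (\<forall>i\<ge>1. (shift ^^ i) y \<notin> Y)}"
  have W [measurable]: "W \<in> sets \<B>"
  proof -
    have "W = {y \<in> space \<B>. y \<in> Y \<and> (\<forall>i\<ge>1. (shift ^^ i) y \<notin> Y)}" by (simp add: W_def)
    also have "\<dots> \<in> sets \<B>" by measurable
    finally show ?thesis .
  qed
  have "disjoint_family (\<lambda>n. (shift ^^ n) -` W \<inter> \<Omega>)"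
    unfolding disjoint_family_on_def
  proof (intro ballI impI)
    have *: False if "(shift ^^ n) y \<in> W" "(shift ^^ n') y \<in> W" "n < n'" for n n' y
    proof -
      have "(shift ^^ (n' - n)) ((shift ^^ n) y) \<notin> Y" using that by (auto simp: W_def)
      moreover have "(shift ^^ (n' - n)) ((shift ^^ n) y) = (shift ^^ n') y"
        using that by (simp flip: funpow_add[THEN fun_cong, simplified])
      ultimately show False using that by (simp add: W_def)
    qed
    fix n n' :: nat assume "n \<noteq> n'"
    then show "((shift ^^ n) -` W \<inter> \<Omega>) \<inter> ((shift ^^ n') -` W \<inter> \<Omega>) = {}"
      using *[of n _ n'] *[of n' _ n] by (cases n n' rule: linorder_cases) auto
  qed
  then have "emeasure m W = 0" by (intro conservative_m W)
  then have "emeasure \<mu> ((shift ^^ j) -` W \<inter> \<Omega>) = 0" for j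
    using emeasure_mu_vimage_shift[OF W] emeasure_mu_eq_0_iff[OF W] by simp
  then have "emeasure m ((shift ^^ j) -` W \<inter> \<Omega>) = 0" for j
    by (subst emeasure_mu_eq_0_iff[symmetric]) measurable
  then have "AE y in m. y \<notin> (shift ^^ j) -` W \<inter> \<Omega>" for j
    by (intro AE_not_in) (auto simp: null_sets_def)
  then have "AE y in m. \<forall>j. y \<notin> (shift ^^ j) -` W \<inter> \<Omega>" unfolding AE_all_countable ..
  then show ?thesis using AE_space
  proof eventually_elim
    case (elim y)
    show ?case
    proof (intro impI allI, rule ccontr)
      fix k assume y: "y \<in> Y" and "\<not> (\<exists>i\<ge>k. (shift ^^ i) y \<in> Y)"
      then have k: "\<And>i. (shift ^^ i) y \<in> Y \<Longrightarrow> i < k" by (meson not_le)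
      define j where "j = Max {i. (shift ^^ i) y \<in> Y}"
      have fin: "finite {i. (shift ^^ i) y \<in> Y}" by (rule finite_subset[of _ "{..<k}"]) (auto simp: k)
      have ne: "0 \<in> {i. (shift ^^ i) y \<in> Y}" using y by simp
      have j: "(shift ^^ j) y \<in> Y" using Max_in[OF fin] ne unfolding j_def by blast
      have "(shift ^^ i) ((shift ^^ j) y) \<notin> Y" if "1 \<le> i" for i
      proof
        assume "(shift ^^ i) ((shift ^^ j) y) \<in> Y"
        then have "(shift ^^ (i + j)) y \<in> Y" by (simp add: funpow_add)
        then have "i + j \<le> j" unfolding j_def using fin by (intro Max_ge) auto
        then show False using that by simp
      qed
      then have "(shift ^^ j) y \<in> W" using j elim shift_space_funpow[of y A j] by (simp add: W_def)
      then show False using elim by simp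
    qed
  qed
qed

text \<open>A substitute for ergodicity. By recurrence almost no point of \<open>Y\<close> ever
  enters the set \<open>E\<close> of points that miss \<open>Y\<close>, so \<open>v Y k\<close>
  vanishes almost everywhere on \<open>E\<close> for all \<open>k\<close>; but its averages converge
  almost everywhere to \<open>measure m Y > 0\<close>.\<close>

lemma AE_hits:
  assumes Y: "Y \<in> sets \<B>" "emeasure m Y < \<infinity>" "0 < measure m Y" and a: "normalizing_sequence \<mu> shift a"
  shows "AE y in m. \<exists>i. (shift ^^ i) y \<in> Y"
proof -
  note [measurable] = Y(1)
  define E where "E = {y \<in> \<Omega>. \<forall>i. (shift ^^ i) y \<notin> Y}"
  have [measurable]: "E \<in> sets \<B>"
  proof -
    have "E = {y \<in> space \<B>. \<forall>i. (shift ^^ i) y \<notin> Y}" by (simp add: E_def)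
    also have "\<dots> \<in> sets \<B>" by measurable
    finally show ?thesis .
  qed
  have "AE y in m. u Y k y * indicator E y = 0" for k
  proof -
    have "(\<integral>\<^sup>+y. u Y k y * indicator E y \<partial>m) = (\<integral>\<^sup>+y. indicator Y y * indicator E ((shift ^^ k) y) \<partial>m)"
      by (rule nn_integral_u) measurable
    also have "\<dots> = (\<integral>\<^sup>+y. 0 \<partial>m)"
    proof (rule nn_integral_cong_AE)
      show "AE y in m. indicator Y y * indicator E ((shift ^^ k) y) = (0::ennreal)"
        using AE_recurrent[OF Y(1)]
      proof eventually_elim
        case (elim y)
        have "(shift ^^ k) y \<notin> E" if "y \<in> Y"
        proof -
          obtain i where i: "i \<ge> k" "(shift ^^ i) y \<in> Y" using elim \<open>y \<in> Y\<close> by blast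
          then have "(shift ^^ (i - k)) ((shift ^^ k) y) \<in> Y"
            by (simp flip: funpow_add[THEN fun_cong, simplified])
          then show ?thesis by (auto simp: E_def)
        qed
        then show ?case by (auto split: split_indicator)
      qed
    qed
    finally have "(\<integral>\<^sup>+y. u Y k y * indicator E y \<partial>m) = 0" by simp
    then show ?thesis by (subst (asm) nn_integral_0_iff_AE) auto
  qed
  then have "AE y in m. \<forall>k. u Y k y * indicator E y = 0" unfolding AE_all_countable ..
  then show ?thesis using AE_average_v[OF Y(1,2) a] AE_space
  proof eventually_elim
    case (elim y)
    have "y \<notin> E"
    proof
      assume "y \<in> E"
      then have "v Y k y = 0" for k using elim(1)[rule_format, of k] by (simp add: v_def)
      then have "(\<lambda>n. 0) \<longlonglongrightarrow> measure m Y" using elim(2) by simp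
      then show False using Y(3) LIMSEQ_unique[OF tendsto_const] by fastforce
    qed
    then show ?case using elim by (auto simp: E_def)
  qed
qed

end

section \<open>Return times to cylinders\<close>

lemma summable_bounded_exp:
  fixes q :: "nat \<Rightarrow> real"
  assumes q: "\<And>l. \<bar>q l\<bar> \<le> K" and \<sigma>: "0 < \<sigma>"
  shows "summable (\<lambda>l. norm (q l * exp (- (\<sigma> * real l))))"
proof (rule summable_comparison_test')
  show "summable (\<lambda>l. K * exp (- \<sigma>) ^ l)" using \<sigma> by (intro summable_mult summable_geometric) simp
  fix l :: nat
  have "exp (- (\<sigma> * real l)) = exp (- \<sigma>) ^ l" by (simp add: exp_of_nat_mult[symmetric] mult.commute)
  then show "norm (norm (q l * exp (- (\<sigma> * real l)))) \<le> K * exp (- \<sigma>) ^ l"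
    using q[of l] by (simp add: abs_mult mult_right_mono)
qed

text \<open>The convolution of \<open>u\<close> and \<open>q\<close> takes values in
  \<open>{lo..hi}\<close>, so its generating function, the Cauchy product of the two series, is
  comparable with the geometric series \<open>1 / (1 - exp (- \<sigma>))\<close>.\<close>

lemma renewal_generating_functions:
  fixes q u :: "nat \<Rightarrow> real"
  assumes q: "\<And>l. \<bar>q l\<bar> \<le> K" and \<sigma>: "0 < \<sigma>"
    and u: "summable (\<lambda>k. u k * exp (- (\<sigma> * real k)))" "\<And>k. 0 \<le> u k"
    and ren: "\<And>n. lo \<le> (\<Sum>k\<le>n. u k * q (n - k))" "\<And>n. (\<Sum>k\<le>n. u k * q (n - k)) \<le> hi"
  shows "lo \<le> (1 - exp (- \<sigma>)) * (\<Sum>l. q l * exp (- (\<sigma> * real l))) * (\<Sum>k. u k * exp (- (\<sigma> * real k)))"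
    and "(1 - exp (- \<sigma>)) * (\<Sum>l. q l * exp (- (\<sigma> * real l))) * (\<Sum>k. u k * exp (- (\<sigma> * real k))) \<le> hi"
proof -
  define f where "f n = (\<Sum>k\<le>n. u k * q (n - k))" for n
  define g where "g n = exp (- (\<sigma> * real n))" for n :: nat
  have g: "g n = exp (- \<sigma>) ^ n" for n by (simp add: g_def exp_of_nat_mult[symmetric] mult.commute)
  have sg: "g sums (1 / (1 - exp (- \<sigma>)))" unfolding g[abs_def] using \<sigma> by (intro geometric_sums) simp
  have su: "summable (\<lambda>k. norm (u k * g k))" using u by (simp add: g_def abs_mult)
  have sq: "summable (\<lambda>l. norm (q l * g l))" using summable_bounded_exp[OF q \<sigma>] by (simp add: g_def)
  have eq: "(\<Sum>i\<le>n. u i * g i * (q (n - i) * g (n - i))) = f n * g n" for n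
  proof -
    have "u i * g i * (q (n - i) * g (n - i)) = u i * q (n - i) * g n" if "i \<in> {..n}" for i
    proof -
      have "g i * g (n - i) = g n" using that by (simp add: g power_add[symmetric])
      then show ?thesis by (metis mult.assoc mult.commute)
    qed
    then have "(\<Sum>i\<le>n. u i * g i * (q (n - i) * g (n - i))) = (\<Sum>i\<le>n. u i * q (n - i) * g n)"
      by (rule sum.cong[OF refl])
    then show ?thesis by (simp only: f_def sum_distrib_right)
  qed
  have prod: "(\<Sum>k. u k * g k) * (\<Sum>l. q l * g l) = (\<Sum>n. f n * g n)"
    using Cauchy_product[OF su sq] by (simp add: eq)
  have sf: "summable (\<lambda>n. f n * g n)" using summable_Cauchy_product[OF su sq] by (simp add: eq)
  have g0: "0 \<le> g n" for n by (simp add: g_def)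
  have "lo * (1 / (1 - exp (- \<sigma>))) \<le> (\<Sum>n. f n * g n)"
    using sums_mult[OF sg, of lo] ren(1) g0
    by (intro sums_le[OF _ _ summable_sums[OF sf]]) (auto simp: f_def intro: mult_right_mono)
  moreover have "(\<Sum>n. f n * g n) \<le> hi * (1 / (1 - exp (- \<sigma>)))"
    using sums_mult[OF sg, of hi] ren(2) g0
    by (intro sums_le[OF _ summable_sums[OF sf]]) (auto simp: f_def intro: mult_right_mono)
  moreover have "0 < 1 - exp (- \<sigma>)" using \<sigma> by simp
  ultimately have *: "lo \<le> (1 - exp (- \<sigma>)) * (\<Sum>n. f n * g n)" "(1 - exp (- \<sigma>)) * (\<Sum>n. f n * g n) \<le> hi"
    by (simp_all add: pos_divide_le_eq pos_le_divide_eq mult.commute)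
  show "lo \<le> (1 - exp (- \<sigma>)) * (\<Sum>l. q l * exp (- (\<sigma> * real l))) * (\<Sum>k. u k * exp (- (\<sigma> * real k)))"
    "(1 - exp (- \<sigma>)) * (\<Sum>l. q l * exp (- (\<sigma> * real l))) * (\<Sum>k. u k * exp (- (\<sigma> * real k))) \<le> hi"
  proof -
    have prod': "(\<Sum>l. q l * exp (- (\<sigma> * real l))) * (\<Sum>k. u k * exp (- (\<sigma> * real k))) = (\<Sum>n. f n * g n)"
      using prod by (simp add: g_def mult.commute)
    show "lo \<le> (1 - exp (- \<sigma>)) * (\<Sum>l. q l * exp (- (\<sigma> * real l))) * (\<Sum>k. u k * exp (- (\<sigma> * real k)))"
      "(1 - exp (- \<sigma>)) * (\<Sum>l. q l * exp (- (\<sigma> * real l))) * (\<Sum>k. u k * exp (- (\<sigma> * real k))) \<le> hi"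
      using * by (simp_all only: mult.assoc prod')
  qed
qed

text \<open>The counted index is the last \<open>k \<le> n\<close> with \<open>V k\<close>, which
  exists because of \<open>V 0\<close>. The cardinality form matches the sum of indicators in
  \<open>renewal_identity\<close>.\<close>

lemma last_visit_count:
  assumes "V (0::nat)"
  shows "card {k. k \<le> n \<and> V k \<and> (\<forall>i\<in>{1..n - k}. \<not> V (k + i))} = 1"
proof -
  define k0 where "k0 = Max {k. k \<le> n \<and> V k}"
  have fin: "finite {k. k \<le> n \<and> V k}" by simp
  have ne: "0 \<in> {k. k \<le> n \<and> V k}" using assms by simp
  have k0: "k0 \<le> n" "V k0" using Max_in[OF fin] ne unfolding k0_def by blast+
  have mx: "k \<le> k0" if "k \<le> n" "V k" for k unfolding k0_def using that fin by (intro Max_ge) auto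
  have "{k. k \<le> n \<and> V k \<and> (\<forall>i\<in>{1..n - k}. \<not> V (k + i))} = {k0}"
  proof (intro equalityI subsetI)
    fix k assume k: "k \<in> {k. k \<le> n \<and> V k \<and> (\<forall>i\<in>{1..n - k}. \<not> V (k + i))}"
    then have "k \<le> k0" using mx by auto
    moreover have "\<not> k < k0"
    proof
      assume lt: "k < k0"
      then have "k0 - k \<in> {1..n - k}" using k0 by auto
      then have "\<not> V (k + (k0 - k))" using k by blast
      then show False using k0 lt by simp
    qed
    ultimately show "k \<in> {k0}" by simp
  next
    fix k assume "k \<in> {k0}"
    moreover have "\<not> V (k0 + i)" if "i \<in> {1..n - k0}" for i
    proof
      assume "V (k0 + i)"
      moreover have "k0 + i \<le> n" using that k0(1) unfolding atLeastAtMost_iff by arith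
      ultimately have "k0 + i \<le> k0" using mx by blast
      then show False using that by simp
    qed
    ultimately show "k \<in> {k. k \<le> n \<and> V k \<and> (\<forall>i\<in>{1..n - k}. \<not> V (k + i))}" using k0 by auto
  qed
  then show ?thesis by simp
qed

section \<open>The almost renewal equation on a cylinder\<close>

context rpf_measure begin

text \<open>On \<open>Y\<close> this is the event that the return time to \<open>Y\<close> exceeds
  \<open>l\<close>.\<close>

definition no_return :: "(nat \<Rightarrow> 'v) set \<Rightarrow> nat \<Rightarrow> (nat \<Rightarrow> 'v) set" where
  "no_return Y l = {y \<in> \<Omega>. y \<in> Y \<and> (\<forall>i\<in>{1..l}. (shift ^^ i) y \<notin> Y)}"

lemma no_return_measurable [measurable]:
  assumes [measurable]: "Y \<in> sets \<B>"
  shows "no_return Y l \<in> sets \<B>"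
proof -
  have "no_return Y l = {y \<in> space \<B>. y \<in> Y \<and> (\<forall>i\<in>{1..l}. (shift ^^ i) y \<notin> Y)}" by (simp add: no_return_def)
  also have "\<dots> \<in> sets \<B>" by measurable
  finally show ?thesis .
qed

lemma no_return_antimono: "k \<le> l \<Longrightarrow> no_return Y l \<subseteq> no_return Y k"
  by (auto simp: no_return_def)

text \<open>Every point of \<open>Y\<close> is split according to its last visit to \<open>Y\<close> up to time \<open>n\<close>.\<close>

lemma renewal_identity:
  assumes [measurable]: "Y \<in> sets \<B>"
  shows "emeasure m Y = (\<Sum>k\<le>n. \<integral>\<^sup>+y. u Y k y * indicator (no_return Y (n - k)) y \<partial>m)"
proof -
  have "(\<Sum>k\<le>n. \<integral>\<^sup>+y. u Y k y * indicator (no_return Y (n - k)) y \<partial>m)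
      = (\<Sum>k\<le>n. \<integral>\<^sup>+y. indicator Y y * indicator (no_return Y (n - k)) ((shift ^^ k) y) \<partial>m)"
    by (intro sum.cong refl nn_integral_u) measurable
  also have "\<dots> = (\<integral>\<^sup>+y. (\<Sum>k\<le>n. indicator Y y * indicator (no_return Y (n - k)) ((shift ^^ k) y)) \<partial>m)"
    by (rule nn_integral_sum[symmetric]) measurable
  also have "\<dots> = (\<integral>\<^sup>+y. indicator Y y \<partial>m)"
  proof (rule nn_integral_cong)
    fix y assume "y \<in> space m"
    then have y: "y \<in> \<Omega>" by simp
    show "(\<Sum>k\<le>n. indicator Y y * indicator (no_return Y (n - k)) ((shift ^^ k) y)) = (indicator Y y :: ennreal)"
    proof (cases "y \<in> Y")
      case True
      define V where "V k \<longleftrightarrow> (shift ^^ k) y \<in> Y" for k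
      have "(\<Sum>k\<le>n. indicator Y y * indicator (no_return Y (n - k)) ((shift ^^ k) y))
          = (\<Sum>k\<le>n. if V k \<and> (\<forall>i\<in>{1..n - k}. \<not> V (k + i)) then 1 else (0::ennreal))"
      proof (intro sum.cong refl)
        fix k
        have "(shift ^^ i) ((shift ^^ k) y) = (shift ^^ (k + i)) y" for i
          by (simp add: funpow_shift add_ac)
        then have "(shift ^^ k) y \<in> no_return Y (n - k) \<longleftrightarrow> V k \<and> (\<forall>i\<in>{1..n - k}. \<not> V (k + i))"
          using y by (simp add: no_return_def V_def shift_space_funpow)
        then show "indicator Y y * indicator (no_return Y (n - k)) ((shift ^^ k) y)
            = (if V k \<and> (\<forall>i\<in>{1..n - k}. \<not> V (k + i)) then 1 else (0::ennreal))"
          using True by (simp add: indicator_def)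
      qed
      also have "\<dots> = of_nat (card {k. k \<le> n \<and> V k \<and> (\<forall>i\<in>{1..n - k}. \<not> V (k + i))})"
        by (subst sum.If_cases) (auto simp: Int_def)
      also have "card {k. k \<le> n \<and> V k \<and> (\<forall>i\<in>{1..n - k}. \<not> V (k + i))} = 1"
        by (rule last_visit_count) (use True in \<open>simp add: V_def\<close>)
      finally show ?thesis using True by simp
    qed simp
  qed
  also have "\<dots> = emeasure m Y" by (simp add: nn_integral_indicator)
  finally show ?thesis by simp
qed

lemma u_cylinder_distortion:
  assumes w: "w \<noteq> []" and y: "y \<in> cylinder A w" "y' \<in> cylinder A w"
  shows "u (cylinder A w) k y \<le> ennreal (\<kappa> (length w)) * u (cylinder A w) k y'"
  unfolding u_def
proof (rule P_pow_distortion)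
  show "1 \<le> length w" using w by (cases w) auto
  show "y \<in> \<Omega>" "y' \<in> \<Omega>" "\<forall>i<length w. y i = y' i" using y by (auto simp: cylinder_def)
  show "indicator (cylinder A w) z = (indicator (cylinder A w) z' :: ennreal)"
    if "z \<in> \<Omega>" "z' \<in> \<Omega>" "\<forall>i<k + length w. z i = z' i" for z z'
    using that by (auto simp: cylinder_def indicator_def)
qed

text \<open>The later estimates freeze the iterates at one point, which must have finite values and
  convergent averages. Such points have full measure and the cylinder is not null.\<close>

lemma cylinder_reference_point:
  assumes w: "w \<noteq> []" and pos: "0 < measure m (cylinder A w)"
    and a: "normalizing_sequence \<mu> shift a" "\<forall>\<^sub>F n in sequentially. 0 < a n"
  obtains y0 where "y0 \<in> cylinder A w" "\<And>k. u (cylinder A w) k y0 < \<infinity>"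
    "(\<lambda>n. (\<Sum>k<n. v (cylinder A w) k y0) / a n) \<longlonglongrightarrow> measure m (cylinder A w)"
    "AE y in m. y \<in> cylinder A w \<longrightarrow> h y \<le> \<kappa> (length w) * h y0 \<and> h y0 \<le> \<kappa> (length w) * h y"
proof -
  let ?Y = "cylinder A w" and ?M = "measure m (cylinder A w)" and ?\<kappa> = "\<kappa> (length w)"
  define good where "good y \<longleftrightarrow> (\<forall>k. u ?Y k y < \<infinity>) \<and> (\<lambda>n. (\<Sum>k<n. v ?Y k y) / a n) \<longlonglongrightarrow> ?M" for y
  have good: "AE y in m. good y"
    using AE_u_finite[OF cylinder_sets finite_cylinder[OF w]] AE_average_v[OF cylinder_sets finite_cylinder[OF w] a(1)]
    by eventually_elim (simp add: good_def)
  have "\<exists>y0\<in>?Y. good y0"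
  proof (rule ccontr)
    assume "\<not> ?thesis"
    with good have "AE y in m. y \<notin> ?Y" by (auto elim!: eventually_mono)
    then have "emeasure m ?Y = 0" by (subst (asm) AE_iff_null_sets[symmetric]) auto
    then show False using pos by (simp add: measure_def)
  qed
  then obtain y0 where y0: "y0 \<in> ?Y" "good y0" by blast
  \<comment> \<open>The averages of \<open>v\<close> at \<open>y\<close> and \<open>z\<close> have the same limit, so \<open>h\<close> inherits the distortion of \<open>u\<close>.\<close>
  have le: "h y \<le> ?\<kappa> * h z" if y: "y \<in> ?Y" "good y" and z: "z \<in> ?Y" "good z" for y z
  proof -
    have hp: "0 < h y" "0 < h z" using y z h_pos by (auto simp: cylinder_def)
    have vk: "h y * v ?Y k y \<le> ?\<kappa> * (h z * v ?Y k z)" for k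
    proof -
      have "u ?Y k z < \<infinity>" "u ?Y k y < \<infinity>" using y z by (auto simp: good_def)
      then have "enn2real (u ?Y k y) \<le> enn2real (ennreal ?\<kappa> * u ?Y k z)"
        using u_cylinder_distortion[OF w y(1) z(1), of k]
        by (intro enn2real_mono) (auto simp: ennreal_mult_less_top)
      then show ?thesis using hp kappa_ge_1[of "length w"] by (simp add: v_def enn2real_mult)
    qed
    have "(\<lambda>n. h y * ((\<Sum>k<n. v ?Y k y) / a n)) \<longlonglongrightarrow> h y * ?M"
      "(\<lambda>n. ?\<kappa> * (h z * ((\<Sum>k<n. v ?Y k z) / a n))) \<longlonglongrightarrow> ?\<kappa> * (h z * ?M)"
      by (rule tendsto_mult[OF tendsto_const y(2)[unfolded good_def, THEN conjunct2]]
          tendsto_mult[OF tendsto_const tendsto_mult[OF tendsto_const z(2)[unfolded good_def, THEN conjunct2]]])+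
    moreover have "\<forall>\<^sub>F n in sequentially. h y * ((\<Sum>k<n. v ?Y k y) / a n) \<le> ?\<kappa> * (h z * ((\<Sum>k<n. v ?Y k z) / a n))"
      using a(2)
    proof eventually_elim
      case (elim n)
      have "(\<Sum>k<n. h y * v ?Y k y) \<le> (\<Sum>k<n. ?\<kappa> * (h z * v ?Y k z))" by (rule sum_mono[OF vk])
      then have "(\<Sum>k<n. h y * v ?Y k y) / a n \<le> (\<Sum>k<n. ?\<kappa> * (h z * v ?Y k z)) / a n"
        using elim by (simp add: divide_right_mono)
      then show ?case by (simp add: sum_distrib_left[symmetric])
    qed
    ultimately have "h y * ?M \<le> ?\<kappa> * (h z * ?M)" by (intro tendsto_le[OF sequentially_bot]) auto
    then show ?thesis using pos by (simp add: mult.assoc[symmetric])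
  qed
  have "AE y in m. y \<in> ?Y \<longrightarrow> h y \<le> ?\<kappa> * h y0 \<and> h y0 \<le> ?\<kappa> * h y"
    using good by eventually_elim (use le y0 in blast)
  then show ?thesis using that[of y0] y0 by (auto simp: good_def)
qed

text \<open>\<open>c\<close> is meant as the value of \<open>h\<close> at a reference point; on
  \<open>Y\<close> the measures \<mu> and \<open>c\<close> times \<open>m\<close> then agree up to
  the factor \<open>K\<close>.\<close>

lemma mu_m_comparison:
  assumes y0: "0 < c" "AE y in m. y \<in> Y \<longrightarrow> h y \<le> K * c \<and> c \<le> K * h y" "1 \<le> K"
    and S: "S \<in> sets \<B>" "S \<subseteq> Y"
  shows "emeasure \<mu> S \<le> ennreal (K * c) * emeasure m S" "ennreal c * emeasure m S \<le> ennreal K * emeasure \<mu> S"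
proof -
  note [measurable] = S(1)
  have "emeasure \<mu> S \<le> (\<integral>\<^sup>+y. ennreal (K * c) * indicator S y \<partial>m)"
    unfolding emeasure_mu[OF S(1)]
  proof (rule nn_integral_mono_AE)
    show "AE y in m. ennreal (h y) * indicator S y \<le> ennreal (K * c) * indicator S y"
      using y0(2) by eventually_elim (use S in \<open>auto split: split_indicator intro: ennreal_leI\<close>)
  qed
  also have "\<dots> = ennreal (K * c) * emeasure m S" by (subst nn_integral_cmult) auto
  finally show "emeasure \<mu> S \<le> ennreal (K * c) * emeasure m S" .
  have "ennreal c * emeasure m S = (\<integral>\<^sup>+y. ennreal c * indicator S y \<partial>m)" by (subst nn_integral_cmult) auto
  also have "\<dots> \<le> (\<integral>\<^sup>+y. ennreal K * (ennreal (h y) * indicator S y) \<partial>m)"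
  proof (rule nn_integral_mono_AE)
    show "AE y in m. ennreal c * indicator S y \<le> ennreal K * (ennreal (h y) * indicator S y)"
      using y0(2) by eventually_elim
        (use S y0(3) in \<open>auto split: split_indicator simp: ennreal_mult'[symmetric] intro: ennreal_leI\<close>)
  qed
  also have "\<dots> = ennreal K * emeasure \<mu> S" unfolding emeasure_mu[OF S(1)] by (rule nn_integral_cmult) measurable
  finally show "ennreal c * emeasure m S \<le> ennreal K * emeasure \<mu> S" .
qed

text \<open>\<open>rpf_pair\<close> makes cylinders finite for \<open>m\<close> only; for \<mu> it
  is the almost everywhere bound on \<open>h\<close> that helps.\<close>

lemma emeasure_mu_cylinder_finite:
  assumes "w \<noteq> []" "0 < c" "AE y in m. y \<in> cylinder A w \<longrightarrow> h y \<le> K * c \<and> c \<le> K * h y" "1 \<le> K"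
  shows "emeasure \<mu> (cylinder A w) < \<infinity>"
proof -
  have "emeasure \<mu> (cylinder A w) \<le> ennreal (K * c) * emeasure m (cylinder A w)"
    by (rule mu_m_comparison(1)[OF assms(2-4)]) auto
  also have "\<dots> < \<infinity>" using finite_cylinder[OF assms(1)] by (simp add: ennreal_mult_less_top)
  finally show ?thesis .
qed

text \<open>In \<open>renewal_identity\<close> the density \<open>u\<close> at \<open>y\<close> is
  replaced by its value at \<open>y0\<close>, and then \<open>h y0\<close> by \<open>h y\<close> to
  restore \<mu>. Each replacement costs a factor \<open>\<kappa> (length w)\<close>, hence the
  square. Dividing by the mass of the cylinder normalises the renewal equation to 1.\<close>

lemma cylinder_renewal_bounds:
  assumes w: "w \<noteq> []" and pos: "0 < measure m (cylinder A w)"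
    and y0: "y0 \<in> cylinder A w" "\<And>k. u (cylinder A w) k y0 < \<infinity>"
      "AE y in m. y \<in> cylinder A w \<longrightarrow> h y \<le> \<kappa> (length w) * h y0 \<and> h y0 \<le> \<kappa> (length w) * h y"
  defines "q \<equiv> \<lambda>l. measure \<mu> (no_return (cylinder A w) l)"
    and "U \<equiv> \<lambda>k. v (cylinder A w) k y0 / measure m (cylinder A w)"
  shows "1 / (\<kappa> (length w))\<^sup>2 \<le> (\<Sum>k\<le>n. U k * q (n - k))" "(\<Sum>k\<le>n. U k * q (n - k)) \<le> (\<kappa> (length w))\<^sup>2"
proof -
  let ?Y = "cylinder A w" and ?M = "measure m (cylinder A w)" and ?\<kappa> = "\<kappa> (length w)"
  have h0: "0 < h y0" using y0(1) h_pos by (auto simp: cylinder_def)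
  have \<kappa>1: "1 \<le> ?\<kappa>" by (rule kappa_ge_1)
  have finm: "emeasure m ?Y < \<infinity>" by (rule finite_cylinder[OF w])
  have finmu: "emeasure \<mu> ?Y < \<infinity>" by (rule emeasure_mu_cylinder_finite[OF w h0 y0(3) \<kappa>1])
  have M: "emeasure m ?Y = ennreal ?M" using finm by (intro emeasure_eq_ennreal_measure) auto
  have q: "emeasure \<mu> (no_return ?Y l) = ennreal (q l)" for l
  proof -
    have "emeasure \<mu> (no_return ?Y l) \<le> emeasure \<mu> ?Y" by (rule emeasure_mono) (auto simp: no_return_def)
    then show ?thesis unfolding q_def using finmu by (intro emeasure_eq_ennreal_measure) (auto simp: top_unique)
  qed
  have u0: "u ?Y k y0 = ennreal (h y0 * v ?Y k y0)" for k
    using y0(2)[of k] h0 by (simp add: v_def less_top[symmetric])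
  have v0: "0 \<le> v ?Y k y0" for k using h0 by (simp add: v_def)
  define I where "I k = (\<integral>\<^sup>+y. u ?Y k y * indicator (no_return ?Y (n - k)) y \<partial>m)" for k
  have up: "I k \<le> ennreal (?\<kappa>\<^sup>2 * (v ?Y k y0 * q (n - k)))" for k
  proof -
    have "I k \<le> (\<integral>\<^sup>+y. ennreal (?\<kappa>\<^sup>2 * v ?Y k y0) * (ennreal (h y) * indicator (no_return ?Y (n - k)) y) \<partial>m)"
      unfolding I_def
    proof (rule nn_integral_mono_AE)
      show "AE y in m. u ?Y k y * indicator (no_return ?Y (n - k)) y
          \<le> ennreal (?\<kappa>\<^sup>2 * v ?Y k y0) * (ennreal (h y) * indicator (no_return ?Y (n - k)) y)"
        using y0(3)
      proof eventually_elim
        case (elim y)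
        show ?case
        proof (cases "y \<in> no_return ?Y (n - k)")
          case True
          then have y: "y \<in> ?Y" by (simp add: no_return_def)
          have "u ?Y k y \<le> ennreal ?\<kappa> * u ?Y k y0" by (rule u_cylinder_distortion[OF w y y0(1)])
          also have "\<dots> = ennreal (?\<kappa> * v ?Y k y0 * h y0)" using \<kappa>1 v0 h0 by (simp add: u0 ennreal_mult'[symmetric] mult_ac)
          also have "\<dots> \<le> ennreal (?\<kappa> * v ?Y k y0 * (?\<kappa> * h y))"
            using elim y v0 \<kappa>1 by (intro ennreal_leI mult_left_mono) auto
          also have "\<dots> = ennreal (?\<kappa>\<^sup>2 * v ?Y k y0) * ennreal (h y)"
            using v0[of k] \<kappa>1 by (subst ennreal_mult'[symmetric]) (simp_all add: power2_eq_square mult_ac)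
          finally show ?thesis using True by simp
        qed simp
      qed
    qed
    also have "\<dots> = ennreal (?\<kappa>\<^sup>2 * v ?Y k y0) * ennreal (q (n - k))"
      unfolding q[symmetric] by (subst nn_integral_cmult) (auto simp: emeasure_mu)
    also have "\<dots> = ennreal (?\<kappa>\<^sup>2 * (v ?Y k y0 * q (n - k)))"
      using v0[of k] by (subst ennreal_mult'[symmetric]) (simp_all add: mult.assoc)
    finally show ?thesis .
  qed
  have low: "ennreal (v ?Y k y0 * q (n - k)) \<le> ennreal (?\<kappa>\<^sup>2) * I k" for k
  proof -
    have "ennreal (v ?Y k y0 * q (n - k)) = ennreal (v ?Y k y0) * emeasure \<mu> (no_return ?Y (n - k))"
      using v0 by (simp add: q ennreal_mult')
    also have "\<dots> = (\<integral>\<^sup>+y. ennreal (v ?Y k y0) * (ennreal (h y) * indicator (no_return ?Y (n - k)) y) \<partial>m)"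
      by (subst nn_integral_cmult) (auto simp: emeasure_mu)
    also have "\<dots> \<le> (\<integral>\<^sup>+y. ennreal (?\<kappa>\<^sup>2) * (u ?Y k y * indicator (no_return ?Y (n - k)) y) \<partial>m)"
    proof (rule nn_integral_mono_AE)
      show "AE y in m. ennreal (v ?Y k y0) * (ennreal (h y) * indicator (no_return ?Y (n - k)) y)
          \<le> ennreal (?\<kappa>\<^sup>2) * (u ?Y k y * indicator (no_return ?Y (n - k)) y)"
        using y0(3)
      proof eventually_elim
        case (elim y)
        show ?case
        proof (cases "y \<in> no_return ?Y (n - k)")
          case True
          then have y: "y \<in> ?Y" by (simp add: no_return_def)
          have "ennreal (v ?Y k y0) * ennreal (h y) \<le> ennreal (v ?Y k y0 * (?\<kappa> * h y0))"
            using elim y v0[of k] by (simp add: ennreal_mult'[symmetric] ennreal_leI mult_left_mono)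
          also have "\<dots> = ennreal ?\<kappa> * u ?Y k y0" using \<kappa>1 by (simp add: u0 ennreal_mult'[symmetric] mult_ac)
          also have "\<dots> \<le> ennreal ?\<kappa> * (ennreal ?\<kappa> * u ?Y k y)"
            by (intro mult_left_mono u_cylinder_distortion[OF w y0(1) y]) simp
          also have "\<dots> = ennreal (?\<kappa>\<^sup>2) * u ?Y k y" using \<kappa>1 by (simp add: power2_eq_square ennreal_mult mult.assoc)
          finally show ?thesis using True by simp
        qed simp
      qed
    qed
    also have "\<dots> = ennreal (?\<kappa>\<^sup>2) * I k" unfolding I_def by (rule nn_integral_cmult) measurable
    finally show ?thesis .
  qed
  have id: "ennreal ?M = (\<Sum>k\<le>n. I k)" using renewal_identity[of ?Y n] by (simp add: I_def M)
  have q0: "0 \<le> q l" for l by (simp add: q_def)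
  have s0: "0 \<le> (\<Sum>k\<le>n. v ?Y k y0 * q (n - k))" using v0 q0 by (intro sum_nonneg) simp
  have "ennreal ?M \<le> (\<Sum>k\<le>n. ennreal (?\<kappa>\<^sup>2 * (v ?Y k y0 * q (n - k))))" unfolding id by (rule sum_mono[OF up])
  also have "\<dots> = ennreal (?\<kappa>\<^sup>2 * (\<Sum>k\<le>n. v ?Y k y0 * q (n - k)))"
    using v0 q0 by (subst sum_ennreal) (auto simp: sum_distrib_left)
  finally have 1: "?M \<le> ?\<kappa>\<^sup>2 * (\<Sum>k\<le>n. v ?Y k y0 * q (n - k))"
    using s0 by (subst (asm) ennreal_le_iff) auto
  have "ennreal (\<Sum>k\<le>n. v ?Y k y0 * q (n - k)) = (\<Sum>k\<le>n. ennreal (v ?Y k y0 * q (n - k)))"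
    using v0 q0 by (subst sum_ennreal) auto
  also have "\<dots> \<le> (\<Sum>k\<le>n. ennreal (?\<kappa>\<^sup>2) * I k)" by (rule sum_mono[OF low])
  also have "\<dots> = ennreal (?\<kappa>\<^sup>2 * ?M)" by (simp add: sum_distrib_left[symmetric] id[symmetric] ennreal_mult)
  finally have 2: "(\<Sum>k\<le>n. v ?Y k y0 * q (n - k)) \<le> ?\<kappa>\<^sup>2 * ?M" by (subst (asm) ennreal_le_iff) auto
  have U: "(\<Sum>k\<le>n. U k * q (n - k)) = (\<Sum>k\<le>n. v ?Y k y0 * q (n - k)) / ?M"
    by (simp add: U_def sum_divide_distrib)
  show "1 / ?\<kappa>\<^sup>2 \<le> (\<Sum>k\<le>n. U k * q (n - k))"
    unfolding U using 1 pos \<kappa>1 by (simp add: pos_divide_le_eq pos_le_divide_eq mult.commute)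
  show "(\<Sum>k\<le>n. U k * q (n - k)) \<le> ?\<kappa>\<^sup>2"
    unfolding U using 2 pos by (simp add: pos_divide_le_eq mult.commute)
qed

text \<open>The tolerance \<open>d\<close> does not depend on the word, so the word may be chosen
  afterwards, long enough for \<open>(\<kappa> (length w))\<^sup>2 \<le> 1 + d\<close>.\<close>

lemma cylinder_return_tail:
  assumes a: "normalizing_sequence \<mu> shift a" "incseq a" "regularly_varying a \<alpha>" and \<alpha>: "0 < \<alpha>" "\<alpha> \<le> 1"
    and t: "0 < t" and e: "0 < e"
  obtains d where "0 < d"
    "\<And>w. w \<noteq> [] \<Longrightarrow> 0 < measure m (cylinder A w) \<Longrightarrow> (\<kappa> (length w))\<^sup>2 \<le> 1 + d \<Longrightarrow>
      \<forall>\<^sub>F n in sequentially. \<bar>a n * measure \<mu> (no_return (cylinder A w) (nat \<lfloor>t * real n\<rfloor>))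
        - sin (pi * \<alpha>) / (pi * \<alpha>) * t powr (- \<alpha>)\<bar> < e"
proof (rule renewal_tail_close[OF a(2,3) \<alpha> t e])
  fix d
  assume d: "0 < d" and close: "\<And>q u \<kappa>. (\<And>l. 0 \<le> q l) \<Longrightarrow> decseq q \<Longrightarrow> (\<And>k. 0 \<le> u k)
      \<Longrightarrow> (\<lambda>n. (\<Sum>k<n. u k) / a n) \<longlonglongrightarrow> 1 \<Longrightarrow> 1 \<le> \<kappa> \<Longrightarrow> \<kappa> \<le> 1 + d
      \<Longrightarrow> almost_renewal \<kappa> q u
      \<Longrightarrow> \<forall>\<^sub>F m in sequentially. \<bar>a m * q (nat \<lfloor>t * real m\<rfloor>) - sin (pi * \<alpha>) / (pi * \<alpha>) * t powr (- \<alpha>)\<bar> < e"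
  show thesis
  proof (rule that[OF d])
    fix w assume w: "w \<noteq> []" "0 < measure m (cylinder A w)" "(\<kappa> (length w))\<^sup>2 \<le> 1 + d"
    let ?Y = "cylinder A w" and ?M = "measure m (cylinder A w)" and ?\<kappa> = "\<kappa> (length w)"
    obtain y0 where y0: "y0 \<in> cylinder A w" "\<And>k. u (cylinder A w) k y0 < \<infinity>"
      "(\<lambda>n. (\<Sum>k<n. v (cylinder A w) k y0) / a n) \<longlonglongrightarrow> measure m (cylinder A w)"
      "AE y in m. y \<in> cylinder A w \<longrightarrow> h y \<le> \<kappa> (length w) * h y0 \<and> h y0 \<le> \<kappa> (length w) * h y"
      using cylinder_reference_point[OF w(1,2) a(1) rv_pos[OF a(2,3) \<alpha>]] by blast
    define q where "q l = measure \<mu> (no_return ?Y l)" for l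
    define U where "U k = v ?Y k y0 / ?M" for k
    note ren = cylinder_renewal_bounds[OF w(1,2) y0(1,2,4), folded q_def U_def]
    have h0: "0 < h y0" using y0(1) h_pos by (auto simp: cylinder_def)
    have fin: "emeasure \<mu> ?Y < \<infinity>" by (rule emeasure_mu_cylinder_finite[OF w(1) h0 y0(4) kappa_ge_1])
    have dec: "decseq q" unfolding q_def[abs_def] decseq_def
    proof (intro allI impI)
      fix k l :: nat assume "k \<le> l"
      have "emeasure \<mu> (no_return ?Y k) \<le> emeasure \<mu> ?Y" by (rule emeasure_mono) (auto simp: no_return_def)
      then have "no_return ?Y k \<in> fmeasurable \<mu>" using fin by (intro fmeasurableI) auto
      then show "measure \<mu> (no_return ?Y l) \<le> measure \<mu> (no_return ?Y k)"
        using no_return_antimono[OF \<open>k \<le> l\<close>] by (intro measure_mono_fmeasurable) auto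
    qed
    have "\<forall>\<^sub>F n in sequentially. \<bar>a n * q (nat \<lfloor>t * real n\<rfloor>) - sin (pi * \<alpha>) / (pi * \<alpha>) * t powr (- \<alpha>)\<bar> < e"
    proof (rule close[where u = U and \<kappa> = "?\<kappa>\<^sup>2"])
      show "0 \<le> q l" for l by (simp add: q_def)
      show "decseq q" by (rule dec)
      show "0 \<le> U k" for k using h0 by (simp add: U_def v_def)
      have "(\<lambda>n. (\<Sum>k<n. v ?Y k y0) / a n / ?M) \<longlonglongrightarrow> ?M / ?M" using y0(3) w(2) by (intro tendsto_intros) auto
      then show "(\<lambda>n. (\<Sum>k<n. U k) / a n) \<longlonglongrightarrow> 1"
        using w(2) by (simp add: U_def sum_divide_distrib[symmetric] mult.commute)
      show "1 \<le> ?\<kappa>\<^sup>2" using kappa_ge_1[of "length w"] by (simp add: one_le_power)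
      show "?\<kappa>\<^sup>2 \<le> 1 + d" by (rule w(3))
      have qb: "\<bar>q l\<bar> \<le> q 0" for l using decseqD[OF dec, of 0 l] by (simp add: q_def)
      have U0: "0 \<le> U k" for k using h0 by (simp add: U_def v_def)
      show "almost_renewal (?\<kappa>\<^sup>2) q U"
        unfolding almost_renewal_def atLeastAtMost_iff
        by (intro allI impI conjI renewal_generating_functions[OF qb _ _ U0 ren])
    qed
    then show "\<forall>\<^sub>F n in sequentially. \<bar>a n * measure \<mu> (no_return (cylinder A w) (nat \<lfloor>t * real n\<rfloor>))
        - sin (pi * \<alpha>) / (pi * \<alpha>) * t powr (- \<alpha>)\<bar> < e" by (simp add: q_def)
  qed
qed

section \<open>Comparing returns to the long cylinder with returns to \<open>[s]\<close>\<close>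

definition first_return :: "(nat \<Rightarrow> 'v) set \<Rightarrow> (nat \<Rightarrow> 'v) set \<Rightarrow> nat \<Rightarrow> (nat \<Rightarrow> 'v) set" where
  "first_return C Y k = {y \<in> \<Omega>. y \<in> C \<and> (shift ^^ k) y \<in> Y \<and> (\<forall>i\<in>{1..<k}. (shift ^^ i) y \<notin> Y)}"

lemma first_return_measurable [measurable]:
  assumes [measurable]: "C \<in> sets \<B>" "Y \<in> sets \<B>"
  shows "first_return C Y k \<in> sets \<B>"
proof -
  have "first_return C Y k = {y \<in> space \<B>. y \<in> C \<and> (shift ^^ k) y \<in> Y \<and> (\<forall>i\<in>{1..<k}. (shift ^^ i) y \<notin> Y)}"
    by (simp add: first_return_def)
  also have "\<dots> \<in> sets \<B>" by measurable
  finally show ?thesis .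
qed

text \<open>Given that the first return to \<open>[s]\<close> happens at time \<open>k\<close>, the
  position at that time has a density on \<open>[s]\<close> that varies by at most the factor
  \<open>\<kappa> 1\<close>, because \<open>length w \<le> k\<close> makes the event depend on the
  first \<open>k + 1\<close> coordinates only. The product form avoids dividing in
  \<open>ennreal\<close>.\<close>

lemma first_return_quasi_independence:
  assumes k: "length w \<le> k" and E: "E \<in> sets \<B>" "E \<subseteq> cylinder A [s]"
  shows "emeasure m (cylinder A [s]) * emeasure m (first_return (cylinder A w) (cylinder A [s]) k \<inter> (shift ^^ k) -` E)
    \<le> ennreal (\<kappa> 1) * emeasure m E * emeasure m (first_return (cylinder A w) (cylinder A [s]) k)"
proof -
  note [measurable] = E(1)
  let ?Y = "cylinder A [s]" and ?G = "first_return (cylinder A w) (cylinder A [s]) k"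
  define D where "D = (P ^^ k) (indicator ?G)"
  have [measurable]: "D \<in> borel_measurable \<B>" unfolding D_def by measurable
  have dist: "D y \<le> ennreal (\<kappa> 1) * D y'" if y: "y \<in> ?Y" "y' \<in> ?Y" for y y'
    unfolding D_def
  proof (rule P_pow_distortion)
    show "1 \<le> (1::nat)" by simp
    show "y \<in> \<Omega>" "y' \<in> \<Omega>" "\<forall>i<1. y i = y' i" using y by (auto simp: cylinder_def)
    fix z z' assume z: "z \<in> \<Omega>" "z' \<in> \<Omega>" "\<forall>i<k + 1. z i = z' i"
    have "z \<in> cylinder A w \<longleftrightarrow> z' \<in> cylinder A w" using z k by (auto simp: cylinder_def)
    moreover have "(shift ^^ i) z \<in> ?Y \<longleftrightarrow> (shift ^^ i) z' \<in> ?Y" if "i \<le> k" for i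
      using z that shift_space_funpow[of z A i] shift_space_funpow[of z' A i]
      by (auto simp: cylinder_def funpow_shift)
    ultimately have "z \<in> ?G \<longleftrightarrow> z' \<in> ?G" using z unfolding first_return_def by auto
    then show "indicator ?G z = (indicator ?G z' :: ennreal)" by (simp add: indicator_def)
  qed
  have inter: "emeasure m (?G \<inter> (shift ^^ k) -` H) = (\<integral>\<^sup>+y. D y * indicator H y \<partial>m)" if [measurable]: "H \<in> sets \<B>" for H
  proof -
    have GH: "?G \<inter> (shift ^^ k) -` H = ?G \<inter> ((shift ^^ k) -` H \<inter> \<Omega>)" by (auto simp: first_return_def)
    have "(\<integral>\<^sup>+y. D y * indicator H y \<partial>m) = (\<integral>\<^sup>+y. indicator ?G y * indicator H ((shift ^^ k) y) \<partial>m)"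
      unfolding D_def by (rule P_pow_duality) measurable
    also have "\<dots> = (\<integral>\<^sup>+y. indicator (?G \<inter> (shift ^^ k) -` H) y \<partial>m)"
      by (intro nn_integral_cong) (auto split: split_indicator)
    also have "\<dots> = emeasure m (?G \<inter> (shift ^^ k) -` H)"
      unfolding GH using that
      by (intro nn_integral_indicator) (auto intro!: sets.Int first_return_measurable sets_vimage_shift cylinder_sets)
    finally show ?thesis by simp
  qed
  have le: "(\<integral>\<^sup>+y. D y * indicator E y \<partial>m) \<le> ennreal (\<kappa> 1) * emeasure m E * D y'" if y': "y' \<in> ?Y" for y'
  proof -
    have "(\<integral>\<^sup>+y. D y * indicator E y \<partial>m) \<le> (\<integral>\<^sup>+y. (ennreal (\<kappa> 1) * D y') * indicator E y \<partial>m)"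
      using dist[OF _ y'] E(2) by (intro nn_integral_mono) (auto split: split_indicator)
    also have "\<dots> = ennreal (\<kappa> 1) * D y' * emeasure m E" by (rule nn_integral_cmult_indicator) simp
    finally show ?thesis by (simp add: mult_ac)
  qed
  \<comment> \<open>Instead of choosing a reference value of the density \<open>D\<close>, the bound
    is integrated over all \<open>y'\<close> in \<open>[s]\<close>.\<close>
  have "emeasure m ?Y * emeasure m (?G \<inter> (shift ^^ k) -` E)
      = (\<integral>\<^sup>+y'. (\<integral>\<^sup>+y. D y * indicator E y \<partial>m) * indicator ?Y y' \<partial>m)"
    by (subst nn_integral_cmult_indicator) (auto simp: inter mult.commute)
  also have "\<dots> \<le> (\<integral>\<^sup>+y'. (ennreal (\<kappa> 1) * emeasure m E) * (D y' * indicator ?Y y') \<partial>m)"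
    using le by (intro nn_integral_mono) (auto split: split_indicator)
  also have "\<dots> = ennreal (\<kappa> 1) * emeasure m E * emeasure m (?G \<inter> (shift ^^ k) -` ?Y)"
    by (subst nn_integral_cmult) (auto simp: inter)
  also have "?G \<inter> (shift ^^ k) -` ?Y = ?G" by (auto simp: first_return_def)
  finally show ?thesis .
qed

text \<open>By \<open>AE_hits\<close> the events decrease to a null set, and \<open>[s]\<close> has
  finite mass.\<close>

lemma late_hitting_tendsto_0:
  assumes w: "w \<noteq> []" "0 < measure m (cylinder A w)" and a: "normalizing_sequence \<mu> shift a"
  shows "(\<lambda>L. measure m {y \<in> cylinder A [s]. \<forall>i\<le>L. (shift ^^ i) y \<notin> cylinder A w}) \<longlonglongrightarrow> 0"
proof -
  let ?Y = "cylinder A [s]"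
  define E where "E L = {y \<in> ?Y. \<forall>i\<le>L. (shift ^^ i) y \<notin> cylinder A w}" for L
  have E_alt: "E L = {y \<in> space m. y \<in> ?Y \<and> (\<forall>i\<le>L. (shift ^^ i) y \<notin> cylinder A w)}" for L
    by (auto simp: E_def cylinder_def)
  have E [measurable]: "E L \<in> sets m" for L unfolding E_alt by measurable
  have fin: "emeasure m ?Y < \<infinity>" by (rule finite_cylinder) simp
  have "(\<lambda>L. measure m (E L)) \<longlonglongrightarrow> measure m (\<Inter>L. E L)"
  proof (rule Lim_measure_decseq)
    show "range E \<subseteq> sets m" using E by auto
    show "decseq E" by (auto simp: decseq_def E_def)
    show "emeasure m (E L) \<noteq> \<infinity>" for L
      using emeasure_mono[of "E L" ?Y m] fin by (auto simp: E_def top_unique)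
  qed
  then have lim: "(\<lambda>L. measure m (E L)) \<longlonglongrightarrow> measure m (\<Inter>L. E L)" .
  have "AE y in m. y \<notin> (\<Inter>L. E L)"
    using AE_hits[OF cylinder_sets finite_cylinder[OF w(1)] w(2) a]
    by eventually_elim (auto simp: E_def)
  moreover have "(\<Inter>L. E L) \<in> sets m" by measurable
  ultimately have "emeasure m (\<Inter>L. E L) = 0"
    using AE_iff_null_sets[of "\<Inter>L. E L" m] by auto
  then have "measure m (\<Inter>L. E L) = 0" by (simp add: measure_def)
  with lim show ?thesis by (simp add: E_def)
qed

text \<open>Up to the event that the first return to \<open>[s]\<close> is followed by a late visit to the smaller
  cylinder, the return time to \<open>[s]\<close> and the one to the smaller cylinder differ by at most \<open>L\<close>.\<close>

lemma first_return_window_bound: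
  fixes L :: nat and K c :: real
  assumes w: "w \<noteq> []" "0 < measure m (cylinder A w)" "w ! 0 = s" and p: "length w \<le> p" "p \<le> r"
    and y0: "0 < c" "AE y in m. y \<in> cylinder A w \<longrightarrow> h y \<le> K * c \<and> c \<le> K * h y" "1 \<le> K"
  defines "C \<equiv> K\<^sup>2 * \<kappa> 1 / measure m (cylinder A [s])"
    and "q \<equiv> \<lambda>l. measure \<mu> (no_return (cylinder A w) l)"
    and "E \<equiv> {y \<in> cylinder A [s]. \<forall>i\<le>L. (shift ^^ i) y \<notin> cylinder A w}"
  shows "measure \<mu> (\<Union>k\<in>{p<..r}. first_return (cylinder A w) (cylinder A [s]) k)
      \<le> q p - q (r + L) + C * measure m E * q p"
proof -
  let ?X = "cylinder A w" and ?Y = "cylinder A [s]"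
  define G where "G k = first_return ?X ?Y k" for k
  define S where "S = (\<Union>k\<in>{p<..r}. G k)"
  have XY: "?X \<subseteq> ?Y" using w by (cases w) (auto simp: cylinder_def)
  have E_alt: "E = {y \<in> space m. y \<in> ?Y \<and> (\<forall>i\<le>L. (shift ^^ i) y \<notin> ?X)}"
    by (auto simp: E_def cylinder_def)
  have E [measurable]: "E \<in> sets \<B>" unfolding sets_m[symmetric] E_alt by measurable
  have [measurable]: "G k \<in> sets \<B>" for k unfolding G_def by measurable
  have S [measurable]: "S \<in> sets \<B>" unfolding S_def by measurable
  have SX: "S \<subseteq> ?X" by (auto simp: S_def G_def first_return_def)
  have Xmu: "?X \<in> fmeasurable \<mu>"
    using emeasure_mu_cylinder_finite[OF w(1) y0] by (intro fmeasurableI) auto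
  have Xm: "?X \<in> fmeasurable m" "?Y \<in> fmeasurable m"
    using finite_cylinder w(1) by (auto intro!: fmeasurableI)
  have fmu: "H \<in> fmeasurable \<mu>" if "H \<subseteq> ?X" "H \<in> sets \<B>" for H
    by (rule fmeasurableI2[OF Xmu]) (use that in auto)
  have fm: "H \<in> fmeasurable m" if "H \<subseteq> ?X" "H \<in> sets \<B>" for H
    by (rule fmeasurableI2[OF Xm(1)]) (use that in auto)
  have Em: "E \<in> fmeasurable m" by (rule fmeasurableI2[OF Xm(2)]) (auto simp: E_def)
  have Ypos: "0 < measure m ?Y"
    using w(2) measure_mono_fmeasurable[OF XY _ Xm(2)] by simp
  have cmp1: "measure \<mu> H \<le> K * c * measure m H" if "H \<subseteq> ?X" "H \<in> sets \<B>" for H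
    using mu_m_comparison(1)[OF y0 that(2,1)] y0 fmu[OF that] fm[OF that]
    by (simp add: emeasure_eq_measure2 ennreal_mult'[symmetric])
  have cmp2: "c * measure m H \<le> K * measure \<mu> H" if "H \<subseteq> ?X" "H \<in> sets \<B>" for H
    using mu_m_comparison(2)[OF y0 that(2,1)] y0 fmu[OF that] fm[OF that]
    by (simp add: emeasure_eq_measure2 ennreal_mult'[symmetric])
  \<comment> \<open>Bad event: the first return to \<open>[s]\<close> occurs at time
    \<open>k\<close>, but the cylinder of \<open>w\<close> is missed from time \<open>k\<close> to
    time \<open>k + L\<close>.\<close>
  define B where "B k = G k \<inter> (shift ^^ k) -` E" for k
  have B_alt: "B k = G k \<inter> ((shift ^^ k) -` E \<inter> \<Omega>)" for k by (auto simp: B_def G_def first_return_def)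
  have [measurable]: "B k \<in> sets \<B>" for k unfolding B_alt by measurable
  have GX: "G k \<subseteq> ?X" "B k \<subseteq> ?X" for k by (auto simp: B_def G_def first_return_def)
  \<comment> \<open>Quasi-independence is a statement about \<open>m\<close>; passing from \<mu> to
    \<open>m\<close> and back costs \<open>K\<close> each way, hence the square in
    \<open>C\<close>.\<close>
  have bad: "measure \<mu> (B k) \<le> C * measure m E * measure \<mu> (G k)" if k: "p < k" for k
  proof -
    have k': "length w \<le> k" using k p by simp
    have "emeasure m ?Y * emeasure m (B k) \<le> ennreal (\<kappa> 1) * emeasure m E * emeasure m (G k)"
      unfolding B_def G_def by (rule first_return_quasi_independence[OF k' E]) (auto simp: E_def)
    then have "measure m ?Y * measure m (B k) \<le> \<kappa> 1 * measure m E * measure m (G k)"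
      using fm[OF GX(1), of k] fm[OF GX(2), of k] Xm Em kappa_ge_1[of 1]
      by (simp add: emeasure_eq_measure2 ennreal_mult'[symmetric])
    then have 1: "measure m (B k) \<le> \<kappa> 1 * measure m E * measure m (G k) / measure m ?Y"
      using Ypos by (simp add: pos_le_divide_eq mult.commute)
    have "measure \<mu> (B k) \<le> K * c * measure m (B k)" by (rule cmp1) (use GX in auto)
    also have "\<dots> \<le> K * c * (\<kappa> 1 * measure m E * measure m (G k) / measure m ?Y)"
      using 1 y0 by (intro mult_left_mono) auto
    also have "\<dots> = K * \<kappa> 1 * measure m E / measure m ?Y * (c * measure m (G k))" by simp
    also have "\<dots> \<le> K * \<kappa> 1 * measure m E / measure m ?Y * (K * measure \<mu> (G k))"
      using GX y0 kappa_ge_1[of 1] by (intro mult_left_mono cmp2) auto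
    also have "\<dots> = C * measure m E * measure \<mu> (G k)" by (simp add: C_def power2_eq_square)
    finally show ?thesis .
  qed
  have disj: "disjoint_family_on G {p<..r}"
    unfolding disjoint_family_on_def
  proof (intro ballI impI)
    fix k l assume kl: "k \<in> {p<..r}" "l \<in> {p<..r}" "k \<noteq> l"
    have *: False if "y \<in> G k" "y \<in> G l" "k < l" "p < k" for y k l
      using that by (auto simp: G_def first_return_def)
    show "G k \<inter> G l = {}" using kl *[of _ k l] *[of _ l k] by (cases k l rule: linorder_cases) auto
  qed
  have sumG: "(\<Sum>k\<in>{p<..r}. measure \<mu> (G k)) = measure \<mu> S"
    unfolding S_def using GX by (intro measure_finite_Union[symmetric] disj)
      (auto intro!: fmeasurableD2 fmu)
  \<comment> \<open>The cylinder of \<open>w\<close> is contained in \<open>[s]\<close>, so a point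
    that avoids \<open>[s]\<close> up to time \<open>p\<close> avoids the smaller cylinder as
    well.\<close>
  have Sp: "S \<subseteq> no_return ?X p"
  proof
    fix y assume "y \<in> S"
    then obtain k where k: "p < k" "y \<in> G k" by (auto simp: S_def)
    then show "y \<in> no_return ?X p" using XY by (fastforce simp: G_def first_return_def no_return_def)
  qed
  \<comment> \<open>Outside the bad events the cylinder of \<open>w\<close> is reached by time
    \<open>k + L\<close>, at most \<open>r + L\<close>, so its return time to itself lies in the
    window between \<open>p\<close> and \<open>r + L\<close>.\<close>
  have sub: "S \<subseteq> (no_return ?X p - no_return ?X (r + L)) \<union> (\<Union>k\<in>{p<..r}. B k)"
  proof
    fix y assume y: "y \<in> S"
    then obtain k where k: "p < k" "k \<le> r" "y \<in> G k" by (auto simp: S_def)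
    show "y \<in> (no_return ?X p - no_return ?X (r + L)) \<union> (\<Union>k\<in>{p<..r}. B k)"
    proof (cases "(shift ^^ k) y \<in> E")
      case True
      then show ?thesis using k by (auto simp: B_def)
    next
      case False
      have "(shift ^^ k) y \<in> ?Y" using k by (simp add: G_def first_return_def)
      then obtain i where i: "i \<le> L" "(shift ^^ i) ((shift ^^ k) y) \<in> ?X" using False by (auto simp: E_def)
      then have "(shift ^^ (k + i)) y \<in> ?X" by (simp add: funpow_shift add_ac)
      moreover have "k + i \<in> {1..r + L}" using i k by auto
      ultimately have "y \<notin> no_return ?X (r + L)" unfolding no_return_def by blast
      then show ?thesis using Sp y by auto
    qed
  qed
  have nr: "no_return ?X l \<subseteq> ?X" for l by (auto simp: no_return_def)
  have "measure \<mu> S \<le> measure \<mu> ((no_return ?X p - no_return ?X (r + L)) \<union> (\<Union>k\<in>{p<..r}. B k))"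
  proof (intro measure_mono_fmeasurable fmu sub)
    show "(no_return ?X p - no_return ?X (r + L)) \<union> (\<Union>k\<in>{p<..r}. B k) \<subseteq> ?X" using nr GX by blast
  qed auto
  also have "\<dots> \<le> measure \<mu> (no_return ?X p - no_return ?X (r + L)) + measure \<mu> (\<Union>k\<in>{p<..r}. B k)"
    by (rule measure_Un_le) auto
  also have "measure \<mu> (no_return ?X p - no_return ?X (r + L)) = q p - q (r + L)"
    unfolding q_def using p no_return_antimono[of p "r + L" ?X] nr
    by (intro measure_Diff) (auto intro!: fmeasurableD2 fmu)
  also have "measure \<mu> (\<Union>k\<in>{p<..r}. B k) \<le> (\<Sum>k\<in>{p<..r}. measure \<mu> (B k))"
    by (rule measure_UNION_le) auto
  also have "\<dots> \<le> (\<Sum>k\<in>{p<..r}. C * measure m E * measure \<mu> (G k))" by (rule sum_mono[OF bad]) simp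
  also have "\<dots> = C * measure m E * measure \<mu> S" by (simp add: sum_distrib_left[symmetric] sumG)
  also have "\<dots> \<le> C * measure m E * q p"
  proof -
    have "measure \<mu> S \<le> q p" unfolding q_def using Sp nr by (intro measure_mono_fmeasurable fmu) auto
    moreover have "0 \<le> C * measure m E" using kappa_ge_1[of 1] by (auto simp: C_def)
    ultimately show ?thesis by (rule mult_left_mono)
  qed
  finally show "measure \<mu> (\<Union>k\<in>{p<..r}. first_return ?X ?Y k) \<le> q p - q (r + L) + C * measure m E * q p"
    by (simp add: S_def G_def)
qed

text \<open>The order of choices matters: \<open>t2\<close> beyond \<open>t'\<close>, so that a
  bounded delay disappears under rescaling; then \<open>N\<close>, so that the tails at
  \<open>t\<close> and \<open>t2\<close> are accurate; then, for each word, \<open>L\<close>, so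
  that late visits are rare; and \<open>n\<close> last.\<close>

lemma first_return_window_limit:
  assumes a: "normalizing_sequence \<mu> shift a" "incseq a" "regularly_varying a \<alpha>" and \<alpha>: "0 < \<alpha>" "\<alpha> \<le> 1"
    and t: "0 < t" "t < t'" and e: "0 < e"
  defines "c \<equiv> sin (pi * \<alpha>) / (pi * \<alpha>)"
  obtains N where "\<And>w s. w \<noteq> [] \<Longrightarrow> N \<le> length w \<Longrightarrow> 0 < measure m (cylinder A w) \<Longrightarrow> w ! 0 = s \<Longrightarrow>
      \<forall>\<^sub>F n in sequentially. a n * measure \<mu> (\<Union>k\<in>{nat \<lfloor>t * real n\<rfloor><..nat \<lfloor>t' * real n\<rfloor>}.
          first_return (cylinder A w) (cylinder A [s]) k)
        \<le> c * (t powr (- \<alpha>) - t' powr (- \<alpha>)) + e"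
proof -
  define g where "g t = c * t powr (- \<alpha>)" for t
  have t'0: "0 < t'" using t by simp
  have "(g \<longlongrightarrow> g t') (at t' within {t'<..})" unfolding g_def[abs_def] using t'0 by (intro tendsto_intros) auto
  then have "\<forall>\<^sub>F r in at_right t'. g t' - e / 5 < g r" using e by (intro order_tendstoD) auto
  moreover have "\<forall>\<^sub>F r in at_right t'. t' < r" by (rule eventually_at_right_less)
  ultimately have "\<forall>\<^sub>F r in at_right t'. g t' - e / 5 < g r \<and> t' < r" by (rule eventually_conj)
  then obtain t2 where t2: "g t' - e / 5 < g t2" "t' < t2"
    using eventually_happens'[OF trivial_limit_at_right_real] by blast
  have e5: "0 < e / 5" using e by simp
  obtain d1 where d1: "0 < d1" "\<And>w. w \<noteq> [] \<Longrightarrow> 0 < measure m (cylinder A w) \<Longrightarrow> (\<kappa> (length w))\<^sup>2 \<le> 1 + d1 \<Longrightarrow>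
      \<forall>\<^sub>F n in sequentially. \<bar>a n * measure \<mu> (no_return (cylinder A w) (nat \<lfloor>t * real n\<rfloor>)) - g t\<bar> < e / 5"
    using cylinder_return_tail[OF a \<alpha> t(1) e5] unfolding g_def c_def by blast
  have t20: "0 < t2" using t2 t'0 by simp
  obtain d2 where d2: "0 < d2" "\<And>w. w \<noteq> [] \<Longrightarrow> 0 < measure m (cylinder A w) \<Longrightarrow> (\<kappa> (length w))\<^sup>2 \<le> 1 + d2 \<Longrightarrow>
      \<forall>\<^sub>F n in sequentially. \<bar>a n * measure \<mu> (no_return (cylinder A w) (nat \<lfloor>t2 * real n\<rfloor>)) - g t2\<bar> < e / 5"
    using cylinder_return_tail[OF a \<alpha> t20 e5] unfolding g_def c_def by blast
  have "(\<lambda>p. (\<kappa> p)\<^sup>2) \<longlonglongrightarrow> 1\<^sup>2" by (intro tendsto_intros kappa_tendsto)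
  then have "\<forall>\<^sub>F p in sequentially. (\<kappa> p)\<^sup>2 < 1 + min d1 d2" using d1 d2 by (intro order_tendstoD) auto
  then obtain N where N: "\<And>p. p \<ge> N \<Longrightarrow> (\<kappa> p)\<^sup>2 < 1 + min d1 d2" by (auto simp: eventually_sequentially)
  show ?thesis
  proof (rule that[of N])
    fix w :: "'v list" and s assume w: "w \<noteq> []" "N \<le> length w" "0 < measure m (cylinder A w)" "w ! 0 = s"
    have \<kappa>w: "(\<kappa> (length w))\<^sup>2 \<le> 1 + d1" "(\<kappa> (length w))\<^sup>2 \<le> 1 + d2" using N[OF w(2)] by auto
    obtain y0 where y0: "y0 \<in> cylinder A w"
      "AE y in m. y \<in> cylinder A w \<longrightarrow> h y \<le> \<kappa> (length w) * h y0 \<and> h y0 \<le> \<kappa> (length w) * h y"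
      using cylinder_reference_point[OF w(1,3) a(1) rv_pos[OF a(2,3) \<alpha>]] by blast
    have h0: "0 < h y0" using y0(1) h_pos by (auto simp: cylinder_def)
    define C where "C = (\<kappa> (length w))\<^sup>2 * \<kappa> 1 / measure m (cylinder A [s])"
    define EL where "EL L = measure m {y \<in> cylinder A [s]. \<forall>i\<le>L. (shift ^^ i) y \<notin> cylinder A w}" for L
    \<comment> \<open>The factor \<open>\<bar>g t\<bar> + e / 5\<close> bounds
      \<open>a n * q p\<close> for large \<open>n\<close>.\<close>
    have "(\<lambda>L. C * EL L * (\<bar>g t\<bar> + e / 5)) \<longlonglongrightarrow> C * 0 * (\<bar>g t\<bar> + e / 5)"
      unfolding EL_def by (intro tendsto_intros late_hitting_tendsto_0[OF w(1,3) a(1)])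
    from order_tendstoD(2)[OF this, of "e / 5"] have "\<forall>\<^sub>F L in sequentially. C * EL L * (\<bar>g t\<bar> + e / 5) < e / 5"
      using e by simp
    then obtain L where L: "C * EL L * (\<bar>g t\<bar> + e / 5) < e / 5" using eventually_happens'[OF sequentially_bot] by blast
    have CE: "0 \<le> C * EL L" using kappa_ge_1[of 1] by (simp add: C_def EL_def)
    \<comment> \<open>\<open>n1\<close> makes \<open>length w\<close> at most \<open>t * n\<close>,
      as the window bound requires, and \<open>n2\<close> makes room for the delay:
      \<open>t' * n + L \<le> t2 * n\<close>.\<close>
    obtain n1 :: nat where n1: "real (length w) / t \<le> real n1" using real_arch_simple by blast
    obtain n2 :: nat where n2: "real L / (t2 - t') \<le> real n2" using real_arch_simple by blast
    show "\<forall>\<^sub>F n in sequentially. a n * measure \<mu> (\<Union>k\<in>{nat \<lfloor>t * real n\<rfloor><..nat \<lfloor>t' * real n\<rfloor>}.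
          first_return (cylinder A w) (cylinder A [s]) k)
        \<le> c * (t powr (- \<alpha>) - t' powr (- \<alpha>)) + e"
      using d1(2)[OF w(1,3) \<kappa>w(1)] d2(2)[OF w(1,3) \<kappa>w(2)] rv_pos[OF a(2,3) \<alpha>]
        eventually_ge_at_top[of n1] eventually_ge_at_top[of n2]
    proof eventually_elim
      case (elim n)
      define p where "p = nat \<lfloor>t * real n\<rfloor>"
      define r where "r = nat \<lfloor>t' * real n\<rfloor>"
      define r2 where "r2 = nat \<lfloor>t2 * real n\<rfloor>"
      define q where "q l = measure \<mu> (no_return (cylinder A w) l)" for l
      have "real (length w) / t \<le> real n" using elim n1 by (meson of_nat_mono order_trans)
      then have "real (length w) \<le> t * real n" using t by (simp add: pos_divide_le_eq mult.commute)
      then have p: "length w \<le> p" unfolding p_def by (rule le_nat_floor)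
      have pr: "p \<le> r" unfolding p_def r_def using t by (intro nat_mono floor_mono mult_right_mono) auto
      have "real L / (t2 - t') \<le> real n" using elim n2 by (meson of_nat_mono order_trans)
      then have "real L \<le> (t2 - t') * real n" using t2 by (simp add: pos_divide_le_eq mult.commute)
      then have "t' * real n + real L \<le> t2 * real n" by (simp add: algebra_simps)
      moreover have "0 \<le> t' * real n" using t'0 by simp
      then have "real r \<le> t' * real n" unfolding r_def by (simp add: of_nat_floor)
      ultimately have "real (r + L) \<le> t2 * real n" by simp
      then have rr: "r + L \<le> r2" unfolding r2_def by (rule le_nat_floor)
      have q2: "q r2 \<le> q (r + L)"
      proof -
        have "no_return (cylinder A w) (r + L) \<in> fmeasurable \<mu>"
        proof (rule fmeasurableI2)
          show "cylinder A w \<in> fmeasurable \<mu>"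
            using emeasure_mu_cylinder_finite[OF w(1) h0 y0(2) kappa_ge_1] by (intro fmeasurableI) auto
          show "no_return (cylinder A w) (r + L) \<subseteq> cylinder A w" by (auto simp: no_return_def)
        qed simp
        then show ?thesis unfolding q_def by (intro measure_mono_fmeasurable no_return_antimono[OF rr]) auto
      qed
      have an: "0 < a n" using elim by simp
      have "measure \<mu> (\<Union>k\<in>{p<..r}. first_return (cylinder A w) (cylinder A [s]) k)
          \<le> q p - q (r + L) + C * EL L * q p"
        unfolding q_def C_def EL_def
        by (rule first_return_window_bound[OF w(1,3,4) p pr h0 y0(2) kappa_ge_1])
      also have "\<dots> \<le> q p - q r2 + C * EL L * q p" using q2 by simp
      finally have "a n * measure \<mu> (\<Union>k\<in>{p<..r}. first_return (cylinder A w) (cylinder A [s]) k)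
          \<le> a n * (q p - q r2 + C * EL L * q p)" using an by (intro mult_left_mono) auto
      also have "\<dots> = a n * q p - a n * q r2 + C * EL L * (a n * q p)" by (simp add: algebra_simps)
      also have "\<dots> \<le> a n * q p - a n * q r2 + C * EL L * (\<bar>g t\<bar> + e / 5)"
      proof (intro add_left_mono mult_left_mono CE)
        show "a n * q p \<le> \<bar>g t\<bar> + e / 5" using elim(1) unfolding q_def p_def by linarith
      qed
      \<comment> \<open>Two fifths pay for the tails and one for late visits; moving from
        \<open>g t2\<close> to \<open>g t'\<close> takes a fourth.\<close>
      also have "\<dots> \<le> (g t + e / 5) - (g t2 - e / 5) + e / 5"
      proof -
        have "a n * q p \<le> g t + e / 5" "g t2 - e / 5 \<le> a n * q r2"
          using elim(1,2) unfolding q_def p_def r2_def by linarith+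
        then show ?thesis using L by linarith
      qed
      also have "\<dots> \<le> g t - g t' + e" using t2(1) e by linarith
      also have "\<dots> = c * (t powr (- \<alpha>) - t' powr (- \<alpha>)) + e" by (simp add: g_def right_diff_distrib)
      finally show ?case by (simp add: p_def r_def)
    qed
  qed
qed

end

section \<open>Limit laws\<close>

text \<open>As \<open>a\<close> is read at integer parts, the infimum is attained at an integer, and
  the strict inequality holds there. For \<open>y = 1 / b n\<close> this integer is the time scale
  \<open>M n\<close> below.\<close>

lemma right_inverse_eq_Least:
  assumes "incseq a" "filterlim a at_top sequentially"
  shows "right_inverse a y = real (LEAST k. y < a k)" "y < a (LEAST k. y < a k)"
proof -
  have "\<forall>\<^sub>F k in sequentially. y < a k" using assms(2) by (simp add: filterlim_at_top_dense)
  then obtain k where k: "y < a k" using eventually_happens'[OF sequentially_bot] by blast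
  show L: "y < a (LEAST k. y < a k)" by (rule LeastI[of "\<lambda>k. y < a k", OF k])
  show "right_inverse a y = real (LEAST k. y < a k)"
    unfolding right_inverse_def
  proof (rule cInf_eq_minimum)
    show "real (LEAST k. y < a k) \<in> {s. 0 \<le> s \<and> y < a (nat \<lfloor>s\<rfloor>)}" using L by simp
    fix s :: real assume "s \<in> {s. 0 \<le> s \<and> y < a (nat \<lfloor>s\<rfloor>)}"
    then have s: "0 \<le> s" "y < a (nat \<lfloor>s\<rfloor>)" by auto
    have "(LEAST k. y < a k) \<le> nat \<lfloor>s\<rfloor>" by (rule Least_le) (rule s(2))
    then show "real (LEAST k. y < a k) \<le> s" using s(1) by linarith
  qed
qed

text \<open>\<open>real_of_ereal\<close> sends an infinite return time to 0, so positivity forces a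
  finite one, at which the infimum is attained.\<close>

lemma return_time_cases:
  assumes "0 < real_of_ereal (ereal_of_enat (return_time C z))"
  obtains k where "return_time C z = enat k" "(shift ^^ k) z \<in> C" "\<And>i. i \<in> {1..<k} \<Longrightarrow> (shift ^^ i) z \<notin> C"
proof -
  let ?S = "{n. 1 \<le> n \<and> (shift ^^ n) z \<in> C}"
  obtain k where k: "return_time C z = enat k"
    using assms by (cases "return_time C z") auto
  have "?S \<noteq> {}"
  proof
    assume "?S = {}"
    then have "return_time C z = Inf (enat ` {})" unfolding return_time_def by (simp only:)
    then have "return_time C z = \<infinity>" by (simp add: Inf_enat_def)
    then show False using k by simp
  qed
  then obtain n where "n \<in> ?S" by blast
  then have "Inf (enat ` ?S) \<in> enat ` ?S" by (intro wellorder_InfI[of "enat n"]) auto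
  then have "(shift ^^ k) z \<in> C" using k by (auto simp: return_time_def)
  moreover have "(shift ^^ i) z \<notin> C" if "i \<in> {1..<k}" for i
  proof
    assume "(shift ^^ i) z \<in> C"
    then have "return_time C z \<le> enat i" unfolding return_time_def using that by (intro Inf_lower) auto
    then show False using that by (simp add: k)
  qed
  ultimately show thesis using that k by blast
qed

text \<open>No measurability of \<open>f\<close> is needed: \<open>distr M N f\<close> is the zero measure when the image
  formula does not define a measure.\<close>

lemma emeasure_distr_le:
  assumes "T \<in> sets M" "f -` S \<inter> space M \<subseteq> T"
  shows "emeasure (distr M N f) S \<le> emeasure M T"
proof -
  have "emeasure (distr M N f) S \<le> emeasure M (f -` S \<inter> space M)"
    unfolding distr_def emeasure_measure_of_conv by simp
  also have "\<dots> \<le> emeasure M T" by (rule emeasure_mono[OF assms(2,1)])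
  finally show ?thesis .
qed

text \<open>Weak convergence speaks only about continuity points of the cdf. The other points are
  countable, so \<open>t\<close> and \<open>s\<close> can be approached from the right through
  continuity points, and the cdf is right-continuous.\<close>

lemma cdf_increment_le_of_continuity_points:
  fixes G :: "real \<Rightarrow> real"
  assumes \<nu>: "finite_borel_measure \<nu>" and G: "continuous_on {0<..} G"
    and le: "\<And>t s. 0 < t \<Longrightarrow> t < s \<Longrightarrow> isCont (cdf \<nu>) t \<Longrightarrow> isCont (cdf \<nu>) s \<Longrightarrow> cdf \<nu> s - cdf \<nu> t \<le> G t - G s"
    and ts: "0 < t" "t < s"
  shows "cdf \<nu> s - cdf \<nu> t \<le> G t - G s"
proof (rule field_le_epsilon)
  interpret finite_borel_measure \<nu> by (rule \<nu>)
  fix e :: real assume e: "0 < e"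
  \<comment> \<open>In terms of \<open>H\<close> the claim reads
    \<open>H s \<le> H t\<close>.\<close>
  define H where "H r = cdf \<nu> r + G r" for r
  have H: "(H \<longlongrightarrow> H r) (at_right r)" if "0 < r" for r
  proof -
    have "(G \<longlongrightarrow> G r) (at r)" using continuous_on_interior[OF G, of r] that by (simp add: isCont_def interior_open)
    then have "(G \<longlongrightarrow> G r) (at_right r)" by (rule tendsto_within_subset) simp
    then show ?thesis unfolding H_def[abs_def]
      using cdf_is_right_cont[of r] by (intro tendsto_add) (simp_all add: continuous_within)
  qed
  have disc: "countable {r. \<not> isCont (cdf \<nu>) r}" by (rule mono_ctble_discont[OF monoI[OF cdf_nondecreasing]])
  have pick: "\<exists>r. a < r \<and> r < b \<and> isCont (cdf \<nu>) r \<and> \<bar>H r - H a\<bar> < e / 2" if "0 < a" "a < b" for a b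
  proof -
    have "\<forall>\<^sub>F r in at_right a. \<bar>H r - H a\<bar> < e / 2" using tendstoD[OF H[OF that(1)], of "e / 2"] e by (simp add: dist_real_def)
    then obtain b' where b': "a < b'" "\<And>r. a < r \<Longrightarrow> r < b' \<Longrightarrow> \<bar>H r - H a\<bar> < e / 2"
      by (auto simp: eventually_at_right_field)
    have "a < min b b'" using that b' by simp
    from real_interval_avoid_countable_set[OF this disc] obtain r
      where "r \<in> {a<..<min b b'}" "r \<notin> {r. \<not> isCont (cdf \<nu>) r}" by blast
    then show ?thesis using b' by auto
  qed
  obtain t' where t': "t < t'" "t' < s" "isCont (cdf \<nu>) t'" "\<bar>H t' - H t\<bar> < e / 2" using pick[OF ts] by blast
  obtain s' where s': "s < s'" "isCont (cdf \<nu>) s'" "\<bar>H s' - H s\<bar> < e / 2" using pick[of s "s + 1"] ts by auto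
  have "H s' \<le> H t'" using le[of t' s'] t' s' ts by (simp add: H_def)
  then have "H s \<le> H t + e" using t' s' by linarith
  then show "cdf \<nu> s - cdf \<nu> t \<le> G t - G s + e" by (simp add: H_def)
qed

section \<open>The laws of the rescaled return times\<close>

context rpf_measure begin

lemma emeasure_mu_cylinder_finite_of_normalizing:
  assumes w: "w \<noteq> []" and a: "normalizing_sequence \<mu> shift a" "\<forall>\<^sub>F n in sequentially. 0 < a n"
  shows "emeasure \<mu> (cylinder A w) < \<infinity>"
proof (cases "measure m (cylinder A w) = 0")
  case True
  then have "emeasure m (cylinder A w) = 0"
    using emeasure_eq_ennreal_measure[of m "cylinder A w"] finite_cylinder[OF w] by simp
  then show ?thesis using emeasure_mu_eq_0_iff[of "cylinder A w"] by simp
next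
  case False
  then have "0 < measure m (cylinder A w)" by (simp add: zero_less_measure_iff)
  then obtain y0 where y0: "y0 \<in> cylinder A w"
      "AE y in m. y \<in> cylinder A w \<longrightarrow> h y \<le> \<kappa> (length w) * h y0 \<and> h y0 \<le> \<kappa> (length w) * h y"
    using cylinder_reference_point[OF w _ a] by blast
  have h0: "0 < h y0" using y0(1) h_pos by (auto simp: cylinder_def)
  show ?thesis by (rule emeasure_mu_cylinder_finite[OF w h0 y0(2) kappa_ge_1])
qed

text \<open>The cylinders shrink to \<open>{x}\<close>. Almost every point of \<open>[x 0]\<close>
  returns there infinitely often and \<open>x\<close> does not, so \<open>{x}\<close> is
  null.\<close>

lemma cylinder_prefix_measure_tendsto_0:
  assumes a: "normalizing_sequence \<mu> shift a" "\<forall>\<^sub>F n in sequentially. 0 < a n"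
    and x: "x \<in> \<Omega>" "finite {k. (shift ^^ k) x \<in> cylinder A [x 0]}"
  shows "(\<lambda>n. measure \<mu> (cylinder A (map x [0..<n]))) \<longlonglongrightarrow> 0"
proof -
  \<comment> \<open>The words start at length 1, as the empty word yields the whole space, which has
    infinite mass.\<close>
  define C where "C n = cylinder A (map x [0..<Suc n])" for n
  have C_mem: "y \<in> C n \<longleftrightarrow> y \<in> \<Omega> \<and> (\<forall>i\<le>n. y i = x i)" for y n
    by (auto simp: C_def cylinder_def less_Suc_eq_le simp del: upt_Suc)
  have "(\<lambda>n. measure \<mu> (C n)) \<longlonglongrightarrow> measure \<mu> (\<Inter>n. C n)"
  proof (rule Lim_measure_decseq)
    show "range C \<subseteq> sets \<mu>" by (auto simp: C_def)
    show "decseq C" unfolding decseq_def by (auto simp: C_mem)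
    show "emeasure \<mu> (C n) \<noteq> \<infinity>" for n
      using emeasure_mu_cylinder_finite_of_normalizing[OF _ a, of "map x [0..<Suc n]"] by (simp add: C_def)
  qed
  moreover have "measure \<mu> (\<Inter>n. C n) = 0"
  proof -
    have sets: "(\<Inter>n. C n) \<in> sets \<B>" by (intro sets.countable_INT'[of UNIV]) (auto simp: C_def)
    have "AE y in m. y \<notin> (\<Inter>n. C n)"
      using AE_recurrent[OF cylinder_sets[of "[x 0]"]]
    proof eventually_elim
      case (elim y)
      show ?case
      proof
        assume "y \<in> (\<Inter>n. C n)"
        then have "y \<in> C n" for n by simp
        then have "y i = x i" for i using C_mem[of y i] by auto
        then have "y = x" by auto
        moreover have "x \<in> cylinder A [x 0]" using x by (simp add: cylinder_def)
        ultimately have "\<forall>k. \<exists>i\<ge>k. (shift ^^ i) x \<in> cylinder A [x 0]" using elim by simp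
        then have "infinite {k. (shift ^^ k) x \<in> cylinder A [x 0]}" by (simp add: infinite_nat_iff_unbounded_le)
        then show False using x by simp
      qed
    qed
    then have "emeasure m (\<Inter>n. C n) = 0" using AE_iff_null_sets[of "\<Inter>n. C n" m] sets by auto
    then have "emeasure \<mu> (\<Inter>n. C n) = 0" using emeasure_mu_eq_0_iff[OF sets] by simp
    then show ?thesis by (simp add: measure_def)
  qed
  ultimately have "(\<lambda>n. measure \<mu> (C n)) \<longlonglongrightarrow> 0" by simp
  then show ?thesis unfolding C_def by (rule LIMSEQ_imp_Suc)
qed

lemma return_law_window_bound:
  assumes a: "normalizing_sequence \<mu> shift a" "incseq a" "regularly_varying a \<alpha>" and \<alpha>: "0 < \<alpha>" "\<alpha> \<le> 1"
    and x: "x \<in> \<Omega>" "finite {k. (shift ^^ k) x \<in> cylinder A [x 0]}" "(shift ^^ j) x \<in> cylinder A [x 0]"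
    and t: "0 < t" "t < s" and e: "0 < e"
  defines "B \<equiv> \<lambda>n. cylinder A (map x [0..<n])"
  defines "law \<equiv> \<lambda>n. distr (uniform_measure \<mu> (B n)) borel
              (\<lambda>y. scaling a (measure \<mu> (B n)) *
                 real_of_ereal (ereal_of_enat (return_time (cylinder A [x 0]) ((shift ^^ j) y))))"
  shows "\<forall>\<^sub>F n in sequentially. measure (law n) {t<..s}
    \<le> sin (pi * \<alpha>) / (pi * \<alpha>) * (t powr (- \<alpha>) - s powr (- \<alpha>)) + e"
proof -
  define c where "c = sin (pi * \<alpha>) / (pi * \<alpha>)"
  let ?Y = "cylinder A [x 0]"
  have apos: "\<forall>\<^sub>F n in sequentially. 0 < a n" by (rule rv_pos[OF a(2,3) \<alpha>])
  have c: "0 \<le> c"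
    using \<alpha> sin_ge_zero[of "pi * \<alpha>"] mult_left_mono[of \<alpha> 1 pi] by (simp add: c_def)
  have rhs: "0 \<le> c * (t powr (- \<alpha>) - s powr (- \<alpha>)) + e"
    using t \<alpha> c e powr_mono2'[of "- \<alpha>" t s] by (intro add_nonneg_nonneg mult_nonneg_nonneg) auto
  have Bsets: "B n \<in> sets \<mu>" for n by (simp add: B_def)
  have \<Omega>: "\<Omega> \<in> sets \<B>" using sets.top[of \<B>] by simp
  have Bfin: "emeasure \<mu> (B n) < \<infinity>" if "1 \<le> n" for n
    unfolding B_def using that by (intro emeasure_mu_cylinder_finite_of_normalizing[OF _ a(1) apos]) auto
  define b where "b n = measure \<mu> (B n)" for n
  have Bb: "emeasure \<mu> (B n) = ennreal (b n)" if "1 \<le> n" for n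
    unfolding b_def using Bfin[OF that] by (intro emeasure_eq_ennreal_measure) auto
  have blim: "b \<longlonglongrightarrow> 0"
    unfolding b_def[abs_def] B_def by (rule cylinder_prefix_measure_tendsto_0[OF a(1) apos x(1,2)])
  show ?thesis
  \<comment> \<open>If some \<open>B n\<close> is null, so are all later ones;
    \<open>uniform_measure\<close> is then zero since \<open>0 / 0 = 0\<close> in
    \<open>ennreal\<close>, and the laws carry no mass.\<close>
  proof (cases "\<exists>n\<ge>1. b n = 0")
    case True
    then obtain n0 where n0: "1 \<le> n0" "b n0 = 0" by blast
    show ?thesis using eventually_ge_at_top[of n0]
    proof eventually_elim
      case (elim n)
      have "emeasure \<mu> (B n) \<le> emeasure \<mu> (B n0)"
      proof (rule emeasure_mono[OF _ Bsets])
        show "B n \<subseteq> B n0" using elim by (auto simp: B_def cylinder_def)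
      qed
      then have z: "emeasure \<mu> (B n) = 0" using Bb[OF n0(1)] n0 by simp
      have "emeasure (law n) {t<..s} \<le> emeasure (uniform_measure \<mu> (B n)) (space (uniform_measure \<mu> (B n)))"
        unfolding law_def by (rule emeasure_distr_le) (auto simp: \<Omega>)
      also have "\<dots> = emeasure \<mu> (B n \<inter> space \<mu>) / emeasure \<mu> (B n)"
        using Bsets \<Omega> by simp
      also have "emeasure \<mu> (B n \<inter> space \<mu>) = 0" unfolding sets.Int_space_eq2[OF Bsets] by (rule z)
      finally have "measure (law n) {t<..s} = 0" by (simp add: measure_def)
      then show ?case using rhs by (simp add: c_def)
    qed
  next
    case False
    then have bpos: "0 < b n" if "1 \<le> n" for n using that by (auto simp: b_def zero_less_measure_iff)
    obtain N where N: "\<And>w s'. w \<noteq> [] \<Longrightarrow> N \<le> length w \<Longrightarrow> 0 < measure m (cylinder A w) \<Longrightarrow> w ! 0 = s' \<Longrightarrow>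
      \<forall>\<^sub>F n in sequentially. a n * measure \<mu> (\<Union>k\<in>{nat \<lfloor>t * real n\<rfloor><..nat \<lfloor>s * real n\<rfloor>}.
          first_return (cylinder A w) (cylinder A [s']) k)
        \<le> c * (t powr (- \<alpha>) - s powr (- \<alpha>)) + e"
      using first_return_window_limit[OF a \<alpha> t e] unfolding c_def by blast
    \<comment> \<open>The prefix of \<open>(shift ^^ j) x\<close> of length \<open>N + 1\<close>; it
      begins with \<open>x 0\<close> because \<open>j\<close> is a visiting time, so its cylinder
      lies in \<open>[x 0]\<close>.\<close>
    define w where "w = map x [j..<j + Suc N]"
    have lw: "length w = Suc N" by (simp add: w_def)
    have w1: "w \<noteq> []" "N \<le> length w" using lw by auto
    have w0: "w ! 0 = x 0" using x(3) by (simp add: w_def cylinder_def funpow_shift del: upt_Suc)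
    have Bw: "(shift ^^ j) y \<in> cylinder A w" if "y \<in> B n" "j + Suc N \<le> n" for y n
    proof -
      have "y \<in> \<Omega>" "\<And>i. i < n \<Longrightarrow> y i = x i" using that by (auto simp: B_def cylinder_def)
      then show ?thesis using that shift_space_funpow[of y A j]
        by (auto simp: cylinder_def w_def funpow_shift add.commute simp del: upt_Suc)
    qed
    \<comment> \<open>The preimage of the cylinder under \<open>shift ^^ j\<close> contains some
      \<open>B n\<close> of positive mass, and \<mu> is invariant.\<close>
    have mw: "0 < measure m (cylinder A w)"
    proof -
      let ?n = "j + Suc N"
      have "emeasure \<mu> (B ?n) \<le> emeasure \<mu> ((shift ^^ j) -` cylinder A w \<inter> \<Omega>)"
      proof (rule emeasure_mono)
        have "B ?n \<subseteq> \<Omega>" by (auto simp: B_def cylinder_def)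
        then show "B ?n \<subseteq> (shift ^^ j) -` cylinder A w \<inter> \<Omega>" using Bw[of _ ?n] by blast
      qed simp
      also have "\<dots> = emeasure \<mu> (cylinder A w)" by (rule emeasure_mu_vimage_shift) simp
      finally have "ennreal (b ?n) \<le> emeasure \<mu> (cylinder A w)" using Bb[of ?n] by simp
      then have "emeasure \<mu> (cylinder A w) \<noteq> 0" using bpos[of ?n] by auto
      then have "emeasure m (cylinder A w) \<noteq> 0" using emeasure_mu_eq_0_iff[of "cylinder A w"] by simp
      then have "measure m (cylinder A w) \<noteq> 0" 
        using emeasure_eq_ennreal_measure[of m "cylinder A w"] finite_cylinder[OF w1(1)] by (auto simp: less_top)
      then show ?thesis by (simp add: zero_less_measure_iff)
    qed
    define W where "W n = (\<Union>k\<in>{nat \<lfloor>t * real n\<rfloor><..nat \<lfloor>s * real n\<rfloor>}. first_return (cylinder A w) ?Y k)" for n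
    have W: "\<forall>\<^sub>F n in sequentially. a n * measure \<mu> (W n) \<le> c * (t powr (- \<alpha>) - s powr (- \<alpha>)) + e"
      unfolding W_def by (rule N[OF w1 mw w0])
    have Wsets [measurable]: "W n \<in> sets \<B>" for n unfolding W_def by measurable
    have Wfin: "emeasure \<mu> (W n) < \<infinity>" for n
    proof -
      have "emeasure \<mu> (W n) \<le> emeasure \<mu> (cylinder A w)" by (rule emeasure_mono) (auto simp: W_def first_return_def)
      also have "\<dots> < \<infinity>" by (rule emeasure_mu_cylinder_finite_of_normalizing[OF w1(1) a(1) apos])
      finally show ?thesis .
    qed
    have atop: "filterlim a at_top sequentially" by (rule rv_at_top[OF a(2,3) \<alpha>])
    define M where "M n = (LEAST k. 1 / b n < a k)" for n
    note M = right_inverse_eq_Least[OF a(2) atop, of "1 / b _", folded M_def]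
    have Mlim: "filterlim M at_top sequentially"
      unfolding filterlim_at_top
    proof
      fix Z :: nat
      define C where "C = max 1 (a Z)"
      have "\<forall>\<^sub>F n in sequentially. b n < 1 / C" using blim by (intro order_tendstoD) (auto simp: C_def)
      then show "\<forall>\<^sub>F n in sequentially. Z \<le> M n" using eventually_ge_at_top[of 1]
      proof eventually_elim
        case (elim n)
        have "C < 1 / b n" 
        proof -
          have "0 < C" "0 < b n" using elim bpos[of n] by (auto simp: C_def)
          then show ?thesis using elim(1) by (simp add: pos_less_divide_eq mult.commute)
        qed
        then have "a Z < a (M n)" using M(2)[of n] by (simp add: C_def)
        then show ?case using incseqD[OF a(2), of "M n" Z] by (meson leD le_cases)
      qed
    qed
    show ?thesis using eventually_compose_filterlim[OF W Mlim] eventually_ge_at_top[of "j + Suc N"]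
    proof eventually_elim
      case (elim n)
      let ?R = "\<lambda>y. real_of_ereal (ereal_of_enat (return_time ?Y ((shift ^^ j) y)))"
      have n1: "1 \<le> n" using elim by simp
      have sc: "scaling a (b n) = 1 / real (M n)" by (simp add: scaling_def M)
      \<comment> \<open>The points of \<open>B n\<close> whose position at time \<open>j\<close>
        lies in the window event; forgetting \<open>B n\<close>, invariance bounds the mass of
        \<open>D\<close> by that of \<open>W (M n)\<close>.\<close>
      define D where "D = B n \<inter> ((shift ^^ j) -` W (M n) \<inter> \<Omega>)"
      have D: "D \<in> sets \<mu>" unfolding D_def using Bsets by auto
      have "(\<lambda>y. scaling a (b n) * ?R y) -` {t<..s} \<inter> B n \<subseteq> D"
      proof
        fix y assume y: "y \<in> (\<lambda>y. scaling a (b n) * ?R y) -` {t<..s} \<inter> B n"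
        then have tR: "t < ?R y / real (M n)" "?R y / real (M n) \<le> s" by (auto simp: sc)
        have M0: "0 < real (M n)" using tR t by (cases "M n = 0") auto
        have "t * real (M n) < ?R y" "?R y \<le> s * real (M n)"
          using tR M0 by (auto simp: pos_less_divide_eq pos_divide_le_eq)
        moreover have "0 < t * real (M n)" using t M0 by simp
        ultimately have R: "0 < ?R y" "t * real (M n) < ?R y" "?R y \<le> s * real (M n)" by linarith+
        obtain k where k: "return_time ?Y ((shift ^^ j) y) = enat k" "(shift ^^ k) ((shift ^^ j) y) \<in> ?Y"
          "\<And>i. i \<in> {1..<k} \<Longrightarrow> (shift ^^ i) ((shift ^^ j) y) \<notin> ?Y"
          using return_time_cases[OF R(1)] by blast
        have Rk: "?R y = real k" by (simp add: k(1))
        have "k \<in> {nat \<lfloor>t * real (M n)\<rfloor><..nat \<lfloor>s * real (M n)\<rfloor>}"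
          using R(2,3) \<open>0 < t * real (M n)\<close> unfolding Rk by (auto intro: le_nat_floor simp: nat_less_iff floor_less_iff)
        moreover have "(shift ^^ j) y \<in> first_return (cylinder A w) ?Y k"
          using k(2,3) Bw[of y n] y elim by (auto simp: first_return_def cylinder_def[of A w])
        ultimately have "(shift ^^ j) y \<in> W (M n)" unfolding W_def by blast
        then show "y \<in> D" using y by (auto simp: D_def B_def cylinder_def)
      qed
      \<comment> \<open>Outside \<open>B n\<close> the map is not controlled, but
        \<open>uniform_measure\<close> has no mass there, so \<open>\<Omega> - B n\<close> may be
        added.\<close>
      then have sub: "(\<lambda>y. scaling a (b n) * ?R y) -` {t<..s} \<inter> space (uniform_measure \<mu> (B n)) \<subseteq> D \<union> (\<Omega> - B n)"
        by auto
      have "emeasure (law n) {t<..s} \<le> emeasure (uniform_measure \<mu> (B n)) (D \<union> (\<Omega> - B n))"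
        unfolding law_def b_def[symmetric] by (rule emeasure_distr_le[OF _ sub]) (use D Bsets \<Omega> in auto)
      also have "\<dots> = emeasure \<mu> (B n \<inter> (D \<union> (\<Omega> - B n))) / emeasure \<mu> (B n)"
        using D Bsets \<Omega> by (intro emeasure_uniform_measure) auto
      also have "B n \<inter> (D \<union> (\<Omega> - B n)) = D" by (auto simp: D_def)
      also have "emeasure \<mu> D / emeasure \<mu> (B n) \<le> emeasure \<mu> (W (M n)) / ennreal (b n)"
      proof -
        have "emeasure \<mu> D \<le> emeasure \<mu> ((shift ^^ j) -` W (M n) \<inter> \<Omega>)"
          by (rule emeasure_mono) (auto simp: D_def)
        also have "\<dots> = emeasure \<mu> (W (M n))" by (rule emeasure_mu_vimage_shift) simp
        finally show ?thesis unfolding Bb[OF n1] by (rule divide_right_mono_ennreal)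
      qed
      also have "\<dots> = ennreal (measure \<mu> (W (M n)) / b n)"
        using Wfin[of "M n"] bpos[OF n1] by (simp add: emeasure_eq_ennreal_measure less_top[symmetric] divide_ennreal)
      finally have "measure (law n) {t<..s} \<le> measure \<mu> (W (M n)) / b n"
        unfolding measure_def[of "law n"] using bpos[OF n1] by (intro enn2real_leI) auto
      also have "\<dots> = 1 / b n * measure \<mu> (W (M n))" by simp
      \<comment> \<open>Defining property of the time scale:
        \<open>1 / b n < a (M n)\<close>.\<close>
      also have "\<dots> \<le> a (M n) * measure \<mu> (W (M n))" using M(2)[of n] by (intro mult_right_mono) auto
      also have "\<dots> \<le> c * (t powr (- \<alpha>) - s powr (- \<alpha>)) + e" using elim by simp
      finally show ?case by (simp add: c_def)
    qed
  qed
qed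

end

theorem proposition5p1:
  fixes A :: "'v::countable \<Rightarrow> 'v \<Rightarrow> bool"
    and \<eta> \<alpha> :: real
    and \<phi> :: "(nat \<Rightarrow> 'v) \<Rightarrow> real"
    and \<mu> :: "(nat \<Rightarrow> 'v) measure"
    and a :: "nat \<Rightarrow> real"
    and x :: "nat \<Rightarrow> 'v"
    and B :: "nat \<Rightarrow> (nat \<Rightarrow> 'v) set"
    and j :: nat
    and \<nu> :: "real measure"
  assumes "infinite (UNIV :: 'v set)"
    and "0 < \<eta>" and "\<eta> < 1"
    and "topologically_mixing A"
    and "\<phi> \<in> borel_measurable (shift_borel \<eta> A)"
    and "walters_condition A \<phi>"
    and "gurevich_pressure A \<phi> < \<infinity>"
    and "null_recurrent A \<phi>"
    and "associated_measure \<eta> A \<phi> \<mu>"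
    and "0 < \<alpha>" and "\<alpha> \<le> 1"
    and "incseq a"
    and "normalizing_sequence \<mu> shift a"
    and "regularly_varying a \<alpha>"
    and "x \<in> shift_space A"
    and "\<And>n. B n = cylinder A (map x [0..<n])"
    and "finite {k. (shift ^^ k) x \<in> cylinder A [x 0]}"
    and "j = Max {k. (shift ^^ k) x \<in> cylinder A [x 0]}"
    and "real_distribution \<nu>" and "measure \<nu> {..<0} = 0"
    and "weak_conv_m
           (\<lambda>n. distr (uniform_measure \<mu> (B n)) borel
              (\<lambda>y. scaling a (measure \<mu> (B n)) *
                 real_of_ereal (ereal_of_enat (return_time (cylinder A [x 0]) ((shift ^^ j) y)))))
           \<nu>"
  shows "\<nu> \<in> G_class \<alpha>"
proof -
  obtain h m where hm: "rpf_pair \<eta> A \<phi> h m" "\<mu> = density m (\<lambda>x. ennreal (h x))"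
    using assms(9) by (auto simp: associated_measure_def)
  interpret R: rpf_measure \<eta> A \<phi> h m
    by standard (use assms(2,3,5,6) hm(1) in auto)
  have mu: "\<mu> = R.\<mu>" by (simp add: hm(2) R.\<mu>_def)
  interpret \<nu>: real_distribution \<nu> by (rule assms(19))
  have \<alpha>: "0 < \<alpha>" "\<alpha> \<le> 1" by fact+
  define G where "G t = sin (pi * \<alpha>) / (pi * \<alpha>) * t powr (- \<alpha>)" for t
  have xY: "x \<in> cylinder A [x 0]" using assms(15) by (simp add: cylinder_def)
  have jY: "(shift ^^ j) x \<in> cylinder A [x 0]"
  proof -
    have "0 \<in> {k. (shift ^^ k) x \<in> cylinder A [x 0]}" using xY by simp
    then have "j \<in> {k. (shift ^^ k) x \<in> cylinder A [x 0]}"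
      unfolding assms(18) using assms(17) by (intro Max_in) blast+
    then show ?thesis by simp
  qed
  define law where "law n = distr (uniform_measure \<mu> (B n)) borel
      (\<lambda>y. scaling a (measure \<mu> (B n)) *
         real_of_ereal (ereal_of_enat (return_time (cylinder A [x 0]) ((shift ^^ j) y))))" for n
  have window: "\<forall>\<^sub>F n in sequentially. measure (law n) {t<..s} \<le> G t - G s + e"
    if "0 < t" "t < s" "0 < e" for t s e
    using R.return_law_window_bound[OF assms(13)[unfolded mu] assms(12,14) \<alpha> assms(15,17) jY that]
    by (simp add: law_def assms(16) mu G_def right_diff_distrib)
  \<comment> \<open>Allows the mass of \<open>{t<..s}\<close> to be written as a difference of cdf
    values. If \<open>B n\<close> has mass 0 or \<infinity>, the quotient below is 0 in
    \<open>ennreal\<close>.\<close>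
  have fin: "finite_borel_measure (law n)" for n
  proof (intro finite_borel_measure.intro finite_measureI finite_borel_measure_axioms.intro)
    show "sets (law n) = sets borel" by (simp add: law_def)
    have Bn: "B n \<in> sets \<mu>" by (simp add: assms(16) mu)
    have "emeasure (law n) (space (law n)) \<le> emeasure (uniform_measure \<mu> (B n)) (space (uniform_measure \<mu> (B n)))"
      unfolding law_def by (rule emeasure_distr_le[OF sets.top]) simp
    also have "\<dots> = emeasure \<mu> (B n) / emeasure \<mu> (B n)"
      using emeasure_uniform_measure[OF Bn sets.top] sets.Int_space_eq2[OF Bn] by simp
    also have "\<dots> < \<infinity>"
    proof (cases "emeasure \<mu> (B n) = 0 \<or> emeasure \<mu> (B n) = \<infinity>")
      case False
      then have "emeasure \<mu> (B n) / emeasure \<mu> (B n) = 1"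
        by (intro ennreal_divide_self) (auto simp: less_top)
      then show ?thesis by simp
    qed auto
    finally show "emeasure (law n) (space (law n)) \<noteq> \<infinity>" by simp
  qed
  have conv: "(\<lambda>n. cdf (law n) t) \<longlonglongrightarrow> cdf \<nu> t" if "isCont (cdf \<nu>) t" for t
    using assms(21) that unfolding weak_conv_m_def weak_conv_def law_def by blast
  have cont: "cdf \<nu> s - cdf \<nu> t \<le> G t - G s"
    if ts: "0 < t" "t < s" "isCont (cdf \<nu>) t" "isCont (cdf \<nu>) s" for t s
  proof (rule field_le_epsilon)
    fix e :: real assume e: "0 < e"
    have "(\<lambda>n. cdf (law n) s - cdf (law n) t) \<longlonglongrightarrow> cdf \<nu> s - cdf \<nu> t"
      using ts by (intro tendsto_diff conv)
    moreover have "\<forall>\<^sub>F n in sequentially. cdf (law n) s - cdf (law n) t \<le> G t - G s + e"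
      using window[OF ts(1,2) e]
      by eventually_elim (simp add: finite_borel_measure.cdf_diff_eq[OF fin ts(2)])
    ultimately show "cdf \<nu> s - cdf \<nu> t \<le> G t - G s + e"
      by (intro tendsto_upperbound[OF _ _ sequentially_bot])
  qed
  have G: "continuous_on {0<..} G" unfolding G_def[abs_def] by (intro continuous_intros) auto
  have incr: "cdf \<nu> s - cdf \<nu> t \<le> G t - G s" if "0 < t" "t < s" for t s
    by (rule cdf_increment_le_of_continuity_points[OF \<nu>.finite_borel_measure_axioms G cont that])
  have c: "0 \<le> sin (pi * \<alpha>) / (pi * \<alpha>)"
    using \<alpha> sin_ge_zero[of "pi * \<alpha>"] mult_left_mono[of \<alpha> 1 pi] by simp
  \<comment> \<open>Let \<open>s\<close> tend to infinity in the increment bound and drop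
    \<open>G s\<close>, which is nonnegative.\<close>
  have tail: "measure \<nu> {t<..} \<le> G t" if t: "0 < t" for t
  proof -
    have "measure \<nu> {t<..} = 1 - cdf \<nu> t"
      using \<nu>.prob_compl[of "{..t}"] by (simp add: cdf_def Compl_eq_Diff_UNIV[symmetric] Compl_atMost)
    moreover have "1 - cdf \<nu> t \<le> G t"
    proof (rule tendsto_upperbound)
      show "((\<lambda>s. cdf \<nu> s - cdf \<nu> t) \<longlongrightarrow> 1 - cdf \<nu> t) at_top"
        using \<nu>.cdf_lim_at_top_prob by (intro tendsto_intros)
      show "\<forall>\<^sub>F s in at_top. cdf \<nu> s - cdf \<nu> t \<le> G t"
        using eventually_gt_at_top[of t]
      proof eventually_elim
        case (elim s)
        have "0 \<le> G s" unfolding G_def using c by (intro mult_nonneg_nonneg) auto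
        then show ?case using incr[OF t elim] by simp
      qed
    qed simp
    ultimately show ?thesis by simp
  qed
  show ?thesis
    unfolding G_class_def
  proof (intro CollectI conjI allI impI)
    show "real_distribution \<nu>" "measure \<nu> {..<0} = 0" by fact+
    fix t s :: real assume "0 < t \<and> t < s"
    then have t: "0 < t" "t < s" by auto
    show "measure \<nu> {t<..} \<le> min 1 (sin (pi * \<alpha>) / (pi * \<alpha>) * t powr (- \<alpha>))"
      using tail[OF t(1)] \<nu>.prob_le_1 by (simp add: G_def)
    show "measure \<nu> {t<..s} \<le> sin (pi * \<alpha>) / (pi * \<alpha>) * (t powr (- \<alpha>) - s powr (- \<alpha>))"
      using incr[OF t] \<nu>.cdf_diff_eq[OF t(2)] by (simp add: G_def right_diff_distrib)
  qed
qed

end
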